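(* Let $\mathcal{A}$ be a weakly idempotent complete exact category and $(\mathcal{X},\mathcal{Y})$ a hereditary complete cotorsion pair in $\mathcal{A}$ with $\omega=\mathcal{X}\cap\mathcal{Y}$ contravariantly finite in $\mathcal{A}$. Then the model structure $(\mathrm{CoFib}_\omega,\mathrm{Fib}_\omega,\mathrm{Weq}_\omega)$ on $\mathcal{A}$ (defined in the context) is exact if and only if $\mathcal{A}$ has enough projective objects and $\omega=\mathcal{P}$, the class of projective objects of $\mathcal{A}$.
   Context: Exact categories are in the sense of Quillen, with conflations $X\xrightarrow{i}Y\xrightarrow{d}Z$, inflations $i$, deflations $d$; $0\to X\to Y\to Z\to 0$ is then called an admissible exact sequence. $\mathcal{A}$ is weakly idempotent complete if every splitting epimorphism is a deflation. $\operatorname{Ext}^1_{\mathcal{A}}$ is the Yoneda Ext of the exact structure. An object $P$ is projective if $\operatorname{Hom}_{\mathcal{A}}(P,d)$ is surjective for every deflation $d$; $\mathcal{A}$ has enough projective objects if every object $X$ admits a deflation $P\to X$ with $P$ projective. $\mathrm{CoFib}_\omega$ is the class of inflations $f$ with $\operatorname{Coker} f\in\mathcal{X}$. $\mathrm{Fib}_\omega$ is the class of morphisms $f:A\to B$ such that $\operatorname{Hom}_{\mathcal{A}}(W,f)$ is surjective for every $W\in\omega$. $\mathrm{Weq}_\omega$ is the class of morphisms $f:A\to B$ for which there exist $W\in\omega$ and $t:W\to B$ such that $(f,t):A\oplus W\to B$ is a deflation with $\operatorname{Ker}(f,t)\in\mathcal{Y}$. Under the hypotheses of the claim, these form a model structure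 on $\mathcal{A}$, i.e. they satisfy the two out of three, retract, lifting and factorization axioms: if two of $f,g,gf$ are in $\mathrm{Weq}$ so is the third; each class is closed under retracts; cofibrations lift on the left against $\mathrm{Fib}\cap\mathrm{Weq}$ and $\mathrm{CoFib}\cap\mathrm{Weq}$ lifts on the left against fibrations; every morphism factors as an element of $\mathrm{CoFib}\cap\mathrm{Weq}$ followed by one of $\mathrm{Fib}$, and as an element of $\mathrm{CoFib}$ followed by one of $\mathrm{Fib}\cap\mathrm{Weq}$. An object $X$ is cofibrant if $0\to X$ is a cofibration and fibrant if $X\to0$ is a fibration. A model structure on an exact category is exact if cofibrations are precisely the inflations with cofibrant cokernel and fibrations are precisely the deflations with fibrant kernel. A cotorsion pair is a pair $(\mathcal{C},\mathcal{F})$ of classes of objects with $\mathcal{C}=\{X\mid\operatorname{Ext}^1_{\mathcal{A}}(X,F)=0\ \forall F\in\mathcal{F}\}$ and $\mathcal{F}=\{Y\mid\operatorname{Ext}^1_{\mathcal{A}}(C,Y)=0\ \forall C\in\mathcal{C}\}$. It is complete if for every object $X$ there are admissible exact sequences $0\to F\to C\to X\to 0$ and $0\to X\to F'\to C'\to 0$ with $C,C'\in\mathcal{C}$, $F,F'\in\mathcal{F}$. It is hereditary if $\mathcal{C}$ is closed under kernels of deflations and $\mathcal{F}$ is closed under cokernels of inflations. A full subcategory $\omega$ is contravariantly finite in $\mathcal{A}$ if every object $B$ admits a morphism $t:W\to B$ with $W\in\omega$ through which every morphism $W'\to B$ with $W'\in\omega$ factors. *)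

theory Defs
  imports "HOL-Algebra.Group"
begin

section \<open>Categories\<close>

record ('o, 'm) cat =
  Obj :: "'o set"
  Arr :: "'m set"
  Dom :: "'m \<Rightarrow> 'o"
  Cod :: "'m \<Rightarrow> 'o"
  Ide :: "'o \<Rightarrow> 'm"
  Cmp :: "'m \<Rightarrow> 'm \<Rightarrow> 'm"  (infixr "\<cdot>\<index>" 70)

definition Hom :: "('o, 'm, 'z) cat_scheme \<Rightarrow> 'o \<Rightarrow> 'o \<Rightarrow> 'm set" where
  "Hom C A B = {f \<in> Arr C. Dom C f = A \<and> Cod C f = B}"

locale category =
  fixes C :: "('o, 'm, 'z) cat_scheme" (structure)
  assumes Dom_in: "f \<in> Arr C \<Longrightarrow> Dom C f \<in> Obj C"
    and Cod_in: "f \<in> Arr C \<Longrightarrow> Cod C f \<in> Obj C"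
    and Ide_in: "A \<in> Obj C \<Longrightarrow> Ide C A \<in> Hom C A A"
    and Cmp_in: "\<lbrakk>f \<in> Hom C A B; g \<in> Hom C B D\<rbrakk> \<Longrightarrow> g \<cdot> f \<in> Hom C A D"
    and Cmp_assoc: "\<lbrakk>f \<in> Hom C A B; g \<in> Hom C B D; h \<in> Hom C D E\<rbrakk>
                     \<Longrightarrow> h \<cdot> (g \<cdot> f) = (h \<cdot> g) \<cdot> f"
    and Ide_left: "f \<in> Hom C A B \<Longrightarrow> Ide C B \<cdot> f = f"
    and Ide_right: "f \<in> Hom C A B \<Longrightarrow> f \<cdot> Ide C A = f"

definition iso_arr :: "('o, 'm, 'z) cat_scheme \<Rightarrow> 'm \<Rightarrow> bool" where
  "iso_arr C f \<longleftrightarrow> f \<in> Arr C \<and>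
     (\<exists>g \<in> Hom C (Cod C f) (Dom C f).
        g \<cdot>\<^bsub>C\<^esub> f = Ide C (Dom C f) \<and> f \<cdot>\<^bsub>C\<^esub> g = Ide C (Cod C f))"

definition splitting_epi :: "('o, 'm, 'z) cat_scheme \<Rightarrow> 'm \<Rightarrow> bool" where
  "splitting_epi C f \<longleftrightarrow> f \<in> Arr C \<and>
     (\<exists>s \<in> Hom C (Cod C f) (Dom C f). f \<cdot>\<^bsub>C\<^esub> s = Ide C (Cod C f))"

definition zero_object :: "('o, 'm, 'z) cat_scheme \<Rightarrow> 'o \<Rightarrow> bool" where
  "zero_object C Z \<longleftrightarrow> Z \<in> Obj C \<and>
     (\<forall>A \<in> Obj C. (\<exists>!f. f \<in> Hom C A Z) \<and> (\<exists>!f. f \<in> Hom C Z A))"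

text \<open>The square with \<open>d : Y \<rightarrow> Z\<close>, \<open>f : Z' \<rightarrow> Z\<close>, \<open>d' : P \<rightarrow> Z'\<close>, \<open>f' : P \<rightarrow> Y\<close>;
  thus \<open>d'\<close> is the pullback of \<open>d\<close> along \<open>f\<close>.\<close>
definition is_pullback :: "('o, 'm, 'z) cat_scheme \<Rightarrow> 'm \<Rightarrow> 'm \<Rightarrow> 'm \<Rightarrow> 'm \<Rightarrow> bool" where
  "is_pullback C d f d' f' \<longleftrightarrow>
     d \<in> Arr C \<and> f \<in> Hom C (Dom C f) (Cod C d) \<and>
     d' \<in> Hom C (Dom C d') (Dom C f) \<and> f' \<in> Hom C (Dom C d') (Dom C d) \<and>
     d \<cdot>\<^bsub>C\<^esub> f' = f \<cdot>\<^bsub>C\<^esub> d' \<and>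
     (\<forall>T \<in> Obj C. \<forall>a \<in> Hom C T (Dom C d). \<forall>b \<in> Hom C T (Dom C f).
        d \<cdot>\<^bsub>C\<^esub> a = f \<cdot>\<^bsub>C\<^esub> b \<longrightarrow>
        (\<exists>!u. u \<in> Hom C T (Dom C d') \<and> f' \<cdot>\<^bsub>C\<^esub> u = a \<and> d' \<cdot>\<^bsub>C\<^esub> u = b))"

text \<open>The square with \<open>i : X \<rightarrow> Y\<close>, \<open>f : X \<rightarrow> X'\<close>, \<open>i' : X' \<rightarrow> P\<close>, \<open>f' : Y \<rightarrow> P\<close>;
  thus \<open>i'\<close> is the pushout of \<open>i\<close> along \<open>f\<close>.\<close>
definition is_pushout :: "('o, 'm, 'z) cat_scheme \<Rightarrow> 'm \<Rightarrow> 'm \<Rightarrow> 'm \<Rightarrow> 'm \<Rightarrow> bool" where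
  "is_pushout C i f i' f' \<longleftrightarrow>
     i \<in> Arr C \<and> f \<in> Hom C (Dom C i) (Cod C f) \<and>
     i' \<in> Hom C (Cod C f) (Cod C i') \<and> f' \<in> Hom C (Cod C i) (Cod C i') \<and>
     f' \<cdot>\<^bsub>C\<^esub> i = i' \<cdot>\<^bsub>C\<^esub> f \<and>
     (\<forall>T \<in> Obj C. \<forall>a \<in> Hom C (Cod C i) T. \<forall>b \<in> Hom C (Cod C f) T.
        a \<cdot>\<^bsub>C\<^esub> i = b \<cdot>\<^bsub>C\<^esub> f \<longrightarrow>
        (\<exists>!u. u \<in> Hom C (Cod C i') T \<and> u \<cdot>\<^bsub>C\<^esub> f' = a \<and> u \<cdot>\<^bsub>C\<^esub> i' = b))"

text \<open>Surjectivity of the map \<open>Hom(W, f)\<close>.\<close>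
definition Hom_surj :: "('o, 'm, 'z) cat_scheme \<Rightarrow> 'o \<Rightarrow> 'm \<Rightarrow> bool" where
  "Hom_surj C W f \<longleftrightarrow>
     (\<lambda>h. f \<cdot>\<^bsub>C\<^esub> h) ` Hom C W (Dom C f) = Hom C W (Cod C f)"

definition contravariantly_finite :: "('o, 'm, 'z) cat_scheme \<Rightarrow> 'o set \<Rightarrow> bool" where
  "contravariantly_finite C \<omega> \<longleftrightarrow>
     (\<forall>B \<in> Obj C. \<exists>W \<in> \<omega>. \<exists>t \<in> Hom C W B.
        \<forall>W' \<in> \<omega>. \<forall>s \<in> Hom C W' B. \<exists>u \<in> Hom C W' W. t \<cdot>\<^bsub>C\<^esub> u = s)"

section \<open>Additive categories\<close>

record ('o, 'm) add_cat = "('o, 'm) cat" +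
  Add :: "'m \<Rightarrow> 'm \<Rightarrow> 'm"
  Zer :: "'o \<Rightarrow> 'o \<Rightarrow> 'm"

definition Hom_group :: "('o, 'm, 'z) add_cat_scheme \<Rightarrow> 'o \<Rightarrow> 'o \<Rightarrow> 'm monoid" where
  "Hom_group C A B = \<lparr>carrier = Hom C A B, mult = Add C, one = Zer C A B\<rparr>"

locale preadditive_category = category C
  for C :: "('o, 'm, 'z) add_cat_scheme" (structure) +
  assumes Hom_comm_group: "\<lbrakk>A \<in> Obj C; B \<in> Obj C\<rbrakk> \<Longrightarrow> comm_group (Hom_group C A B)"
    and Cmp_Add_right: "\<lbrakk>f \<in> Hom C A B; f' \<in> Hom C A B; g \<in> Hom C B D\<rbrakk>
                         \<Longrightarrow> g \<cdot> Add C f f' = Add C (g \<cdot> f) (g \<cdot> f')"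
    and Cmp_Add_left: "\<lbrakk>f \<in> Hom C A B; g \<in> Hom C B D; g' \<in> Hom C B D\<rbrakk>
                        \<Longrightarrow> Add C g g' \<cdot> f = Add C (g \<cdot> f) (g' \<cdot> f)"

definition is_biproduct ::
  "('o, 'm, 'z) add_cat_scheme \<Rightarrow> 'o \<Rightarrow> 'o \<Rightarrow> 'o \<Rightarrow> 'm \<Rightarrow> 'm \<Rightarrow> 'm \<Rightarrow> 'm \<Rightarrow> bool" where
  "is_biproduct C A B P i\<^sub>1 i\<^sub>2 p\<^sub>1 p\<^sub>2 \<longleftrightarrow>
     i\<^sub>1 \<in> Hom C A P \<and> i\<^sub>2 \<in> Hom C B P \<and> p\<^sub>1 \<in> Hom C P A \<and> p\<^sub>2 \<in> Hom C P B \<and>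
     p\<^sub>1 \<cdot>\<^bsub>C\<^esub> i\<^sub>1 = Ide C A \<and> p\<^sub>2 \<cdot>\<^bsub>C\<^esub> i\<^sub>2 = Ide C B \<and>
     p\<^sub>1 \<cdot>\<^bsub>C\<^esub> i\<^sub>2 = Zer C B A \<and> p\<^sub>2 \<cdot>\<^bsub>C\<^esub> i\<^sub>1 = Zer C A B \<and>
     Add C (i\<^sub>1 \<cdot>\<^bsub>C\<^esub> p\<^sub>1) (i\<^sub>2 \<cdot>\<^bsub>C\<^esub> p\<^sub>2) = Ide C P"

locale additive_category = preadditive_category C
  for C :: "('o, 'm, 'z) add_cat_scheme" (structure) +
  assumes ex_zero_object: "\<exists>Z. zero_object C Z"
    and ex_biproduct: "\<lbrakk>A \<in> Obj C; B \<in> Obj C\<rbrakk>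
                        \<Longrightarrow> \<exists>P i\<^sub>1 i\<^sub>2 p\<^sub>1 p\<^sub>2. is_biproduct C A B P i\<^sub>1 i\<^sub>2 p\<^sub>1 p\<^sub>2"

definition is_kernel :: "('o, 'm, 'z) add_cat_scheme \<Rightarrow> 'm \<Rightarrow> 'm \<Rightarrow> bool" where
  "is_kernel C d i \<longleftrightarrow> d \<in> Arr C \<and> i \<in> Hom C (Dom C i) (Dom C d) \<and>
     d \<cdot>\<^bsub>C\<^esub> i = Zer C (Dom C i) (Cod C d) \<and>
     (\<forall>T \<in> Obj C. \<forall>f \<in> Hom C T (Dom C d). d \<cdot>\<^bsub>C\<^esub> f = Zer C T (Cod C d) \<longrightarrow>
        (\<exists>!u. u \<in> Hom C T (Dom C i) \<and> i \<cdot>\<^bsub>C\<^esub> u = f))"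

definition is_cokernel :: "('o, 'm, 'z) add_cat_scheme \<Rightarrow> 'm \<Rightarrow> 'm \<Rightarrow> bool" where
  "is_cokernel C i d \<longleftrightarrow> i \<in> Arr C \<and> d \<in> Hom C (Cod C i) (Cod C d) \<and>
     d \<cdot>\<^bsub>C\<^esub> i = Zer C (Dom C i) (Cod C d) \<and>
     (\<forall>T \<in> Obj C. \<forall>f \<in> Hom C (Cod C i) T. f \<cdot>\<^bsub>C\<^esub> i = Zer C (Dom C i) T \<longrightarrow>
        (\<exists>!u. u \<in> Hom C (Cod C d) T \<and> u \<cdot>\<^bsub>C\<^esub> d = f))"

section \<open>Exact categories\<close>

text \<open>An element \<open>(i, d)\<close> of \<open>Confl\<close> is the conflation \<open>X \<rightarrow> Y \<rightarrow> Z\<close> with inflation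
  \<open>i : X \<rightarrow> Y\<close> and deflation \<open>d : Y \<rightarrow> Z\<close>.\<close>
record ('o, 'm) exact_cat = "('o, 'm) add_cat" +
  Confl :: "('m \<times> 'm) set"

definition inflation :: "('o, 'm, 'z) exact_cat_scheme \<Rightarrow> 'm \<Rightarrow> bool" where
  "inflation C i \<longleftrightarrow> (\<exists>d. (i, d) \<in> Confl C)"

definition deflation :: "('o, 'm, 'z) exact_cat_scheme \<Rightarrow> 'm \<Rightarrow> bool" where
  "deflation C d \<longleftrightarrow> (\<exists>i. (i, d) \<in> Confl C)"

text \<open>Quillen's axioms, in the self-dual form given by Buehler (\<^emph>\<open>Exact categories\<close>,
  Expo. Math. 28 (2010), Definition 2.1).\<close>
locale exact_category = additive_category C
  for C :: "('o, 'm, 'z) exact_cat_scheme" (structure) +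
  assumes conflation_kernel: "(i, d) \<in> Confl C \<Longrightarrow> is_kernel C d i"
    and conflation_cokernel: "(i, d) \<in> Confl C \<Longrightarrow> is_cokernel C i d"
    and conflation_iso_closed:
      "\<lbrakk>(i, d) \<in> Confl C; i' \<in> Hom C X' Y'; d' \<in> Hom C Y' Z';
        a \<in> Hom C (Dom C i) X'; b \<in> Hom C (Cod C i) Y'; c \<in> Hom C (Cod C d) Z';
        iso_arr C a; iso_arr C b; iso_arr C c; b \<cdot> i = i' \<cdot> a; c \<cdot> d = d' \<cdot> b\<rbrakk>
        \<Longrightarrow> (i', d') \<in> Confl C"
    and inflation_Ide: "A \<in> Obj C \<Longrightarrow> inflation C (Ide C A)"
    and deflation_Ide: "A \<in> Obj C \<Longrightarrow> deflation C (Ide C A)"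
    and inflation_Cmp: "\<lbrakk>inflation C i; inflation C j; Cod C i = Dom C j\<rbrakk>
                         \<Longrightarrow> inflation C (j \<cdot> i)"
    and deflation_Cmp: "\<lbrakk>deflation C d; deflation C e; Cod C d = Dom C e\<rbrakk>
                         \<Longrightarrow> deflation C (e \<cdot> d)"
    and inflation_pushout: "\<lbrakk>inflation C i; f \<in> Arr C; Dom C f = Dom C i\<rbrakk>
                             \<Longrightarrow> \<exists>i' f'. is_pushout C i f i' f' \<and> inflation C i'"
    and deflation_pullback: "\<lbrakk>deflation C d; f \<in> Arr C; Cod C f = Cod C d\<rbrakk>
                              \<Longrightarrow> \<exists>d' f'. is_pullback C d f d' f' \<and> deflation C d'"

definition weakly_idempotent_complete :: "('o, 'm, 'z) exact_cat_scheme \<Rightarrow> bool" where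
  "weakly_idempotent_complete C \<longleftrightarrow> (\<forall>d. splitting_epi C d \<longrightarrow> deflation C d)"

definition projectives :: "('o, 'm, 'z) exact_cat_scheme \<Rightarrow> 'o set" where
  "projectives C = {P \<in> Obj C. \<forall>d. deflation C d \<longrightarrow> Hom_surj C P d}"

definition enough_projectives :: "('o, 'm, 'z) exact_cat_scheme \<Rightarrow> bool" where
  "enough_projectives C \<longleftrightarrow>
     (\<forall>X \<in> Obj C. \<exists>P \<in> projectives C. \<exists>d \<in> Hom C P X. deflation C d)"

section \<open>Yoneda extensions and cotorsion pairs\<close>

definition extensions :: "('o, 'm, 'z) exact_cat_scheme \<Rightarrow> 'o \<Rightarrow> 'o \<Rightarrow> ('m \<times> 'm) set" where
  "extensions C X Y = {(i, d) \<in> Confl C. Dom C i = Y \<and> Cod C d = X}"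

text \<open>Two extensions of \<open>X\<close> by \<open>Y\<close> are equivalent if there is an isomorphism between
  their middle terms that is compatible with the identities of \<open>Y\<close> and \<open>X\<close>.\<close>
definition extension_equiv ::
  "('o, 'm, 'z) exact_cat_scheme \<Rightarrow> 'o \<Rightarrow> 'o \<Rightarrow> (('m \<times> 'm) \<times> ('m \<times> 'm)) set" where
  "extension_equiv C X Y =
     {((i, d), (i', d')). (i, d) \<in> extensions C X Y \<and> (i', d') \<in> extensions C X Y \<and>
        (\<exists>h \<in> Hom C (Cod C i) (Cod C i'). iso_arr C h \<and>
           h \<cdot>\<^bsub>C\<^esub> i = i' \<and> d' \<cdot>\<^bsub>C\<^esub> h = d)}"

text \<open>The underlying set of the Yoneda group \<open>Ext\<^sup>1(X, Y)\<close>; its zero element is the class of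
  the split extension \<open>Y \<rightarrow> Y \<oplus> X \<rightarrow> X\<close>.\<close>
definition Ext1 :: "('o, 'm, 'z) exact_cat_scheme \<Rightarrow> 'o \<Rightarrow> 'o \<Rightarrow> ('m \<times> 'm) set set" where
  "Ext1 C X Y = extensions C X Y // extension_equiv C X Y"

definition Ext1_zero :: "('o, 'm, 'z) exact_cat_scheme \<Rightarrow> 'o \<Rightarrow> 'o \<Rightarrow> ('m \<times> 'm) set" where
  "Ext1_zero C X Y =
     extension_equiv C X Y `` {(i\<^sub>1, p\<^sub>2). \<exists>P i\<^sub>2 p\<^sub>1. is_biproduct C Y X P i\<^sub>1 i\<^sub>2 p\<^sub>1 p\<^sub>2}"

definition Ext1_vanishes :: "('o, 'm, 'z) exact_cat_scheme \<Rightarrow> 'o \<Rightarrow> 'o \<Rightarrow> bool" where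
  "Ext1_vanishes C X Y \<longleftrightarrow> Ext1 C X Y = {Ext1_zero C X Y}"

definition cotorsion_pair ::
  "('o, 'm, 'z) exact_cat_scheme \<Rightarrow> 'o set \<Rightarrow> 'o set \<Rightarrow> bool" where
  "cotorsion_pair C \<C> \<F> \<longleftrightarrow>
     \<C> = {X \<in> Obj C. \<forall>F \<in> \<F>. Ext1_vanishes C X F} \<and>
     \<F> = {Y \<in> Obj C. \<forall>X \<in> \<C>. Ext1_vanishes C X Y}"

definition complete_cotorsion_pair ::
  "('o, 'm, 'z) exact_cat_scheme \<Rightarrow> 'o set \<Rightarrow> 'o set \<Rightarrow> bool" where
  "complete_cotorsion_pair C \<C> \<F> \<longleftrightarrow> cotorsion_pair C \<C> \<F> \<and>
     (\<forall>X \<in> Obj C.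
        (\<exists>i d. (i, d) \<in> Confl C \<and> Dom C i \<in> \<F> \<and> Dom C d \<in> \<C> \<and> Cod C d = X) \<and>
        (\<exists>i d. (i, d) \<in> Confl C \<and> Dom C i = X \<and> Cod C i \<in> \<F> \<and> Cod C d \<in> \<C>))"

definition hereditary_cotorsion_pair ::
  "('o, 'm, 'z) exact_cat_scheme \<Rightarrow> 'o set \<Rightarrow> 'o set \<Rightarrow> bool" where
  "hereditary_cotorsion_pair C \<C> \<F> \<longleftrightarrow> cotorsion_pair C \<C> \<F> \<and>
     (\<forall>i d. (i, d) \<in> Confl C \<and> Dom C d \<in> \<C> \<and> Cod C d \<in> \<C> \<longrightarrow> Dom C i \<in> \<C>) \<and>
     (\<forall>i d. (i, d) \<in> Confl C \<and> Dom C i \<in> \<F> \<and> Cod C i \<in> \<F> \<longrightarrow> Cod C d \<in> \<F>)"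

section \<open>Model structures\<close>

record 'm model =
  CoFib :: "'m set"
  Fib :: "'m set"
  Weq :: "'m set"

definition retract_of :: "('o, 'm, 'z) cat_scheme \<Rightarrow> 'm \<Rightarrow> 'm \<Rightarrow> bool" where
  "retract_of C f g \<longleftrightarrow> f \<in> Arr C \<and> g \<in> Arr C \<and>
     (\<exists>i \<in> Hom C (Dom C f) (Dom C g). \<exists>r \<in> Hom C (Dom C g) (Dom C f).
      \<exists>j \<in> Hom C (Cod C f) (Cod C g). \<exists>s \<in> Hom C (Cod C g) (Cod C f).
        r \<cdot>\<^bsub>C\<^esub> i = Ide C (Dom C f) \<and> s \<cdot>\<^bsub>C\<^esub> j = Ide C (Cod C f) \<and>
        g \<cdot>\<^bsub>C\<^esub> i = j \<cdot>\<^bsub>C\<^esub> f \<and> f \<cdot>\<^bsub>C\<^esub> r = s \<cdot>\<^bsub>C\<^esub> g)"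

definition has_lifting :: "('o, 'm, 'z) cat_scheme \<Rightarrow> 'm \<Rightarrow> 'm \<Rightarrow> bool" where
  "has_lifting C i p \<longleftrightarrow>
     (\<forall>u \<in> Hom C (Dom C i) (Dom C p). \<forall>v \<in> Hom C (Cod C i) (Cod C p).
        p \<cdot>\<^bsub>C\<^esub> u = v \<cdot>\<^bsub>C\<^esub> i \<longrightarrow>
        (\<exists>h \<in> Hom C (Cod C i) (Dom C p). h \<cdot>\<^bsub>C\<^esub> i = u \<and> p \<cdot>\<^bsub>C\<^esub> h = v))"

locale model_structure = category C
  for C :: "('o, 'm, 'z) exact_cat_scheme" (structure) and M :: "'m model" +
  assumes CoFib_Arr: "CoFib M \<subseteq> Arr C"
    and Fib_Arr: "Fib M \<subseteq> Arr C"
    and Weq_Arr: "Weq M \<subseteq> Arr C"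
    and Weq_Cmp: "\<lbrakk>f \<in> Hom C A B; g \<in> Hom C B D; f \<in> Weq M; g \<in> Weq M\<rbrakk>
                   \<Longrightarrow> g \<cdot> f \<in> Weq M"
    and Weq_cancel_left: "\<lbrakk>f \<in> Hom C A B; g \<in> Hom C B D; g \<in> Weq M; g \<cdot> f \<in> Weq M\<rbrakk>
                           \<Longrightarrow> f \<in> Weq M"
    and Weq_cancel_right: "\<lbrakk>f \<in> Hom C A B; g \<in> Hom C B D; f \<in> Weq M; g \<cdot> f \<in> Weq M\<rbrakk>
                            \<Longrightarrow> g \<in> Weq M"
    and CoFib_retract: "\<lbrakk>retract_of C f g; g \<in> CoFib M\<rbrakk> \<Longrightarrow> f \<in> CoFib M"
    and Fib_retract: "\<lbrakk>retract_of C f g; g \<in> Fib M\<rbrakk> \<Longrightarrow> f \<in> Fib M"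
    and Weq_retract: "\<lbrakk>retract_of C f g; g \<in> Weq M\<rbrakk> \<Longrightarrow> f \<in> Weq M"
    and CoFib_lifting: "\<lbrakk>i \<in> CoFib M; p \<in> Fib M \<inter> Weq M\<rbrakk> \<Longrightarrow> has_lifting C i p"
    and Fib_lifting: "\<lbrakk>i \<in> CoFib M \<inter> Weq M; p \<in> Fib M\<rbrakk> \<Longrightarrow> has_lifting C i p"
    and factor_CoFib_Weq: "f \<in> Arr C \<Longrightarrow> \<exists>i p. i \<in> CoFib M \<inter> Weq M \<and> p \<in> Fib M \<and>
           Cod C i = Dom C p \<and> f = p \<cdot> i"
    and factor_Fib_Weq: "f \<in> Arr C \<Longrightarrow> \<exists>i p. i \<in> CoFib M \<and> p \<in> Fib M \<inter> Weq M \<and>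
           Cod C i = Dom C p \<and> f = p \<cdot> i"
begin

definition cofibrant :: "'o set" where
  "cofibrant = {X \<in> Obj C. \<exists>Z f. zero_object C Z \<and> f \<in> Hom C Z X \<and> f \<in> CoFib M}"

definition fibrant :: "'o set" where
  "fibrant = {X \<in> Obj C. \<exists>Z f. zero_object C Z \<and> f \<in> Hom C X Z \<and> f \<in> Fib M}"

text \<open>This is only the condition on cofibrations and fibrations; as a predicate
  \<open>model_structure.is_exact C M\<close> it does not itself entail \<open>model_structure C M\<close>.\<close>
definition is_exact :: bool where
  "is_exact \<longleftrightarrow>
     CoFib M = {i. \<exists>d. (i, d) \<in> Confl C \<and> Cod C d \<in> cofibrant} \<and>
     Fib M = {d. \<exists>k. (k, d) \<in> Confl C \<and> Dom C k \<in> fibrant}"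

end

text \<open>For \<open>f : A \<rightarrow> B\<close> and \<open>t : W \<rightarrow> B\<close> the morphism \<open>(f, t) : A \<oplus> W \<rightarrow> B\<close> is
  \<open>f p\<^sub>1 + t p\<^sub>2\<close>.\<close>
definition omega_model ::
  "('o, 'm, 'z) exact_cat_scheme \<Rightarrow> 'o set \<Rightarrow> 'o set \<Rightarrow> 'm model" where
  "omega_model C \<X> \<Y> = \<lparr>
     CoFib = {f. \<exists>d. (f, d) \<in> Confl C \<and> Cod C d \<in> \<X>},
     Fib = {f \<in> Arr C. \<forall>W \<in> \<X> \<inter> \<Y>. Hom_surj C W f},
     Weq = {f \<in> Arr C. \<exists>W \<in> \<X> \<inter> \<Y>. \<exists>t \<in> Hom C W (Cod C f).
              \<exists>P i\<^sub>1 i\<^sub>2 p\<^sub>1 p\<^sub>2 k. is_biproduct C (Dom C f) W P i\<^sub>1 i\<^sub>2 p\<^sub>1 p\<^sub>2 \<and>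
                (k, Add C (f \<cdot>\<^bsub>C\<^esub> p\<^sub>1) (t \<cdot>\<^bsub>C\<^esub> p\<^sub>2)) \<in> Confl C \<and> Dom C k \<in> \<Y>}\<rparr>"

end

theory Submission
  imports Defs
begin

text \<open>
  Every morphism to a zero object is an \<open>\<omega>\<close>-fibration, so all objects are fibrant, while the
  cofibrant objects are exactly those of \<open>\<X>\<close>. Exactness of the model structure therefore means that
  the \<open>\<omega>\<close>-fibrations are precisely the deflations. In that case every object of \<open>\<omega>\<close> is projective,
  \<open>\<omega>\<close>-approximations are deflations from projectives, and a projective is a retract of its
  approximation. Conversely, if \<open>\<omega>\<close> consists of the projectives and there are enough of them, an
  \<open>\<omega>\<close>-fibration \<open>f\<close> factors a deflation \<open>d = f u\<close> from a projective, and weak idempotent completeness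
  makes \<open>f\<close> a deflation.

  That the three classes form a model structure rests on a characterization of the weak equivalences:
  they are the morphisms inducing bijections on \<open>Hom(X, -)\<close> modulo maps that factor through \<open>\<omega>\<close>, for
  all \<open>X\<close> in \<open>\<X>\<close>. This makes two out of three and retract closure formal.
\<close>

section \<open>Calculus in preadditive categories\<close>

text \<open>\<open>Weq\<close> is an existence statement about an auxiliary object \<open>W\<close>,
  a map \<open>t\<close> and a conflation, and such witnesses neither compose nor cancel in a direct
  way; the bijection criterion contains no choice. Its price is a converse: a fibration that is
  bijective modulo \<omega> must be shown to be a deflation with kernel in \<Y>. This is the one
  place where heredity enters. Membership of the kernel in \<Y> is tested against arbitrary
  extensions, while the criterion speaks only about maps out of objects of \<X>, so the extension
  has to be replaced by one that lives inside \<X>. Contravariant finiteness brings an arbitrary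
  morphism into the range of this converse: an approximation of the target, added as a second
  summand of the source, turns it into a fibration and changes nothing modulo \<omega>. Weak
  idempotent completeness acts mostly through \<open>deflation_cancel\<close>: whenever a deflation
  has been written as \<open>g \<cdot> f\<close>, the map \<open>g\<close> is itself a
  deflation.\<close>

lemma Hom_iff: "f \<in> Hom C A B \<longleftrightarrow> f \<in> Arr C \<and> Dom C f = A \<and> Cod C f = B"
  by (auto simp: Hom_def)

context category
begin

text \<open>A single conjunction, so that \<open>x[THEN Hom_facts]\<close> as a simp rule delivers
  all typing information about an arrow at once.\<close>

lemma Hom_facts:
  assumes "f \<in> Hom C A B"
  shows "f \<in> Arr C \<and> Dom C f = A \<and> Cod C f = B \<and> A \<in> Obj C \<and> B \<in> Obj C"
  using assms Dom_in Cod_in by (auto simp: Hom_iff)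

lemma Ide_facts [simp]:
  "A \<in> Obj C \<Longrightarrow> Ide C A \<in> Arr C" "A \<in> Obj C \<Longrightarrow> Dom C (Ide C A) = A"
  "A \<in> Obj C \<Longrightarrow> Cod C (Ide C A) = A"
  using Ide_in[of A] by (auto simp: Hom_iff)

lemma Cmp_facts [simp]:
  assumes "f \<in> Arr C" "g \<in> Arr C" "Cod C f = Dom C g"
  shows "g \<cdot> f \<in> Arr C" "Dom C (g \<cdot> f) = Dom C f" "Cod C (g \<cdot> f) = Cod C g"
  using Cmp_in[of f "Dom C f" "Dom C g" g "Cod C g"] assms by (auto simp: Hom_iff)

lemma Cmp_assoc' [simp]:
  "\<lbrakk>f \<in> Arr C; g \<in> Arr C; h \<in> Arr C; Cod C f = Dom C g; Cod C g = Dom C h\<rbrakk>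
    \<Longrightarrow> (h \<cdot> g) \<cdot> f = h \<cdot> (g \<cdot> f)"
  by (rule Cmp_assoc[symmetric]) (auto simp: Hom_iff)

lemma Ide_left' [simp]: "\<lbrakk>f \<in> Arr C; Cod C f = B\<rbrakk> \<Longrightarrow> Ide C B \<cdot> f = f"
  by (rule Ide_left) (auto simp: Hom_iff)

lemma Ide_right' [simp]: "\<lbrakk>f \<in> Arr C; Dom C f = A\<rbrakk> \<Longrightarrow> f \<cdot> Ide C A = f"
  by (rule Ide_right) (auto simp: Hom_iff)

text \<open>Since \<open>Cmp_assoc'\<close> nests composites to the right, a known equation for
  \<open>g \<cdot> f\<close> no longer matches inside \<open>g \<cdot> (f \<cdot> x)\<close>. This
  is its form for that position.\<close>

lemma Cmp_red:
  "\<lbrakk>g \<cdot> f = h; f \<in> Arr C; g \<in> Arr C; x \<in> Arr C; Cod C f = Dom C g; Cod C x = Dom C f\<rbrakk>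
    \<Longrightarrow> g \<cdot> (f \<cdot> x) = h \<cdot> x"
  using Cmp_assoc'[of x f g] by simp

lemma splitting_epiI:
  "\<lbrakk>f \<in> Hom C A B; s \<in> Hom C B A; f \<cdot> s = Ide C B\<rbrakk> \<Longrightarrow> splitting_epi C f"
  by (auto simp: splitting_epi_def Hom_iff)

lemma iso_arrI:
  "\<lbrakk>f \<in> Hom C A B; g \<in> Hom C B A; g \<cdot> f = Ide C A; f \<cdot> g = Ide C B\<rbrakk> \<Longrightarrow> iso_arr C f"
  by (auto simp: iso_arr_def Hom_iff)

lemma iso_arr_Ide: "A \<in> Obj C \<Longrightarrow> iso_arr C (Ide C A)"
  by (rule iso_arrI[of _ A A "Ide C A"]) (auto simp: Hom_iff)

end

context preadditive_category
begin

text \<open>The Hom group is recovered from \<open>Dom\<close> and \<open>Cod\<close> of the arrow,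
  which makes the inverse a unary operation that needs no object parameters.\<close>

definition neg :: "'m \<Rightarrow> 'm" where
  "neg f = inv\<^bsub>Hom_group C (Dom C f) (Cod C f)\<^esub> f"

lemma Hom_group_simps [simp]:
  "carrier (Hom_group C A B) = Hom C A B"
  "x \<otimes>\<^bsub>Hom_group C A B\<^esub> y = Add C x y"
  "\<one>\<^bsub>Hom_group C A B\<^esub> = Zer C A B"
  by (auto simp: Hom_group_def)

lemma Zer_facts [simp]:
  assumes "A \<in> Obj C" "B \<in> Obj C"
  shows "Zer C A B \<in> Arr C" "Dom C (Zer C A B) = A" "Cod C (Zer C A B) = B"
proof -
  interpret comm_group "Hom_group C A B" using Hom_comm_group assms .
  have "Zer C A B \<in> Hom C A B" using one_closed by simp
  then show "Zer C A B \<in> Arr C" "Dom C (Zer C A B) = A" "Cod C (Zer C A B) = B"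
    by (auto simp: Hom_iff)
qed

context
  fixes f g h A B
  assumes f: "f \<in> Arr C" "Dom C f = A" "Cod C f = B"
    and g: "g \<in> Arr C" "Dom C g = A" "Cod C g = B"
    and h: "h \<in> Arr C" "Dom C h = A" "Cod C h = B"
begin

interpretation G: comm_group "Hom_group C A B"
  using Hom_comm_group Dom_in Cod_in f by blast

text \<open>Everything borrowed from the library theory of groups is collected here under explicit
  types; the lemmas below restate it with side conditions that the simplifier can discharge.\<close>

lemma Add_facts_aux:
  "Add C f g \<in> Hom C A B" "neg f \<in> Hom C A B"
  "Add C f g = Add C g f" "Add C (Add C f g) h = Add C f (Add C g h)"
  "Add C (Zer C A B) f = f" "Add C f (neg f) = Zer C A B" "Add C f (Add C (neg f) g) = g"
  "Add C (neg f) (Add C f g) = g"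
  "Add C f h = Add C g h \<longleftrightarrow> f = g"
  "Add C f g = f \<longleftrightarrow> g = Zer C A B"
  "neg f = g \<longleftrightarrow> Add C f g = Zer C A B"
proof -
  have fgh: "f \<in> carrier (Hom_group C A B)" "g \<in> carrier (Hom_group C A B)"
    "h \<in> carrier (Hom_group C A B)" using f g h by (auto simp: Hom_iff)
  have n: "neg f = inv\<^bsub>Hom_group C A B\<^esub> f" by (simp add: neg_def f)
  show "Add C f g \<in> Hom C A B" using G.m_closed fgh by simp
  show nf: "neg f \<in> Hom C A B" using G.inv_closed fgh n by simp
  show "Add C f g = Add C g f" using G.m_comm[of f g] fgh by simp
  show "Add C (Add C f g) h = Add C f (Add C g h)" using G.m_assoc[of f g h] fgh by simp
  show "Add C (Zer C A B) f = f" using G.l_one[of f] fgh by simp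
  show 1: "Add C f (neg f) = Zer C A B" using G.r_inv[of f] fgh n by simp
  then show "Add C f (Add C (neg f) g) = g"
    using G.m_assoc[of f "neg f" g] G.l_one[of g] fgh nf by simp
  show "Add C (neg f) (Add C f g) = g"
    using G.m_assoc[of "neg f" f g] G.l_one[of g] G.l_inv[of f] fgh nf n by simp
  show "Add C f h = Add C g h \<longleftrightarrow> f = g" using G.right_cancel[of h f g] fgh by simp
  show "Add C f g = f \<longleftrightarrow> g = Zer C A B"
    using G.l_cancel_one[of f g] fgh by simp
  show "neg f = g \<longleftrightarrow> Add C f g = Zer C A B"
    using G.inv_equality[of g f] G.m_comm[of f g] fgh 1 n by auto
qed

end

lemma Add_facts [simp]:
  assumes "f \<in> Arr C" "g \<in> Arr C" "Dom C f = Dom C g" "Cod C f = Cod C g"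
  shows "Add C f g \<in> Arr C" "Dom C (Add C f g) = Dom C g" "Cod C (Add C f g) = Cod C g"
  using Add_facts_aux(1)[of f _ _ g f] assms by (auto simp: Hom_iff)

lemma neg_facts [simp]:
  assumes "f \<in> Arr C"
  shows "neg f \<in> Arr C" "Dom C (neg f) = Dom C f" "Cod C (neg f) = Cod C f"
  using Add_facts_aux(2)[of f _ _ f f] assms by (auto simp: Hom_iff)

lemma Add_commute:
  "\<lbrakk>f \<in> Arr C; g \<in> Arr C; Dom C f = Dom C g; Cod C f = Cod C g\<rbrakk> \<Longrightarrow> Add C f g = Add C g f"
  by (rule Add_facts_aux(3)) auto

lemma Add_assoc:
  "\<lbrakk>f \<in> Arr C; g \<in> Arr C; h \<in> Arr C; Dom C f = Dom C g; Cod C f = Cod C g;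
    Dom C g = Dom C h; Cod C g = Cod C h\<rbrakk> \<Longrightarrow> Add C (Add C f g) h = Add C f (Add C g h)"
  by (rule Add_facts_aux(4)) auto

lemma Add_Zer_left [simp]: "\<lbrakk>f \<in> Arr C; Dom C f = A; Cod C f = B\<rbrakk> \<Longrightarrow> Add C (Zer C A B) f = f"
  by (rule Add_facts_aux(5)) auto

lemma Add_Zer_right [simp]: "\<lbrakk>f \<in> Arr C; Dom C f = A; Cod C f = B\<rbrakk> \<Longrightarrow> Add C f (Zer C A B) = f"
  using Add_Zer_left[of f A B] Add_commute[of f "Zer C A B"] Dom_in[of f] Cod_in[of f] by auto

lemma Add_neg [simp]:
  "f \<in> Arr C \<Longrightarrow> Add C f (neg f) = Zer C (Dom C f) (Cod C f)"
  "f \<in> Arr C \<Longrightarrow> Add C (neg f) f = Zer C (Dom C f) (Cod C f)"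
  using Add_facts_aux(6)[of f _ _ f f] Add_commute[of f "neg f"] by auto

lemma Add_neg_cancel [simp]:
  "\<lbrakk>f \<in> Arr C; g \<in> Arr C; Dom C f = Dom C g; Cod C f = Cod C g\<rbrakk> \<Longrightarrow> Add C f (Add C (neg f) g) = g"
  "\<lbrakk>f \<in> Arr C; g \<in> Arr C; Dom C f = Dom C g; Cod C f = Cod C g\<rbrakk> \<Longrightarrow> Add C (neg f) (Add C f g) = g"
  using Add_facts_aux(7,8)[of f _ _ g f] by auto

lemma Add_right_cancel:
  "\<lbrakk>f \<in> Arr C; g \<in> Arr C; h \<in> Arr C; Dom C f = Dom C g; Cod C f = Cod C g;
    Dom C g = Dom C h; Cod C g = Cod C h\<rbrakk> \<Longrightarrow> Add C f h = Add C g h \<longleftrightarrow> f = g"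
  by (rule Add_facts_aux(9)) auto

lemma neg_unique:
  "\<lbrakk>f \<in> Arr C; g \<in> Arr C; Dom C f = Dom C g; Cod C f = Cod C g;
    Add C f g = Zer C (Dom C f) (Cod C f)\<rbrakk> \<Longrightarrow> neg f = g"
  by (subst Add_facts_aux(11)[of f "Dom C g" "Cod C g" g f]) auto

lemma Cmp_Add [simp]:
  "\<lbrakk>f \<in> Arr C; f' \<in> Arr C; g \<in> Arr C; Dom C f = Dom C f'; Cod C f = Cod C f'; Cod C f' = Dom C g\<rbrakk>
    \<Longrightarrow> g \<cdot> Add C f f' = Add C (g \<cdot> f) (g \<cdot> f')"
  by (rule Cmp_Add_right) (auto simp: Hom_iff)

lemma Add_Cmp [simp]:
  "\<lbrakk>f \<in> Arr C; g \<in> Arr C; g' \<in> Arr C; Dom C g = Dom C g'; Cod C g = Cod C g'; Cod C f = Dom C g'\<rbrakk>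
    \<Longrightarrow> Add C g g' \<cdot> f = Add C (g \<cdot> f) (g' \<cdot> f)"
  by (rule Cmp_Add_left) (auto simp: Hom_iff)

text \<open>By distributivity the composite equals its own double, and the only such element of a
  group is the neutral one.\<close>

lemma Cmp_Zer [simp]:
  assumes "g \<in> Arr C" "A \<in> Obj C" "Dom C g = B"
  shows "g \<cdot> Zer C A B = Zer C A (Cod C g)"
proof -
  have B: "B \<in> Obj C" using assms Dom_in by auto
  have "Add C (g \<cdot> Zer C A B) (g \<cdot> Zer C A B) = g \<cdot> Add C (Zer C A B) (Zer C A B)"
    using assms B by (subst Cmp_Add) auto
  also have "\<dots> = g \<cdot> Zer C A B" using assms B by simp
  finally show ?thesis
    using Add_facts_aux(10)[of "g \<cdot> Zer C A B" A "Cod C g" "g \<cdot> Zer C A B" "g \<cdot> Zer C A B"] assms B by simp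
qed

lemma Zer_Cmp [simp]:
  assumes "f \<in> Arr C" "D \<in> Obj C" "Cod C f = B"
  shows "Zer C B D \<cdot> f = Zer C (Dom C f) D"
proof -
  have B: "B \<in> Obj C" using assms Cod_in by auto
  have "Add C (Zer C B D \<cdot> f) (Zer C B D \<cdot> f) = Add C (Zer C B D) (Zer C B D) \<cdot> f"
    using assms B by (subst Add_Cmp) auto
  also have "\<dots> = Zer C B D \<cdot> f" using assms B by simp
  finally show ?thesis
    using Add_facts_aux(10)[of "Zer C B D \<cdot> f" "Dom C f" D "Zer C B D \<cdot> f" "Zer C B D \<cdot> f"] assms B by simp
qed

lemma Cmp_neg [simp]:
  assumes "f \<in> Arr C" "g \<in> Arr C" "Cod C f = Dom C g"
  shows "g \<cdot> neg f = neg (g \<cdot> f)"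
proof (rule neg_unique[symmetric])
  have "Add C (g \<cdot> f) (g \<cdot> neg f) = g \<cdot> Add C f (neg f)" using assms by (subst Cmp_Add) auto
  also have "\<dots> = Zer C (Dom C (g \<cdot> f)) (Cod C (g \<cdot> f))"
    using assms Dom_in by (simp del: Cmp_Add)
  finally show "Add C (g \<cdot> f) (g \<cdot> neg f) = Zer C (Dom C (g \<cdot> f)) (Cod C (g \<cdot> f))" .
qed (use assms in auto)

lemma neg_Cmp [simp]:
  assumes "f \<in> Arr C" "g \<in> Arr C" "Cod C f = Dom C g"
  shows "neg g \<cdot> f = neg (g \<cdot> f)"
proof (rule neg_unique[symmetric])
  have "Add C (g \<cdot> f) (neg g \<cdot> f) = Add C g (neg g) \<cdot> f" using assms by (subst Add_Cmp) auto
  also have "\<dots> = Zer C (Dom C (g \<cdot> f)) (Cod C (g \<cdot> f))"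
    using assms Cod_in by (simp del: Add_Cmp)
  finally show "Add C (g \<cdot> f) (neg g \<cdot> f) = Zer C (Dom C (g \<cdot> f)) (Cod C (g \<cdot> f))" .
qed (use assms in auto)

lemma neg_Zer [simp]: "\<lbrakk>A \<in> Obj C; B \<in> Obj C\<rbrakk> \<Longrightarrow> neg (Zer C A B) = Zer C A B"
  by (rule neg_unique) auto

lemma neg_neg [simp]: "f \<in> Arr C \<Longrightarrow> neg (neg f) = f"
  by (rule neg_unique) auto

lemma neg_Add [simp]:
  assumes "f \<in> Arr C" "g \<in> Arr C" "Dom C f = Dom C g" "Cod C f = Cod C g"
  shows "neg (Add C f g) = Add C (neg f) (neg g)"
proof (rule neg_unique)
  have "Add C (Add C f g) (Add C (neg f) (neg g)) = Add C f (Add C g (Add C (neg g) (neg f)))"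
    using assms by (simp add: Add_assoc Add_commute[of "neg f"])
  also have "\<dots> = Zer C (Dom C (Add C f g)) (Cod C (Add C f g))" using assms by simp
  finally show "Add C (Add C f g) (Add C (neg f) (neg g)) = Zer C (Dom C (Add C f g)) (Cod C (Add C f g))" .
qed (use assms in simp_all)

lemma diff_eq_Zer:
  assumes "f \<in> Arr C" "g \<in> Arr C" "Dom C f = Dom C g" "Cod C f = Cod C g"
    "Add C f (neg g) = Zer C (Dom C g) (Cod C g)"
  shows "f = g"
proof -
  have "Add C f (neg g) = Add C g (neg g)" by (simp only: assms(5) Add_neg(1)[OF assms(2)])
  then show ?thesis
    by (rule Add_right_cancel[THEN iffD1, rotated -1]) (simp_all add: assms)
qed

text \<open>Cancellation is tested on the difference of \<open>u\<close> and \<open>v\<close>, so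
  only the zero test for the one object \<open>T\<close> is required.\<close>

lemma mono_from_Zer:
  assumes u: "u \<in> Hom C T X" and v: "v \<in> Hom C T X" and i: "i \<in> Hom C X Y" and eq: "i \<cdot> u = i \<cdot> v"
    and mono: "\<And>w. \<lbrakk>w \<in> Hom C T X; i \<cdot> w = Zer C T Y\<rbrakk> \<Longrightarrow> w = Zer C T X"
  shows "u = v"
proof -
  note [simp] = u[THEN Hom_facts] v[THEN Hom_facts] i[THEN Hom_facts] 
  have "Add C u (neg v) = Zer C T X"
    by (rule mono) (simp_all add: Hom_iff eq)
  then show ?thesis by - (rule diff_eq_Zer, simp_all)
qed

lemma epi_from_Zer:
  assumes u: "u \<in> Hom C X T" and v: "v \<in> Hom C X T" and d: "d \<in> Hom C Y X" and eq: "u \<cdot> d = v \<cdot> d"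
    and epi: "\<And>w. \<lbrakk>w \<in> Hom C X T; w \<cdot> d = Zer C Y T\<rbrakk> \<Longrightarrow> w = Zer C X T"
  shows "u = v"
proof -
  note [simp] = u[THEN Hom_facts] v[THEN Hom_facts] d[THEN Hom_facts] 
  have "Add C u (neg v) = Zer C X T"
    by (rule epi) (simp_all add: Hom_iff eq)
  then show ?thesis by - (rule diff_eq_Zer, simp_all)
qed

section \<open>Biproducts and matrix calculus\<close>

lemma biproduct_facts:
  assumes "is_biproduct C A B P i1 i2 p1 p2"
  shows "i1 \<in> Hom C A P \<and> i2 \<in> Hom C B P \<and> p1 \<in> Hom C P A \<and> p2 \<in> Hom C P B \<and>
    p1 \<cdot> i1 = Ide C A \<and> p2 \<cdot> i2 = Ide C B \<and> p1 \<cdot> i2 = Zer C B A \<and> p2 \<cdot> i1 = Zer C A B \<and>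
    Add C (i1 \<cdot> p1) (i2 \<cdot> p2) = Ide C P"
  using assms by (simp add: is_biproduct_def)

lemma biproduct_simps:
  assumes "is_biproduct C A B P i1 i2 p1 p2"
  shows "i1 \<in> Arr C" "Dom C i1 = A" "Cod C i1 = P" "i2 \<in> Arr C" "Dom C i2 = B" "Cod C i2 = P"
    "p1 \<in> Arr C" "Dom C p1 = P" "Cod C p1 = A" "p2 \<in> Arr C" "Dom C p2 = P" "Cod C p2 = B"
    "A \<in> Obj C" "B \<in> Obj C" "P \<in> Obj C"
    "p1 \<cdot> i1 = Ide C A" "p2 \<cdot> i2 = Ide C B" "p1 \<cdot> i2 = Zer C B A" "p2 \<cdot> i1 = Zer C A B"
    "\<lbrakk>x \<in> Arr C; Cod C x = A\<rbrakk> \<Longrightarrow> p1 \<cdot> (i1 \<cdot> x) = x"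
    "\<lbrakk>x \<in> Arr C; Cod C x = B\<rbrakk> \<Longrightarrow> p2 \<cdot> (i2 \<cdot> x) = x"
    "\<lbrakk>x \<in> Arr C; Cod C x = B\<rbrakk> \<Longrightarrow> p1 \<cdot> (i2 \<cdot> x) = Zer C (Dom C x) A"
    "\<lbrakk>x \<in> Arr C; Cod C x = A\<rbrakk> \<Longrightarrow> p2 \<cdot> (i1 \<cdot> x) = Zer C (Dom C x) B"
proof -
  note b = biproduct_facts[OF assms]
  note [simp] = b[THEN conjunct1, THEN Hom_facts] b[THEN conjunct2, THEN conjunct1, THEN Hom_facts]
    b[THEN conjunct2, THEN conjunct2, THEN conjunct1, THEN Hom_facts]
    b[THEN conjunct2, THEN conjunct2, THEN conjunct2, THEN conjunct1, THEN Hom_facts]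
  show "i1 \<in> Arr C" "Dom C i1 = A" "Cod C i1 = P" "i2 \<in> Arr C" "Dom C i2 = B" "Cod C i2 = P"
    "p1 \<in> Arr C" "Dom C p1 = P" "Cod C p1 = A" "p2 \<in> Arr C" "Dom C p2 = P" "Cod C p2 = B"
    "A \<in> Obj C" "B \<in> Obj C" "P \<in> Obj C" by simp_all
  show e: "p1 \<cdot> i1 = Ide C A" "p2 \<cdot> i2 = Ide C B" "p1 \<cdot> i2 = Zer C B A" "p2 \<cdot> i1 = Zer C A B"
    using b by simp_all
  show "\<lbrakk>x \<in> Arr C; Cod C x = A\<rbrakk> \<Longrightarrow> p1 \<cdot> (i1 \<cdot> x) = x" 
    using Cmp_red[OF e(1), of x] by simp
  show "\<lbrakk>x \<in> Arr C; Cod C x = B\<rbrakk> \<Longrightarrow> p2 \<cdot> (i2 \<cdot> x) = x"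
    using Cmp_red[OF e(2), of x] by simp
  show "\<lbrakk>x \<in> Arr C; Cod C x = B\<rbrakk> \<Longrightarrow> p1 \<cdot> (i2 \<cdot> x) = Zer C (Dom C x) A"
    using Cmp_red[OF e(3), of x] by simp
  show "\<lbrakk>x \<in> Arr C; Cod C x = A\<rbrakk> \<Longrightarrow> p2 \<cdot> (i1 \<cdot> x) = Zer C (Dom C x) B"
    using Cmp_red[OF e(4), of x] by simp
qed

lemma biproduct_decomp_left:
  assumes b: "is_biproduct C A B P i1 i2 p1 p2" and x: "x \<in> Hom C T P"
  shows "Add C (i1 \<cdot> (p1 \<cdot> x)) (i2 \<cdot> (p2 \<cdot> x)) = x"
proof -
  note [simp] = biproduct_simps[OF b] x[THEN Hom_facts]
  have "Add C (i1 \<cdot> (p1 \<cdot> x)) (i2 \<cdot> (p2 \<cdot> x)) = Add C (i1 \<cdot> p1) (i2 \<cdot> p2) \<cdot> x" by simp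
  also have "\<dots> = x" unfolding biproduct_facts[OF b, THEN conjunct2, THEN conjunct2, THEN conjunct2, 
    THEN conjunct2, THEN conjunct2, THEN conjunct2, THEN conjunct2, THEN conjunct2] by simp
  finally show ?thesis .
qed

lemma biproduct_decomp_right:
  assumes b: "is_biproduct C A B P i1 i2 p1 p2" and x: "x \<in> Hom C P T"
  shows "Add C (x \<cdot> (i1 \<cdot> p1)) (x \<cdot> (i2 \<cdot> p2)) = x"
proof -
  note [simp] = biproduct_simps[OF b] x[THEN Hom_facts]
  have "Add C (x \<cdot> (i1 \<cdot> p1)) (x \<cdot> (i2 \<cdot> p2)) = x \<cdot> Add C (i1 \<cdot> p1) (i2 \<cdot> p2)" by simp
  also have "\<dots> = x" unfolding biproduct_facts[OF b, THEN conjunct2, THEN conjunct2, THEN conjunct2, 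
    THEN conjunct2, THEN conjunct2, THEN conjunct2, THEN conjunct2, THEN conjunct2] by simp
  finally show ?thesis .
qed

lemma biproduct_decomp:
  assumes b: "is_biproduct C A B P i1 i2 p1 p2"
  shows "Add C (i1 \<cdot> p1) (i2 \<cdot> p2) = Ide C P"
  using biproduct_facts[OF b] by simp

end

section \<open>Conflations\<close>

context exact_category
begin

text \<open>The three objects become explicit, so that one fact types both arrows of a
  conflation.\<close>

definition confl :: "'o \<Rightarrow> 'm \<Rightarrow> 'o \<Rightarrow> 'm \<Rightarrow> 'o \<Rightarrow> bool" where
  "confl X i Y d Z \<longleftrightarrow> (i, d) \<in> Confl C \<and> i \<in> Hom C X Y \<and> d \<in> Hom C Y Z"

lemma confl_types:
  assumes "confl X i Y d Z"
  shows "(i, d) \<in> Confl C" "i \<in> Hom C X Y" "d \<in> Hom C Y Z"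
  using assms by (auto simp: confl_def)

lemma confl_deflation: "confl X i Y d Z \<Longrightarrow> deflation C d"
  by (auto simp: confl_def deflation_def)

lemma confl_inflation: "confl X i Y d Z \<Longrightarrow> inflation C i"
  by (auto simp: confl_def inflation_def)

lemma Confl_confl:
  assumes "(i, d) \<in> Confl C"
  shows "confl (Dom C i) i (Dom C d) d (Cod C d)"
  using conflation_kernel[OF assms] assms by (auto simp: confl_def is_kernel_def Hom_iff)

lemma deflation_confl:
  assumes "deflation C d" "d \<in> Hom C Y Z"
  obtains X i where "confl X i Y d Z"
  using assms Confl_confl that by (fastforce simp: deflation_def Hom_iff)

lemma inflation_confl:
  assumes "inflation C i" "i \<in> Hom C X Y"
  obtains d Z where "confl X i Y d Z"
proof -
  obtain d where d: "(i, d) \<in> Confl C" using assms by (auto simp: inflation_def)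
  have "confl (Dom C i) i (Dom C d) d (Cod C d)" using Confl_confl[OF d] .
  then have "confl X i Y d (Cod C d)" using assms(2) by (auto simp: confl_def Hom_iff)
  then show thesis using that by blast
qed

lemma confl_Zer: 
  assumes "confl X i Y d Z"
  shows "d \<cdot> i = Zer C X Z"
  using conflation_kernel[OF confl_types(1)[OF assms]] confl_types(2,3)[OF assms]
  by (auto simp: is_kernel_def Hom_iff)

lemma confl_simps:
  assumes "confl X i Y d Z"
  shows "i \<in> Arr C" "Dom C i = X" "Cod C i = Y" "d \<in> Arr C" "Dom C d = Y" "Cod C d = Z"
    "X \<in> Obj C" "Y \<in> Obj C" "Z \<in> Obj C" "d \<cdot> i = Zer C X Z"
    "\<lbrakk>x \<in> Arr C; Cod C x = X\<rbrakk> \<Longrightarrow> d \<cdot> (i \<cdot> x) = Zer C (Dom C x) Z"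
proof -
  note [simp] = confl_types(2,3)[OF assms, THEN Hom_facts]
  show "i \<in> Arr C" "Dom C i = X" "Cod C i = Y" "d \<in> Arr C" "Dom C d = Y" "Cod C d = Z"
    "X \<in> Obj C" "Y \<in> Obj C" "Z \<in> Obj C" by simp_all
  show "d \<cdot> i = Zer C X Z" by (rule confl_Zer[OF assms])
  then show "\<lbrakk>x \<in> Arr C; Cod C x = X\<rbrakk> \<Longrightarrow> d \<cdot> (i \<cdot> x) = Zer C (Dom C x) Z"
    using Cmp_red[OF confl_Zer[OF assms], of x] by simp
qed

lemma confl_lift:
  assumes "confl X i Y d Z" "f \<in> Hom C T Y" "d \<cdot> f = Zer C T Z"
  obtains u where "u \<in> Hom C T X" "i \<cdot> u = f"
proof -
  have "is_kernel C d i" "T \<in> Obj C"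
    using conflation_kernel confl_types(1)[OF assms(1)] Hom_facts[OF assms(2)] by auto
  then show thesis using assms that confl_simps[OF assms(1)] unfolding is_kernel_def by metis
qed

lemma confl_mono:
  assumes "confl X i Y d Z" "u \<in> Hom C T X" "v \<in> Hom C T X" "i \<cdot> u = i \<cdot> v"
  shows "u = v"
proof -
  note [simp] = confl_simps[OF assms(1)] assms(2,3)[THEN Hom_facts]
  have "is_kernel C d i"
    using conflation_kernel confl_types(1)[OF assms(1)] by auto
  moreover have "i \<cdot> v \<in> Hom C T Y" "d \<cdot> (i \<cdot> v) = Zer C T Z" by (simp_all add: Hom_iff)
  ultimately have "\<exists>!u. u \<in> Hom C T X \<and> i \<cdot> u = i \<cdot> v" unfolding is_kernel_def by simp
  then show ?thesis using assms by blast
qed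

lemma confl_colift:
  assumes "confl X i Y d Z" "f \<in> Hom C Y T" "f \<cdot> i = Zer C X T"
  obtains u where "u \<in> Hom C Z T" "u \<cdot> d = f"
proof -
  have "is_cokernel C i d" "T \<in> Obj C"
    using conflation_cokernel confl_types(1)[OF assms(1)] Hom_facts[OF assms(2)] by auto
  then show thesis using assms that confl_simps[OF assms(1)] unfolding is_cokernel_def by metis
qed

lemma confl_epi:
  assumes "confl X i Y d Z" "u \<in> Hom C Z T" "v \<in> Hom C Z T" "u \<cdot> d = v \<cdot> d"
  shows "u = v"
proof -
  note [simp] = confl_simps[OF assms(1)] assms(2,3)[THEN Hom_facts]
  have "is_cokernel C i d"
    using conflation_cokernel confl_types(1)[OF assms(1)] by auto
  moreover have "v \<cdot> d \<in> Hom C Y T" "(v \<cdot> d) \<cdot> i = Zer C X T" by (simp_all add: Hom_iff)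
  ultimately have "\<exists>!u. u \<in> Hom C Z T \<and> u \<cdot> d = v \<cdot> d" unfolding is_cokernel_def by simp
  then show ?thesis using assms by blast
qed

text \<open>The deflation \<open>d\<close> has some kernel \<open>k\<close> that forms a conflation
  with it. Since \<open>i\<close> has the same universal property, the two are isomorphic, and
  conflations are closed under isomorphism.\<close>

lemma conflI_deflation:
  assumes defl: "deflation C d" and d: "d \<in> Hom C Y Z" and i: "i \<in> Hom C X Y"
    and zero: "d \<cdot> i = Zer C X Z"
    and lift: "\<And>T f. \<lbrakk>f \<in> Hom C T Y; d \<cdot> f = Zer C T Z\<rbrakk> \<Longrightarrow> \<exists>u \<in> Hom C T X. i \<cdot> u = f"
    and mono: "\<And>T u. \<lbrakk>u \<in> Hom C T X; i \<cdot> u = Zer C T Y\<rbrakk> \<Longrightarrow> u = Zer C T X"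
  shows "confl X i Y d Z"
proof -
  obtain K k where k: "confl K k Y d Z" using deflation_confl[OF defl d] .
  note [simp] = confl_simps[OF k] i[THEN Hom_facts]
  obtain v where v: "v \<in> Hom C K X" "i \<cdot> v = k"
    using lift[of k K] confl_types(2)[OF k] by auto
  obtain u where u: "u \<in> Hom C X K" "k \<cdot> u = i"
    using confl_lift[OF k i zero] by metis
  note [simp] = v(1)[THEN Hom_facts] u(1)[THEN Hom_facts] v(2) u(2) Cmp_red[OF v(2)] Cmp_red[OF u(2)]
  have uv: "u \<cdot> v = Ide C K"
    by (rule confl_mono[OF k, of _ K]) (simp_all add: Hom_iff)
  have vu: "v \<cdot> u = Ide C X"
    by (rule mono_from_Zer[of _ X X _ i Y]) (simp_all add: Hom_iff mono)
  have iso: "iso_arr C v" by (rule iso_arrI[OF v(1) u(1) uv vu])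
  have "(i, d) \<in> Confl C"
    by (rule conflation_iso_closed[OF confl_types(1)[OF k], of i X Y d Z v "Ide C Y" "Ide C Z"])
      (simp_all add: Hom_iff iso iso_arr_Ide)
  then show ?thesis by (simp add: confl_def d i)
qed

lemma conflI_inflation:
  assumes infl: "inflation C i" and i: "i \<in> Hom C X Y" and d: "d \<in> Hom C Y Z"
    and zero: "d \<cdot> i = Zer C X Z"
    and colift: "\<And>T f. \<lbrakk>f \<in> Hom C Y T; f \<cdot> i = Zer C X T\<rbrakk> \<Longrightarrow> \<exists>u \<in> Hom C Z T. u \<cdot> d = f"
    and epi: "\<And>T u. \<lbrakk>u \<in> Hom C Z T; u \<cdot> d = Zer C Y T\<rbrakk> \<Longrightarrow> u = Zer C Z T"
  shows "confl X i Y d Z"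
proof -
  obtain K k where k: "confl X i Y k K" using inflation_confl[OF infl i] .
  note [simp] = confl_simps[OF k] d[THEN Hom_facts]
  obtain v where v: "v \<in> Hom C Z K" "v \<cdot> d = k"
    using colift[of k K] confl_types(3)[OF k] by auto
  obtain u where u: "u \<in> Hom C K Z" "u \<cdot> k = d"
    using confl_colift[OF k d zero] by metis
  note [simp] = v(1)[THEN Hom_facts] u(1)[THEN Hom_facts] v(2) u(2) Cmp_red[OF v(2)] Cmp_red[OF u(2)]
  have vu: "v \<cdot> u = Ide C K"
    by (rule confl_epi[OF k, of _ K]) (simp_all add: Hom_iff)
  have uv: "u \<cdot> v = Ide C Z"
    by (rule epi_from_Zer[of _ Z Z _ d Y]) (simp_all add: Hom_iff epi)
  have iso: "iso_arr C u" by (rule iso_arrI[OF u(1) v(1) vu uv])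
  have "(i, d) \<in> Confl C"
    by (rule conflation_iso_closed[OF confl_types(1)[OF k], of i X Y d Z "Ide C X" "Ide C Y" u])
      (simp_all add: Hom_iff iso iso_arr_Ide)
  then show ?thesis by (simp add: confl_def d i)
qed

section \<open>Split conflations\<close>

lemma confl_split_section:
  assumes c: "confl X i Y d Z" and s: "s \<in> Hom C Z Y" "d \<cdot> s = Ide C Z"
  obtains r where "is_biproduct C X Z Y i s r d"
proof -
  note [simp] = confl_simps[OF c] s(1)[THEN Hom_facts] s(2) Cmp_red[OF s(2)]
  \<comment> \<open>The projector onto the kernel along \<open>s\<close>; its lift through
    \<open>i\<close> is the retraction.\<close>
  define h where "h = Add C (Ide C Y) (neg (s \<cdot> d))"
  have "h \<in> Hom C Y Y" "d \<cdot> h = Zer C Y Z" by (simp_all add: h_def Hom_iff)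
  then obtain r where r: "r \<in> Hom C Y X" "i \<cdot> r = h" by (rule confl_lift[OF c])
  note [simp] = r(1)[THEN Hom_facts] r(2) Cmp_red[OF r(2)]
  have "r \<cdot> i = Ide C X"
    by (rule confl_mono[OF c, of _ X]) (simp_all add: Hom_iff h_def)
  moreover have "r \<cdot> s = Zer C Z X"
    by (rule confl_mono[OF c, of _ Z]) (simp_all add: Hom_iff h_def)
  ultimately have "is_biproduct C X Z Y i s r d"
    by (simp add: is_biproduct_def Hom_iff h_def Add_assoc)
  then show thesis by (rule that)
qed

lemma confl_split_retraction:
  assumes c: "confl X i Y d Z" and r: "r \<in> Hom C Y X" "r \<cdot> i = Ide C X"
  obtains s where "is_biproduct C X Z Y i s r d"
proof -
  note [simp] = confl_simps[OF c] r(1)[THEN Hom_facts] r(2) Cmp_red[OF r(2)]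
  \<comment> \<open>With the negated term in front, \<open>Add_neg_cancel\<close> reduces the sum of
    \<open>i \<cdot> r\<close> and \<open>h\<close> to the identity, which is the biproduct
    equation.\<close>
  define h where "h = Add C (neg (i \<cdot> r)) (Ide C Y)"
  have "h \<in> Hom C Y Y" "h \<cdot> i = Zer C X Y" by (simp_all add: h_def Hom_iff)
  then obtain s where s: "s \<in> Hom C Z Y" "s \<cdot> d = h" by (rule confl_colift[OF c])
  note [simp] = s(1)[THEN Hom_facts] s(2) Cmp_red[OF s(2)]
  have "d \<cdot> s = Ide C Z"
    by (rule confl_epi[OF c, of _ Z]) (simp_all add: Hom_iff h_def)
  moreover have "r \<cdot> s = Zer C Z X"
    by (rule confl_epi[OF c, of _ X]) (simp_all add: Hom_iff h_def)
  ultimately have "is_biproduct C X Z Y i s r d"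
    by (simp add: is_biproduct_def Hom_iff h_def)
  then show thesis by (rule that)
qed

end

section \<open>Pushouts, pullbacks and weak idempotent completeness\<close>

context category
begin

lemma Hom_surj_iff:
  assumes "f \<in> Arr C"
  shows "Hom_surj C W f \<longleftrightarrow> (\<forall>b \<in> Hom C W (Cod C f). \<exists>a \<in> Hom C W (Dom C f). f \<cdot> a = b)"
proof -
  have "(\<lambda>h. f \<cdot> h) ` Hom C W (Dom C f) \<subseteq> Hom C W (Cod C f)" using assms by (auto simp: Hom_iff)
  then have "Hom_surj C W f \<longleftrightarrow> Hom C W (Cod C f) \<subseteq> (\<lambda>h. f \<cdot> h) ` Hom C W (Dom C f)"
    by (simp add: Hom_surj_def set_eq_subset)
  also have "\<dots> \<longleftrightarrow> (\<forall>b \<in> Hom C W (Cod C f). \<exists>a \<in> Hom C W (Dom C f). f \<cdot> a = b)"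
    unfolding subset_iff image_iff by metis
  finally show ?thesis .
qed

lemma pushout_simps:
  assumes "is_pushout C i f i' f'"
  shows "i \<in> Arr C" "f \<in> Arr C" "i' \<in> Arr C" "f' \<in> Arr C" "Dom C f = Dom C i"
    "Dom C i' = Cod C f" "Dom C f' = Cod C i" "Cod C f' = Cod C i'" "f' \<cdot> i = i' \<cdot> f"
    "\<lbrakk>x \<in> Arr C; Cod C x = Dom C i\<rbrakk> \<Longrightarrow> f' \<cdot> (i \<cdot> x) = i' \<cdot> (f \<cdot> x)"
proof -
  show *: "i \<in> Arr C" "f \<in> Arr C" "i' \<in> Arr C" "f' \<in> Arr C" "Dom C f = Dom C i"
    "Dom C i' = Cod C f" "Dom C f' = Cod C i" "Cod C f' = Cod C i'" and eq: "f' \<cdot> i = i' \<cdot> f"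
    using assms by (auto simp: is_pushout_def Hom_iff)
  show "\<lbrakk>x \<in> Arr C; Cod C x = Dom C i\<rbrakk> \<Longrightarrow> f' \<cdot> (i \<cdot> x) = i' \<cdot> (f \<cdot> x)"
    using Cmp_red[OF eq, of x] * by simp
qed

lemma pushout_colift:
  assumes "is_pushout C i f i' f'" "a \<in> Hom C (Cod C i) T" "b \<in> Hom C (Cod C f) T" "a \<cdot> i = b \<cdot> f"
  obtains u where "u \<in> Hom C (Cod C i') T" "u \<cdot> f' = a" "u \<cdot> i' = b"
proof -
  have "T \<in> Obj C" using assms(2) Hom_facts by blast
  then have "\<exists>!u. u \<in> Hom C (Cod C i') T \<and> u \<cdot> f' = a \<and> u \<cdot> i' = b"
    using assms unfolding is_pushout_def by blast
  then show thesis using that by blast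
qed

lemma pushout_eq:
  assumes "is_pushout C i f i' f'" "u \<in> Hom C (Cod C i') T" "v \<in> Hom C (Cod C i') T"
    "u \<cdot> f' = v \<cdot> f'" "u \<cdot> i' = v \<cdot> i'"
  shows "u = v"
proof -
  note [simp] = pushout_simps[OF assms(1)] assms(2,3)[THEN Hom_facts]
  have "T \<in> Obj C" by simp
  moreover have "v \<cdot> f' \<in> Hom C (Cod C i) T" "v \<cdot> i' \<in> Hom C (Cod C f) T"
    "(v \<cdot> f') \<cdot> i = (v \<cdot> i') \<cdot> f" by (simp_all add: Hom_iff)
  ultimately have "\<exists>!u. u \<in> Hom C (Cod C i') T \<and> u \<cdot> f' = v \<cdot> f' \<and> u \<cdot> i' = v \<cdot> i'"
    using assms(1) unfolding is_pushout_def by blast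
  then show ?thesis using assms by blast
qed

lemma is_pushoutI:
  assumes "i \<in> Hom C X Y" "f \<in> Hom C X X'" "i' \<in> Hom C X' P" "f' \<in> Hom C Y P" "f' \<cdot> i = i' \<cdot> f"
    and "\<And>T a b. \<lbrakk>a \<in> Hom C Y T; b \<in> Hom C X' T; a \<cdot> i = b \<cdot> f\<rbrakk>
      \<Longrightarrow> \<exists>u \<in> Hom C P T. u \<cdot> f' = a \<and> u \<cdot> i' = b"
    and "\<And>T u v. \<lbrakk>u \<in> Hom C P T; v \<in> Hom C P T; u \<cdot> f' = v \<cdot> f'; u \<cdot> i' = v \<cdot> i'\<rbrakk> \<Longrightarrow> u = v"
  shows "is_pushout C i f i' f'"
proof -
  have t: "Dom C i = X" "Cod C i = Y" "Dom C f = X" "Cod C f = X'" "Cod C i' = P" and i: "i \<in> Arr C"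
    using assms(1-5) by (auto simp: Hom_iff)
  have *: "\<exists>!u. u \<in> Hom C P T \<and> u \<cdot> f' = a \<and> u \<cdot> i' = b"
    if "a \<in> Hom C Y T" "b \<in> Hom C X' T" "a \<cdot> i = b \<cdot> f" for T a b
    using assms(6)[OF that] assms(7)[of _ T] by (elim bexE, intro ex1I) auto
  show ?thesis unfolding is_pushout_def t by (intro conjI ballI impI i assms(2-5) *)
qed

lemma is_pushout_sym: "is_pushout C i f i' f' \<Longrightarrow> is_pushout C f i f' i'"
  unfolding is_pushout_def Hom_iff by (auto simp: conj_commute)

lemma pullback_simps:
  assumes "is_pullback C d f d' f'"
  shows "d \<in> Arr C" "f \<in> Arr C" "d' \<in> Arr C" "f' \<in> Arr C" "Cod C f = Cod C d"
    "Cod C d' = Dom C f" "Cod C f' = Dom C d" "Dom C f' = Dom C d'" "d \<cdot> f' = f \<cdot> d'"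
    "\<lbrakk>x \<in> Arr C; Cod C x = Dom C d'\<rbrakk> \<Longrightarrow> d \<cdot> (f' \<cdot> x) = f \<cdot> (d' \<cdot> x)"
proof -
  show *: "d \<in> Arr C" "f \<in> Arr C" "d' \<in> Arr C" "f' \<in> Arr C" "Cod C f = Cod C d"
    "Cod C d' = Dom C f" "Cod C f' = Dom C d" "Dom C f' = Dom C d'" and eq: "d \<cdot> f' = f \<cdot> d'"
    using assms by (auto simp: is_pullback_def Hom_iff)
  show "\<lbrakk>x \<in> Arr C; Cod C x = Dom C d'\<rbrakk> \<Longrightarrow> d \<cdot> (f' \<cdot> x) = f \<cdot> (d' \<cdot> x)"
    using Cmp_red[OF eq, of x] * by simp
qed

lemma pullback_lift:
  assumes "is_pullback C d f d' f'" "a \<in> Hom C T (Dom C d)" "b \<in> Hom C T (Dom C f)" "d \<cdot> a = f \<cdot> b"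
  obtains u where "u \<in> Hom C T (Dom C d')" "f' \<cdot> u = a" "d' \<cdot> u = b"
proof -
  have "T \<in> Obj C" using assms(2) Hom_facts by blast
  then have "\<exists>!u. u \<in> Hom C T (Dom C d') \<and> f' \<cdot> u = a \<and> d' \<cdot> u = b"
    using assms unfolding is_pullback_def by blast
  then show thesis using that by blast
qed

lemma pullback_eq:
  assumes "is_pullback C d f d' f'" "u \<in> Hom C T (Dom C d')" "v \<in> Hom C T (Dom C d')"
    "f' \<cdot> u = f' \<cdot> v" "d' \<cdot> u = d' \<cdot> v"
  shows "u = v"
proof -
  note [simp] = pullback_simps[OF assms(1)] assms(2,3)[THEN Hom_facts]
  have "T \<in> Obj C" by simp
  moreover have "f' \<cdot> v \<in> Hom C T (Dom C d)" "d' \<cdot> v \<in> Hom C T (Dom C f)"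
    "d \<cdot> (f' \<cdot> v) = f \<cdot> (d' \<cdot> v)" by (simp_all add: Hom_iff)
  ultimately have "\<exists>!u. u \<in> Hom C T (Dom C d') \<and> f' \<cdot> u = f' \<cdot> v \<and> d' \<cdot> u = d' \<cdot> v"
    using assms(1) unfolding is_pullback_def by blast
  then show ?thesis using assms by blast
qed

lemma is_pullbackI:
  assumes "d \<in> Hom C Y Z" "f \<in> Hom C Z' Z" "d' \<in> Hom C P Z'" "f' \<in> Hom C P Y" "d \<cdot> f' = f \<cdot> d'"
    and "\<And>T a b. \<lbrakk>a \<in> Hom C T Y; b \<in> Hom C T Z'; d \<cdot> a = f \<cdot> b\<rbrakk>
      \<Longrightarrow> \<exists>u \<in> Hom C T P. f' \<cdot> u = a \<and> d' \<cdot> u = b"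
    and "\<And>T u v. \<lbrakk>u \<in> Hom C T P; v \<in> Hom C T P; f' \<cdot> u = f' \<cdot> v; d' \<cdot> u = d' \<cdot> v\<rbrakk> \<Longrightarrow> u = v"
  shows "is_pullback C d f d' f'"
proof -
  have t: "Cod C d = Z" "Dom C d = Y" "Dom C f = Z'" "Cod C f = Z" "Dom C d' = P" and d: "d \<in> Arr C"
    using assms(1-5) by (auto simp: Hom_iff)
  have *: "\<exists>!u. u \<in> Hom C T P \<and> f' \<cdot> u = a \<and> d' \<cdot> u = b"
    if "a \<in> Hom C T Y" "b \<in> Hom C T Z'" "d \<cdot> a = f \<cdot> b" for T a b
    using assms(6)[OF that] assms(7)[of _ T] by (elim bexE, intro ex1I) auto
  show ?thesis unfolding is_pullback_def t by (intro conjI ballI impI d assms(2-5) *)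
qed

end

context exact_category
begin

text \<open>Pushing out preserves the cokernel: \<open>d\<close> and the zero map induce
  \<open>d'\<close>, and a map that kills \<open>i'\<close> kills \<open>i\<close> after restriction
  along \<open>f'\<close>, hence factors through \<open>d\<close>.\<close>

lemma pushout_confl_inflation:
  assumes c: "confl X i Y d Z" and po: "is_pushout C i f i' f'" and i': "inflation C i'"
  obtains d' where "confl (Cod C f) i' (Cod C i') d' Z" "d' \<cdot> f' = d"
proof -
  note [simp] = confl_simps[OF c] pushout_simps[OF po]
  have Obj [simp]: "Cod C f \<in> Obj C" "Cod C i' \<in> Obj C" using Cod_in by simp_all
  obtain d' where d': "d' \<in> Hom C (Cod C i') Z" "d' \<cdot> f' = d" "d' \<cdot> i' = Zer C (Cod C f) Z"
    by (rule pushout_colift[OF po, of d Z "Zer C (Cod C f) Z"]) (simp_all add: Hom_iff)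
  note [simp] = d'(1)[THEN Hom_facts] d'(2,3) Cmp_red[OF d'(2)] Cmp_red[OF d'(3)]
  have "confl (Cod C f) i' (Cod C i') d' Z"
  proof (rule conflI_inflation[OF i' _ d'(1,3)])
    show "i' \<in> Hom C (Cod C f) (Cod C i')" by (simp add: Hom_iff)
  next
    fix T g assume g: "g \<in> Hom C (Cod C i') T" "g \<cdot> i' = Zer C (Cod C f) T"
    note [simp] = g(1)[THEN Hom_facts] g(2) Cmp_red[OF g(2)]
    obtain z where z: "z \<in> Hom C Z T" "z \<cdot> d = g \<cdot> f'"
      by (rule confl_colift[OF c, of "g \<cdot> f'" T]) (simp_all add: Hom_iff)
    note [simp] = z(1)[THEN Hom_facts] z(2)
    have "z \<cdot> d' = g"
      by (rule pushout_eq[OF po, of _ T]) (simp_all add: Hom_iff)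
    then show "\<exists>u\<in>Hom C Z T. u \<cdot> d' = g" using z(1) by blast
  next
    fix T u assume u: "u \<in> Hom C Z T" "u \<cdot> d' = Zer C (Cod C i') T"
    note [simp] = u(1)[THEN Hom_facts]
    have "u \<cdot> d = (u \<cdot> d') \<cdot> f'" by simp
    also have "\<dots> = Zer C Z T \<cdot> d" by (simp add: u(2) del: Cmp_assoc')
    finally show "u = Zer C Z T"
      by - (rule confl_epi[OF c, of _ T], simp_all add: Hom_iff)
  qed
  then show thesis using d' that by blast
qed

lemma ex_pushout:
  assumes c: "confl X i Y d Z" and f: "f \<in> Hom C X X'"
  obtains P i' f' d' where "is_pushout C i f i' f'" "confl X' i' P d' Z" "f' \<in> Hom C Y P" "d' \<cdot> f' = d"
proof -
  note [simp] = confl_simps[OF c] f[THEN Hom_facts]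
  obtain i' f' where po: "is_pushout C i f i' f'" and i': "inflation C i'"
    using inflation_pushout[OF confl_inflation[OF c], of f] by auto
  obtain d' where "confl (Cod C f) i' (Cod C i') d' Z" "d' \<cdot> f' = d"
    using pushout_confl_inflation[OF c po i'] .
  then show thesis
    by (intro that[OF po, of "Cod C i'" d']) (simp_all add: Hom_iff pushout_simps[OF po])
qed

text \<open>The axiom supplies one pushout whose leg is an inflation. The comparison isomorphism
  carries its conflation over to the given pushout.\<close>

lemma pushout_confl:
  assumes c: "confl X i Y d Z" and po: "is_pushout C i f i' f'"
  obtains d' where "confl (Cod C f) i' (Cod C i') d' Z" "d' \<cdot> f' = d"
proof -
  note [simp] = confl_simps[OF c] pushout_simps[OF po]
  have Obj [simp]: "Cod C f \<in> Obj C" "Cod C i' \<in> Obj C" using Cod_in by simp_all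
  obtain Q j g e where po': "is_pushout C i f j g" and cj: "confl (Cod C f) j Q e Z"
    and g: "g \<in> Hom C Y Q" "e \<cdot> g = d"
    using ex_pushout[OF c, of f "Cod C f"] by (auto simp: Hom_iff)
  note [simp] = confl_simps[OF cj] g(1)[THEN Hom_facts] g(2) pushout_simps[OF po']
  obtain h where h: "h \<in> Hom C Q (Cod C i')" "h \<cdot> g = f'" "h \<cdot> j = i'"
    by (rule pushout_colift[OF po', of f' "Cod C i'" i']) (simp_all add: Hom_iff)
  obtain k where k: "k \<in> Hom C (Cod C i') Q" "k \<cdot> f' = g" "k \<cdot> i' = j"
    by (rule pushout_colift[OF po, of g Q j]) (simp_all add: Hom_iff)
  note [simp] = h(1)[THEN Hom_facts] k(1)[THEN Hom_facts] h(2,3) k(2,3)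
  have kh: "k \<cdot> h = Ide C Q"
    by (rule pushout_eq[OF po', of _ Q]) (simp_all add: Hom_iff)
  have hk: "h \<cdot> k = Ide C (Cod C i')"
    by (rule pushout_eq[OF po, of _ "Cod C i'"]) (simp_all add: Hom_iff)
  have iso: "iso_arr C h" by (rule iso_arrI[OF h(1) k(1) kh hk])
  have "(i', e \<cdot> k) \<in> Confl C"
    by (rule conflation_iso_closed[OF confl_types(1)[OF cj], of i' "Cod C f" "Cod C i'" "e \<cdot> k" Z 
          "Ide C (Cod C f)" h "Ide C Z"]) (simp_all add: Hom_iff iso iso_arr_Ide kh)
  then show thesis
    by (intro that[of "e \<cdot> k"]) (simp_all add: confl_def Hom_iff)
qed

lemma pullback_confl:
  assumes c: "confl X k Y d Z" and pb: "is_pullback C d f d' f'" and d': "deflation C d'"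
  obtains k' where "confl X k' (Dom C d') d' (Dom C f)" "f' \<cdot> k' = k"
proof -
  note [simp] = confl_simps[OF c] pullback_simps[OF pb]
  have Obj [simp]: "Dom C f \<in> Obj C" "Dom C d' \<in> Obj C" using Dom_in by simp_all
  obtain k' where k': "k' \<in> Hom C X (Dom C d')" "f' \<cdot> k' = k" "d' \<cdot> k' = Zer C X (Dom C f)"
    by (rule pullback_lift[OF pb, of k X "Zer C X (Dom C f)"]) (simp_all add: Hom_iff)
  note [simp] = k'(1)[THEN Hom_facts] k'(2,3) Cmp_red[OF k'(2)] Cmp_red[OF k'(3)]
  have "confl X k' (Dom C d') d' (Dom C f)"
  proof (rule conflI_deflation[OF d' _ k'(1,3)])
    show "d' \<in> Hom C (Dom C d') (Dom C f)" by (simp add: Hom_iff)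
  next
    fix T g assume g: "g \<in> Hom C T (Dom C d')" "d' \<cdot> g = Zer C T (Dom C f)"
    note [simp] = g(1)[THEN Hom_facts] g(2)
    obtain z where z: "z \<in> Hom C T X" "k \<cdot> z = f' \<cdot> g"
      by (rule confl_lift[OF c, of "f' \<cdot> g" T]) (simp_all add: Hom_iff)
    note [simp] = z(1)[THEN Hom_facts] z(2)
    have "k' \<cdot> z = g"
      by (rule pullback_eq[OF pb, of _ T]) (simp_all add: Hom_iff)
    then show "\<exists>u\<in>Hom C T X. k' \<cdot> u = g" using z(1) by blast
  next
    fix T u assume u: "u \<in> Hom C T X" "k' \<cdot> u = Zer C T (Dom C d')"
    note [simp] = u(1)[THEN Hom_facts]
    have "k \<cdot> u = f' \<cdot> (k' \<cdot> u)" by simp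
    also have "\<dots> = k \<cdot> Zer C T X" by (simp add: u(2) del: k' Cmp_red[OF k'(2)])
    finally show "u = Zer C T X"
      by - (rule confl_mono[OF c, of _ T], simp_all add: Hom_iff)
  qed
  then show thesis using k' that by blast
qed

lemma ex_pullback:
  assumes c: "confl X k Y d Z" and f: "f \<in> Hom C Z' Z"
  obtains P k' d' f' where "is_pullback C d f d' f'" "confl X k' P d' Z'" "f' \<in> Hom C P Y" "f' \<cdot> k' = k"
proof -
  note [simp] = confl_simps[OF c] f[THEN Hom_facts]
  obtain d' f' where pb: "is_pullback C d f d' f'" and d': "deflation C d'"
    using deflation_pullback[OF confl_deflation[OF c], of f] by auto
  obtain k' where "confl X k' (Dom C d') d' (Dom C f)" "f' \<cdot> k' = k"
    using pullback_confl[OF c pb d'] .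
  then show thesis
    by (intro that[OF pb, of k' "Dom C d'"]) (simp_all add: Hom_iff pullback_simps[OF pb])
qed

end

locale wic_exact_category = exact_category +
  assumes wic: "weakly_idempotent_complete C"
begin

lemma split_epi_deflation:
  "\<lbrakk>f \<in> Hom C A B; s \<in> Hom C B A; f \<cdot> s = Ide C B\<rbrakk> \<Longrightarrow> deflation C f"
  using wic splitting_epiI by (auto simp: weakly_idempotent_complete_def)

text \<open>The projection \<open>p2\<close> is split by \<open>i2\<close>, hence a deflation by
  weak idempotent completeness, and the decomposition of the identity shows that \<open>i1\<close>
  is its kernel.\<close>

lemma biproduct_confl:
  assumes b: "is_biproduct C A B P i1 i2 p1 p2"
  shows "confl A i1 P p2 B"
proof -
  note [simp] = biproduct_simps[OF b]
  show ?thesis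
  proof (rule conflI_deflation)
    show "deflation C p2" by (rule split_epi_deflation[of _ P B i2]) (simp_all add: Hom_iff)
  next
    fix T f assume f: "f \<in> Hom C T P" "p2 \<cdot> f = Zer C T B"
    note [simp] = f(1)[THEN Hom_facts] f(2)
    have "i1 \<cdot> (p1 \<cdot> f) = f" using biproduct_decomp_left[OF b f(1)] by simp
    then show "\<exists>u\<in>Hom C T A. i1 \<cdot> u = f" by (intro bexI[of _ "p1 \<cdot> f"]) (simp_all add: Hom_iff)
  next
    fix T u assume u: "u \<in> Hom C T A" "i1 \<cdot> u = Zer C T P"
    note [simp] = u(1)[THEN Hom_facts]
    have "u = p1 \<cdot> (i1 \<cdot> u)" by simp
    also have "\<dots> = Zer C T A" unfolding u(2) by simp
    finally show "u = Zer C T A" .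
  qed (simp_all add: Hom_iff)
qed

text \<open>Weak idempotent completeness provides a kernel of \<open>e\<close>, and this kernel is
  the missing complement of \<open>B\<close> in \<open>Y\<close>.\<close>

lemma split_epi_biproduct:
  assumes "e \<in> Hom C Y B" "s \<in> Hom C B Y" "e \<cdot> s = Ide C B"
  obtains A a r where "is_biproduct C A B Y a s r e"
proof -
  obtain A a where c: "confl A a Y e B"
    using deflation_confl[OF split_epi_deflation[OF assms] assms(1)] .
  show thesis using confl_split_section[OF c assms(2,3)] that by metis
qed

text \<open>Splitting \<open>e\<close> off the kernel \<open>l\<close> of \<open>g e\<close> leaves a summand \<open>K\<close>, and \<open>K \<rightarrow> B\<close> is the pushout of \<open>l\<close>
  along the projection onto \<open>K\<close>; its cokernel is \<open>g\<close>.\<close>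

lemma deflation_cancel_split:
  assumes e: "e \<in> Hom C Y B" "s \<in> Hom C B Y" "e \<cdot> s = Ide C B"
    and g: "g \<in> Hom C B Z" and defl: "deflation C (g \<cdot> e)"
  shows "deflation C g"
proof -
  obtain A a r where b: "is_biproduct C A B Y a s r e" using split_epi_biproduct[OF e] .
  note [simp] = biproduct_simps[OF b] g[THEN Hom_facts]
  have "g \<cdot> e \<in> Hom C Y Z" by (simp add: Hom_iff)
  then obtain L l where cl: "confl L l Y (g \<cdot> e) Z" using deflation_confl[OF defl] by blast
  note [simp] = confl_simps(1-3,7-9)[OF cl]
  have gel: "g \<cdot> (e \<cdot> l) = Zer C L Z" using confl_simps(10)[OF cl] by simp
  \<comment> \<open>Because \<open>e \<cdot> a\<close> vanishes, the summand \<open>A\<close> of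
    \<open>Y\<close> lies in the kernel of \<open>g \<cdot> e\<close>.\<close>
  obtain j where j: "j \<in> Hom C A L" "l \<cdot> j = a"
    by (rule confl_lift[OF cl, of a A]) (simp_all add: Hom_iff)
  note [simp] = j(1)[THEN Hom_facts] j(2) Cmp_red[OF j(2)]
  \<comment> \<open>The map \<open>r \<cdot> l\<close> is split by \<open>j\<close>, since
    \<open>r \<cdot> a\<close> is the identity; \<open>K\<close> is the resulting complement of
    \<open>A\<close> in \<open>L\<close>.\<close>
  obtain K m q where bm: "is_biproduct C K A L m j q (r \<cdot> l)"
    using split_epi_biproduct[of "r \<cdot> l" L A j] by (auto simp: Hom_iff)
  note [simp] = biproduct_simps(1-6,13-18)[OF bm] biproduct_simps(7-9,16,18,20)[OF bm] 
  have "r \<cdot> (l \<cdot> m) = Zer C K A" using biproduct_simps(19)[OF bm] by simp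
  note [simp] = this
  have ls: "Add C (l \<cdot> (m \<cdot> q)) (a \<cdot> (r \<cdot> l)) = l"
    using biproduct_decomp_right[OF bm, of l Y] by (simp add: Hom_iff)
  have po: "is_pushout C l q (e \<cdot> (l \<cdot> m)) e"
  proof (rule is_pushoutI)
    have "e \<cdot> Add C (l \<cdot> (m \<cdot> q)) (a \<cdot> (r \<cdot> l)) = e \<cdot> l" by (simp only: ls)
    then show "e \<cdot> l = (e \<cdot> (l \<cdot> m)) \<cdot> q" by simp
  next
    fix T x y assume x: "x \<in> Hom C Y T" and y: "y \<in> Hom C K T" and eq: "x \<cdot> l = y \<cdot> q"
    note [simp] = x[THEN Hom_facts] y[THEN Hom_facts] eq Cmp_red[OF eq]
    have "x \<cdot> a = (x \<cdot> l) \<cdot> j" by (simp del: eq Cmp_red[OF eq])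
    also have "\<dots> = Zer C A T" by (simp add: eq)
    finally have xa: "x \<cdot> a = Zer C A T" .
    \<comment> \<open>A map on \<open>Y\<close> that vanishes on \<open>A\<close> is determined by
      its restriction along \<open>s\<close>, so \<open>x \<cdot> s\<close> is the induced map on
      the pushout.\<close>
    have xse: "x \<cdot> (s \<cdot> e) = x" 
      using biproduct_decomp_right[OF b x] Cmp_red[OF xa, of r] by simp
    have "x \<cdot> (s \<cdot> (e \<cdot> (l \<cdot> m))) = y" using Cmp_red[OF xse, of "l \<cdot> m"] by simp
    then show "\<exists>u\<in>Hom C B T. u \<cdot> e = x \<and> u \<cdot> (e \<cdot> (l \<cdot> m)) = y"
      using xse by (intro bexI[of _ "x \<cdot> s"]) (simp_all add: Hom_iff)
  next
    fix T u v assume u: "u \<in> Hom C B T" "v \<in> Hom C B T" "u \<cdot> e = v \<cdot> e"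
    note [simp] = u(1,2)[THEN Hom_facts]
    show "u = v" using Cmp_red[OF u(3), of s] by simp
  qed (simp_all add: Hom_iff)
  obtain d' where d': "confl K (e \<cdot> (l \<cdot> m)) B d' Z" "d' \<cdot> e = g \<cdot> e"
    using pushout_confl[OF cl po] by auto
  note [simp] = confl_simps(4-6)[OF d'(1)]
  \<comment> \<open>The two maps agree after the split epimorphism \<open>e\<close>.\<close>
  have "d' = g" using Cmp_red[OF d'(2), of s] by simp
  then show ?thesis using confl_deflation[OF d'(1)] by simp
qed

text \<open>The axiom speaks about one chosen pullback. The comparison \<open>h\<close> to it is a
  splitting epimorphism, hence a deflation, and \<open>d'\<close> is the composite of
  \<open>h\<close> and the deflation \<open>e\<close>.\<close>

lemma pullback_deflation:
  assumes d: "deflation C d" and pb: "is_pullback C d f d' f'"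
  shows "deflation C d'"
proof -
  note [simp] = pullback_simps[OF pb]
  have Obj [simp]: "Dom C d' \<in> Obj C" using Dom_in by simp
  obtain e g where pb': "is_pullback C d f e g" and e: "deflation C e"
    using deflation_pullback[OF d, of f] by auto
  note [simp] = pullback_simps[OF pb']
  have Obj' [simp]: "Dom C e \<in> Obj C" using Dom_in by simp
  obtain h where h: "h \<in> Hom C (Dom C d') (Dom C e)" "g \<cdot> h = f'" "e \<cdot> h = d'"
    by (rule pullback_lift[OF pb', of f' "Dom C d'" d']) (simp_all add: Hom_iff)
  obtain k where k: "k \<in> Hom C (Dom C e) (Dom C d')" "f' \<cdot> k = g" "d' \<cdot> k = e"
    by (rule pullback_lift[OF pb, of g "Dom C e" e]) (simp_all add: Hom_iff)
  note [simp] = h(1)[THEN Hom_facts] k(1)[THEN Hom_facts]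
  note [simp] = h(2,3) k(2,3) Cmp_red[OF h(2)] Cmp_red[OF h(3)] 
  have "h \<cdot> k = Ide C (Dom C e)"
    by (rule pullback_eq[OF pb', of _ "Dom C e"]) (simp_all add: Hom_iff)
  then have "deflation C h" using split_epi_deflation h(1) k(1) by blast
  then show ?thesis using deflation_Cmp[OF _ e, of h] by simp
qed

text \<open>If \<open>g f\<close> is a deflation then so is \<open>(g f, g) : A \<oplus> B \<rightarrow> D\<close>, and it equals \<open>g\<close> after the split
  epimorphism \<open>(f, 1) : A \<oplus> B \<rightarrow> B\<close>.\<close>

lemma deflation_cancel:
  assumes f: "f \<in> Hom C A B" and g: "g \<in> Hom C B D" and defl: "deflation C (g \<cdot> f)"
  shows "deflation C g"
proof -
  note [simp] = f[THEN Hom_facts] g[THEN Hom_facts]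
  obtain P i1 i2 p1 p2 where b: "is_biproduct C A B P i1 i2 p1 p2"
    using ex_biproduct[of A B] by auto
  obtain Q j1 j2 q1 q2 where b': "is_biproduct C D B Q j1 j2 q1 q2"
    using ex_biproduct[of D B] by auto
  note [simp] = biproduct_simps[OF b] biproduct_simps[OF b']
  \<comment> \<open>The diagonal map from \<open>A \<oplus> B\<close> to \<open>D \<oplus> B\<close>
    with entries \<open>g \<cdot> f\<close> and the identity. It is the pullback of
    \<open>g \<cdot> f\<close> along the projection to \<open>D\<close>.\<close>
  define e where "e = Add C (j1 \<cdot> (g \<cdot> (f \<cdot> p1))) (j2 \<cdot> p2)"
  have e [simp]: "e \<in> Arr C" "Dom C e = P" "Cod C e = Q" by (simp_all add: e_def)
  have q1e: "q1 \<cdot> e = g \<cdot> (f \<cdot> p1)" and q2e: "q2 \<cdot> e = p2" by (simp_all add: e_def)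
  note [simp] = q1e q2e Cmp_red[OF q1e] Cmp_red[OF q2e]
  have pb: "is_pullback C (g \<cdot> f) q1 e p1"
  proof (rule is_pullbackI)
    fix T a x assume ax: "a \<in> Hom C T A" "x \<in> Hom C T Q" "(g \<cdot> f) \<cdot> a = q1 \<cdot> x"
    note [simp] = ax(1,2)[THEN Hom_facts]
    have gfa [simp]: "g \<cdot> (f \<cdot> a) = q1 \<cdot> x" using ax(3) by simp
    have e_u: "e \<cdot> Add C (i1 \<cdot> a) (i2 \<cdot> (q2 \<cdot> x)) = x"
      using biproduct_decomp_left[OF b' ax(2)] by (simp add: e_def)
    have p1_u: "p1 \<cdot> Add C (i1 \<cdot> a) (i2 \<cdot> (q2 \<cdot> x)) = a" by simp
    have "Add C (i1 \<cdot> a) (i2 \<cdot> (q2 \<cdot> x)) \<in> Hom C T P" by (simp add: Hom_iff)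
    with e_u p1_u show "\<exists>u\<in>Hom C T P. p1 \<cdot> u = a \<and> e \<cdot> u = x" by blast
  next
    fix T u v assume uv: "u \<in> Hom C T P" "v \<in> Hom C T P" "p1 \<cdot> u = p1 \<cdot> v" "e \<cdot> u = e \<cdot> v"
    note [simp] = uv(1,2)[THEN Hom_facts]
    have "q2 \<cdot> (e \<cdot> u) = q2 \<cdot> (e \<cdot> v)" using uv(4) by (simp only:)
    then have "p2 \<cdot> u = p2 \<cdot> v" by simp
    with uv(3) show "u = v"
      using biproduct_decomp_left[OF b uv(1)] biproduct_decomp_left[OF b uv(2)] by metis
  qed (simp_all add: Hom_iff)
  have "deflation C e" by (rule pullback_deflation[OF defl pb])
  \<comment> \<open>The map \<open>(1, g)\<close> on \<open>D \<oplus> B\<close> is split by the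
    inclusion of \<open>D\<close>; after \<open>e\<close> it becomes
    \<open>(g \<cdot> f, g)\<close>.\<close>
  moreover have "deflation C (Add C q1 (g \<cdot> q2))"
    by (rule split_epi_deflation[of _ Q D j1]) (simp_all add: Hom_iff)
  ultimately have "deflation C (Add C q1 (g \<cdot> q2) \<cdot> e)"
    by (intro deflation_Cmp) simp_all
  moreover have "Add C q1 (g \<cdot> q2) \<cdot> e = g \<cdot> Add C (f \<cdot> p1) p2" by simp
  ultimately have "deflation C (g \<cdot> Add C (f \<cdot> p1) p2)" by simp
  then show ?thesis
    by (rule deflation_cancel_split[where s = i2 and Y = P and B = B and Z = D, rotated -1]) (simp_all add: Hom_iff)
qed

end

section \<open>Extensions and cotorsion pairs\<close>

context wic_exact_category
begin

lemma extensions_confl: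
  "(i, d) \<in> extensions C X Y \<longleftrightarrow> (\<exists>E. confl Y i E d X)"
proof
  assume "(i, d) \<in> extensions C X Y"
  then show "\<exists>E. confl Y i E d X" using Confl_confl[of i d] by (auto simp: extensions_def)
next
  assume "\<exists>E. confl Y i E d X"
  then show "(i, d) \<in> extensions C X Y" by (auto simp: extensions_def confl_def Hom_iff)
qed

lemma biproducts_extension_equiv:
  assumes b: "is_biproduct C Y X P i s r d" and b': "is_biproduct C Y X P' i' s' r' d'"
  shows "((i, d), (i', d')) \<in> extension_equiv C X Y"
proof -
  note [simp] = biproduct_simps[OF b] biproduct_simps[OF b'] biproduct_decomp[OF b] biproduct_decomp[OF b']
  define h where "h = Add C (i' \<cdot> r) (s' \<cdot> d)"
  define k where "k = Add C (i \<cdot> r') (s \<cdot> d')"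
  have h: "h \<in> Hom C P P'" and k: "k \<in> Hom C P' P" by (simp_all add: h_def k_def Hom_iff)
  have "k \<cdot> h = Ide C P" "h \<cdot> k = Ide C P'" by (simp_all add: h_def k_def)
  then have iso: "iso_arr C h" using iso_arrI h k by blast
  have "h \<cdot> i = i'" "d' \<cdot> h = d" by (simp_all add: h_def)
  then show ?thesis
    using h iso biproduct_confl[OF b] biproduct_confl[OF b']
    by (auto simp: extension_equiv_def extensions_confl)
qed

text \<open>If there is only the zero class, an equivalence with a biproduct transports its section.
  If all extensions split, any two are equivalent because both are biproducts of the same objects,
  so the quotient is a single class; it is nonempty by the biproduct.\<close>

lemma Ext1_vanishes_iff:
  assumes [simp]: "X \<in> Obj C" "Y \<in> Obj C"
  shows "Ext1_vanishes C X Y \<longleftrightarrow>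
    (\<forall>i E d. confl Y i E d X \<longrightarrow> (\<exists>s \<in> Hom C X E. d \<cdot> s = Ide C X))"
proof (intro iffI allI impI)
  fix i E d assume v: "Ext1_vanishes C X Y" and c: "confl Y i E d X"
  note [simp] = confl_simps[OF c]
  have ext: "(i, d) \<in> extensions C X Y" using c by (auto simp: extensions_confl)
  have "((i, d), (i, d)) \<in> extension_equiv C X Y"
    using ext by (auto simp: extension_equiv_def Hom_iff iso_arr_Ide intro!: bexI[of _ "Ide C E"])
  moreover have "extension_equiv C X Y `` {(i, d)} = Ext1_zero C X Y"
    using v quotientI[OF ext, of "extension_equiv C X Y"] unfolding Ext1_vanishes_def Ext1_def by blast
  ultimately have "(i, d) \<in> Ext1_zero C X Y" by blast
  then obtain i1 p2 P i2 p1 where b: "is_biproduct C Y X P i1 i2 p1 p2"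
    and e: "((i1, p2), (i, d)) \<in> extension_equiv C X Y"
    by (auto simp: Ext1_zero_def)
  note [simp] = biproduct_simps[OF b]
  obtain h where h: "h \<in> Hom C P E" "d \<cdot> h = p2"
    using e by (auto simp: extension_equiv_def)
  note [simp] = h(1)[THEN Hom_facts]
  have "d \<cdot> (h \<cdot> i2) = Ide C X" using Cmp_red[OF h(2), of i2] by simp
  then show "\<exists>s\<in>Hom C X E. d \<cdot> s = Ide C X" by (intro bexI[of _ "h \<cdot> i2"]) (simp_all add: Hom_iff)
next
  assume split: "\<forall>i E d. confl Y i E d X \<longrightarrow> (\<exists>s \<in> Hom C X E. d \<cdot> s = Ide C X)"
  have bip: "\<exists>P s r. is_biproduct C Y X P i s r d" if "(i, d) \<in> extensions C X Y" for i d
    using that split confl_split_section by (metis extensions_confl)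
  have equiv: "extension_equiv C X Y = extensions C X Y \<times> extensions C X Y"
  proof
    show "extension_equiv C X Y \<subseteq> extensions C X Y \<times> extensions C X Y"
      by (auto simp: extension_equiv_def)
    have "((i, d), (i', d')) \<in> extension_equiv C X Y"
      if "(i, d) \<in> extensions C X Y" "(i', d') \<in> extensions C X Y" for i d i' d'
      using bip[OF that(1)] bip[OF that(2)] biproducts_extension_equiv by blast
    then show "extensions C X Y \<times> extensions C X Y \<subseteq> extension_equiv C X Y" by auto
  qed
  obtain P i1 i2 p1 p2 where b: "is_biproduct C Y X P i1 i2 p1 p2" using ex_biproduct[of Y X] by auto
  have ne: "(i1, p2) \<in> extensions C X Y" using biproduct_confl[OF b] by (auto simp: extensions_confl)
  have "Ext1_zero C X Y = extensions C X Y"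
    unfolding Ext1_zero_def equiv using ne b by blast
  moreover have "Ext1 C X Y = {extensions C X Y}"
    unfolding Ext1_def quotient_def equiv using ne by blast
  ultimately show "Ext1_vanishes C X Y" by (simp add: Ext1_vanishes_def)
qed

end

locale omega_setup = wic_exact_category C
  for C :: "('o, 'm, 'z) exact_cat_scheme" (structure) and \<X> \<Y> :: "'o set" +
  assumes complete: "complete_cotorsion_pair C \<X> \<Y>"
    and hereditary: "hereditary_cotorsion_pair C \<X> \<Y>"
    and contra_finite: "contravariantly_finite C (\<X> \<inter> \<Y>)"
begin

lemma cotorsion:
  "\<X> = {X \<in> Obj C. \<forall>F \<in> \<Y>. Ext1_vanishes C X F}" "\<Y> = {Y \<in> Obj C. \<forall>X \<in> \<X>. Ext1_vanishes C X Y}"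
  using complete unfolding complete_cotorsion_pair_def cotorsion_pair_def by (rule conjunct1[THEN conjunct1], rule conjunct1[THEN conjunct2])

lemma \<X>_Obj: "X \<in> \<X> \<Longrightarrow> X \<in> Obj C"
  using cotorsion(1) by blast

lemma \<Y>_Obj: "Y \<in> \<Y> \<Longrightarrow> Y \<in> Obj C"
  using cotorsion(2) by blast

lemma \<X>I:
  assumes "X \<in> Obj C" "\<And>F i E d. \<lbrakk>F \<in> \<Y>; confl F i E d X\<rbrakk> \<Longrightarrow> \<exists>s \<in> Hom C X E. d \<cdot> s = Ide C X"
  shows "X \<in> \<X>"
proof -
  have "Ext1_vanishes C X F" if "F \<in> \<Y>" for F
    using assms(2)[OF that] assms(1) \<Y>_Obj[OF that] by (simp add: Ext1_vanishes_iff)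
  then show ?thesis using assms(1) cotorsion(1) by blast
qed

lemma \<Y>I:
  assumes "Y \<in> Obj C" "\<And>X i E d. \<lbrakk>X \<in> \<X>; confl Y i E d X\<rbrakk> \<Longrightarrow> \<exists>r \<in> Hom C E Y. r \<cdot> i = Ide C Y"
  shows "Y \<in> \<Y>"
proof -
  have "\<exists>s \<in> Hom C X E. d \<cdot> s = Ide C X" if X: "X \<in> \<X>" and c: "confl Y i E d X" for X i E d
  proof -
    obtain r where r: "r \<in> Hom C E Y" "r \<cdot> i = Ide C Y" using assms(2)[OF X c] by blast
    obtain s where "is_biproduct C Y X E i s r d" by (rule confl_split_retraction[OF c r])
    then show ?thesis by (auto simp: is_biproduct_def)
  qed
  then have "Ext1_vanishes C X Y" if "X \<in> \<X>" for X
    using that assms(1) \<X>_Obj[OF that] by (simp add: Ext1_vanishes_iff)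
  then show ?thesis using assms(1) cotorsion(2) by blast
qed

lemma confl_section:
  assumes "confl Y i E d X" "X \<in> \<X>" "Y \<in> \<Y>"
  obtains s where "s \<in> Hom C X E" "d \<cdot> s = Ide C X"
proof -
  have "Ext1_vanishes C X Y" using assms(2,3) cotorsion(1) by blast
  then show thesis using assms(1) that by (auto simp: Ext1_vanishes_iff[OF \<X>_Obj[OF assms(2)] \<Y>_Obj[OF assms(3)]])
qed

text \<open>The pullback of the conflation along \<open>f\<close> is an extension of
  \<open>X\<close> by \<open>Y\<close>, hence splits; its section followed by the map to
  \<open>E\<close> is the lift. Dually, \<open>\<Y>_extend\<close> splits a pushout.\<close>

lemma \<X>_lift:
  assumes c: "confl Y k E d B" and Y: "Y \<in> \<Y>" and X: "X \<in> \<X>" and f: "f \<in> Hom C X B"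
  obtains u where "u \<in> Hom C X E" "d \<cdot> u = f"
proof -
  note [simp] = confl_simps[OF c] f[THEN Hom_facts]
  obtain P k' d' f' where pb: "is_pullback C d f d' f'" and c': "confl Y k' P d' X" and f': "f' \<in> Hom C P E"
    by (rule ex_pullback[OF c f])
  note [simp] = confl_simps[OF c'] f'[THEN Hom_facts] pullback_simps(9,10)[OF pb]
  obtain s where s: "s \<in> Hom C X P" "d' \<cdot> s = Ide C X" by (rule confl_section[OF c' X Y])
  note [simp] = s(1)[THEN Hom_facts] s(2)
  show thesis by (rule that[of "f' \<cdot> s"]) (simp_all add: Hom_iff)
qed

lemma \<Y>_extend:
  assumes c: "confl A i B d X" and X: "X \<in> \<X>" and Y: "Y \<in> \<Y>" and f: "f \<in> Hom C A Y"
  obtains u where "u \<in> Hom C B Y" "u \<cdot> i = f"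
proof -
  note [simp] = confl_simps[OF c] f[THEN Hom_facts]
  obtain P i' f' d' where po: "is_pushout C i f i' f'" and c': "confl Y i' P d' X" and f': "f' \<in> Hom C B P"
    by (rule ex_pushout[OF c f])
  note [simp] = confl_simps[OF c'] f'[THEN Hom_facts] pushout_simps(9,10)[OF po]
  obtain s where s: "s \<in> Hom C X P" "d' \<cdot> s = Ide C X" by (rule confl_section[OF c' X Y])
  obtain r where b: "is_biproduct C Y X P i' s r d'" by (rule confl_split_section[OF c' s])
  note [simp] = biproduct_simps[OF b]
  show thesis by (rule that[of "r \<cdot> f'"]) (simp_all add: Hom_iff)
qed

text \<open>To split an extension of \<open>A\<close>, lift \<open>q\<close> through its deflation
  and restrict the lift along \<open>m\<close>.\<close>

lemma \<X>_retract:
  assumes X: "X \<in> \<X>" and m: "m \<in> Hom C A X" and q: "q \<in> Hom C X A" "q \<cdot> m = Ide C A"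
  shows "A \<in> \<X>"
proof (rule \<X>I)
  note [simp] = m[THEN Hom_facts] q(1)[THEN Hom_facts] q(2)
  show "A \<in> Obj C" by simp
  fix F i E d assume F: "F \<in> \<Y>" and c: "confl F i E d A"
  note [simp] = confl_simps[OF c]
  obtain u where u: "u \<in> Hom C X E" "d \<cdot> u = q" by (rule \<X>_lift[OF c F X q(1)])
  note [simp] = u(1)[THEN Hom_facts] u(2) Cmp_red[OF u(2)]
  show "\<exists>s\<in>Hom C A E. d \<cdot> s = Ide C A" by (intro bexI[of _ "u \<cdot> m"]) (simp_all add: Hom_iff)
qed

lemma \<Y>_retract:
  assumes Y: "Y \<in> \<Y>" and m: "m \<in> Hom C A Y" and q: "q \<in> Hom C Y A" "q \<cdot> m = Ide C A"
  shows "A \<in> \<Y>"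
proof (rule \<Y>I)
  note [simp] = m[THEN Hom_facts] q(1)[THEN Hom_facts] q(2)
  show "A \<in> Obj C" by simp
  fix X i E d assume X: "X \<in> \<X>" and c: "confl A i E d X"
  note [simp] = confl_simps[OF c]
  obtain u where u: "u \<in> Hom C E Y" "u \<cdot> i = m" by (rule \<Y>_extend[OF c X Y m])
  note [simp] = u(1)[THEN Hom_facts] u(2) Cmp_red[OF u(2)]
  show "\<exists>r\<in>Hom C E A. r \<cdot> i = Ide C A" by (intro bexI[of _ "q \<cdot> u"]) (simp_all add: Hom_iff)
qed

lemma \<X>_biproduct:
  assumes b: "is_biproduct C A B P i1 i2 p1 p2" and A: "A \<in> \<X>" and B: "B \<in> \<X>"
  shows "P \<in> \<X>"
proof (rule \<X>I)
  note [simp] = biproduct_simps[OF b] biproduct_decomp[OF b]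
  show "P \<in> Obj C" by simp
  fix F i E d assume F: "F \<in> \<Y>" and c: "confl F i E d P"
  note [simp] = confl_simps[OF c]
  obtain u where u: "u \<in> Hom C A E" "d \<cdot> u = i1" by (rule \<X>_lift[OF c F A, of i1]) (simp add: Hom_iff)
  obtain v where v: "v \<in> Hom C B E" "d \<cdot> v = i2" by (rule \<X>_lift[OF c F B, of i2]) (simp add: Hom_iff)
  note [simp] = u(1)[THEN Hom_facts] Cmp_red[OF u(2)] v(1)[THEN Hom_facts] Cmp_red[OF v(2)]
  show "\<exists>s\<in>Hom C P E. d \<cdot> s = Ide C P"
    by (intro bexI[of _ "Add C (u \<cdot> p1) (v \<cdot> p2)"]) (simp_all add: Hom_iff)
qed

lemma \<Y>_biproduct:
  assumes b: "is_biproduct C A B P i1 i2 p1 p2" and A: "A \<in> \<Y>" and B: "B \<in> \<Y>"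
  shows "P \<in> \<Y>"
proof (rule \<Y>I)
  note [simp] = biproduct_simps[OF b] biproduct_decomp[OF b]
  show "P \<in> Obj C" by simp
  fix X i E d assume X: "X \<in> \<X>" and c: "confl P i E d X"
  note [simp] = confl_simps[OF c]
  obtain u where u: "u \<in> Hom C E A" "u \<cdot> i = p1" by (rule \<Y>_extend[OF c X A, of p1]) (simp add: Hom_iff)
  obtain v where v: "v \<in> Hom C E B" "v \<cdot> i = p2" by (rule \<Y>_extend[OF c X B, of p2]) (simp add: Hom_iff)
  note [simp] = u(1)[THEN Hom_facts] u(2) v(1)[THEN Hom_facts] v(2)
  show "\<exists>r\<in>Hom C E P. r \<cdot> i = Ide C P"
    by (intro bexI[of _ "Add C (i1 \<cdot> u) (i2 \<cdot> v)"]) (simp_all add: Hom_iff)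
qed

lemma \<X>_precover:
  assumes "B \<in> Obj C"
  obtains F k X e where "confl F k X e B" "F \<in> \<Y>" "X \<in> \<X>"
proof -
  obtain i d where "(i, d) \<in> Confl C" "Dom C i \<in> \<Y>" "Dom C d \<in> \<X>" "Cod C d = B"
    using complete assms by (auto simp: complete_cotorsion_pair_def)
  then show thesis using Confl_confl[of i d] that by blast
qed

lemma \<Y>_preenvelope:
  assumes "A \<in> Obj C"
  obtains m F e X where "confl A m F e X" "F \<in> \<Y>" "X \<in> \<X>"
proof -
  obtain i d where "(i, d) \<in> Confl C" "Dom C i = A" "Cod C i \<in> \<Y>" "Cod C d \<in> \<X>"
    using complete assms unfolding complete_cotorsion_pair_def by blast
  then show thesis using Confl_confl[of i d] confl_simps[OF Confl_confl[of i d]] that by metis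
qed

lemma \<X>_kernel:
  assumes "confl A i B d D" "B \<in> \<X>" "D \<in> \<X>"
  shows "A \<in> \<X>"
  using hereditary assms confl_simps[OF assms(1)] confl_types(1)[OF assms(1)]
  unfolding hereditary_cotorsion_pair_def by metis

lemma ex_approximation:
  assumes "B \<in> Obj C"
  obtains W t where "W \<in> \<X> \<inter> \<Y>" "t \<in> Hom C W B"
    "\<And>W' s. \<lbrakk>W' \<in> \<X> \<inter> \<Y>; s \<in> Hom C W' B\<rbrakk> \<Longrightarrow> \<exists>u \<in> Hom C W' W. t \<cdot> u = s"
  using contra_finite assms unfolding contravariantly_finite_def by metis

text \<open>After replacing \<open>i\<close> by its pushout \<open>i'\<close> along \<open>u\<close>, the kernel of the induced map \<open>v' : B' \<rightarrow> D\<close> is an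
  extension of \<open>X\<close> by \<open>Y\<close>. A section of it corrects \<open>Ide B'\<close> to a map factoring through \<open>i'\<close>.\<close>

lemma cofibration_lifting:
  assumes ci: "confl A i B d X" and X: "X \<in> \<X>" and cp: "confl Y \<kappa> E p D" and Y: "Y \<in> \<Y>"
    and u: "u \<in> Hom C A E" and v: "v \<in> Hom C B D" and sq: "p \<cdot> u = v \<cdot> i"
  obtains h where "h \<in> Hom C B E" "h \<cdot> i = u" "p \<cdot> h = v"
proof -
  note [simp] = confl_simps[OF ci] confl_simps[OF cp] u[THEN Hom_facts] v[THEN Hom_facts] sq
  obtain B' i' f' d' where po: "is_pushout C i u i' f'" and ci': "confl E i' B' d' X"
    and f': "f' \<in> Hom C B B'" "d' \<cdot> f' = d"
    by (rule ex_pushout[OF ci u])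
  note [simp] = confl_simps[OF ci'] f'(1)[THEN Hom_facts] pushout_simps(9,10)[OF po]
  obtain v' where v': "v' \<in> Hom C B' D" "v' \<cdot> f' = v" "v' \<cdot> i' = p"
    by (rule pushout_colift[OF po, of v D p]) (simp_all add: Hom_iff)
  note [simp] = v'(1)[THEN Hom_facts] v'(2,3) Cmp_red[OF v'(2)] Cmp_red[OF v'(3)]
  have "deflation C v'"
    by (rule deflation_cancel[of i' E B' v' D]) (simp_all add: Hom_iff confl_deflation[OF cp])
  then obtain N \<nu> where cv: "confl N \<nu> B' v' D" using deflation_confl v'(1) by blast
  note [simp] = confl_simps[OF cv]
  obtain y where y: "y \<in> Hom C Y N" "\<nu> \<cdot> y = i' \<cdot> \<kappa>"
    by (rule confl_lift[OF cv, of "i' \<cdot> \<kappa>" Y]) (simp_all add: Hom_iff)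
  note [simp] = y(1)[THEN Hom_facts] y(2) Cmp_red[OF y(2)]
  have "deflation C (d' \<cdot> \<nu>)"
  proof -
    obtain Q k' q q' where pb: "is_pullback C p v' q q'" and cq: "confl Y k' Q q B'"
      and q': "q' \<in> Hom C Q E"
      by (rule ex_pullback[OF cp v'(1)])
    note [simp] = confl_simps[OF cq] q'[THEN Hom_facts] pullback_simps(9,10)[OF pb]
    \<comment> \<open>The pullback consists of pairs of \<open>b\<close> in \<open>B'\<close> and
      \<open>x\<close> in \<open>E\<close> with equal image in \<open>D\<close>. The difference of
      \<open>b\<close> and the image of \<open>x\<close> under \<open>i'\<close> lies in
      \<open>N\<close> and has the same image in \<open>X\<close> as \<open>b\<close>; so
      \<open>d' \<cdot> q\<close>, a composite of deflations, factors through
      \<open>d' \<cdot> \<nu>\<close>.\<close>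
    obtain \<pi> where \<pi>: "\<pi> \<in> Hom C Q N" "\<nu> \<cdot> \<pi> = Add C q (neg (i' \<cdot> q'))"
      by (rule confl_lift[OF cv, of "Add C q (neg (i' \<cdot> q'))" Q]) (simp_all add: Hom_iff)
    note [simp] = \<pi>(1)[THEN Hom_facts] \<pi>(2)
    have "(d' \<cdot> \<nu>) \<cdot> \<pi> = d' \<cdot> q" by simp
    moreover have "deflation C (d' \<cdot> q)"
      by (rule deflation_Cmp[OF confl_deflation[OF cq] confl_deflation[OF ci']]) simp
    ultimately show ?thesis
      by (intro deflation_cancel[of \<pi> Q N "d' \<cdot> \<nu>" X]) (simp_all add: Hom_iff)
  qed
  \<comment> \<open>A map into \<open>N\<close> that dies in \<open>X\<close> comes from
    \<open>E\<close> through \<open>i'\<close>, and there \<open>p\<close> annihilates it, so it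
    comes from \<open>Y\<close>.\<close>
  then have cN: "confl Y y N (d' \<cdot> \<nu>) X"
  proof (rule conflI_deflation)
    fix T f assume f: "f \<in> Hom C T N" "(d' \<cdot> \<nu>) \<cdot> f = Zer C T X"
    note [simp] = f(1)[THEN Hom_facts]
    obtain a where a: "a \<in> Hom C T E" "i' \<cdot> a = \<nu> \<cdot> f"
      using confl_lift[OF ci', of "\<nu> \<cdot> f" T] f(2) by (auto simp: Hom_iff)
    note [simp] = a(1)[THEN Hom_facts] a(2)
    have "p \<cdot> a = v' \<cdot> (i' \<cdot> a)" by (simp del: a(2))
    also have "\<dots> = Zer C T D" unfolding a(2) by simp
    finally have "p \<cdot> a = Zer C T D" .
    then obtain w where w: "w \<in> Hom C T Y" "\<kappa> \<cdot> w = a" by (rule confl_lift[OF cp a(1)])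
    note [simp] = w(1)[THEN Hom_facts] w(2)
    have "y \<cdot> w = f" by (rule confl_mono[OF cv, of _ T]) (simp_all add: Hom_iff)
    then show "\<exists>u\<in>Hom C T Y. y \<cdot> u = f" using w(1) by blast
  next
    fix T w assume w: "w \<in> Hom C T Y" "y \<cdot> w = Zer C T N"
    note [simp] = w(1)[THEN Hom_facts]
    have "i' \<cdot> (\<kappa> \<cdot> w) = \<nu> \<cdot> (y \<cdot> w)" by simp
    also have "\<dots> = i' \<cdot> (\<kappa> \<cdot> Zer C T Y)" unfolding w(2) by simp
    finally have "\<kappa> \<cdot> w = \<kappa> \<cdot> Zer C T Y"
      by - (rule confl_mono[OF ci', of _ T], simp_all add: Hom_iff)
    then show "w = Zer C T Y"
      by - (rule confl_mono[OF cp, of _ T], simp_all add: Hom_iff)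
  qed (simp_all add: Hom_iff)
  obtain s where s: "s \<in> Hom C X N" "(d' \<cdot> \<nu>) \<cdot> s = Ide C X" by (rule confl_section[OF cN X Y])
  have s': "d' \<cdot> (\<nu> \<cdot> s) = Ide C X" using s Hom_facts[OF s(1)] by simp
  note [simp] = s(1)[THEN Hom_facts] s' Cmp_red[OF s']
  define g where "g = Add C (Ide C B') (neg (\<nu> \<cdot> (s \<cdot> d')))"
  have "d' \<cdot> (\<nu> \<cdot> (s \<cdot> d')) = d'" using Cmp_red[OF s', of d'] by simp
  then have "g \<in> Hom C B' B'" "d' \<cdot> g = Zer C B' X" by (simp_all add: g_def Hom_iff)
  then obtain h where h: "h \<in> Hom C B' E" "i' \<cdot> h = g" by (rule confl_lift[OF ci'])
  note [simp] = h(1)[THEN Hom_facts] h(2) Cmp_red[OF h(2)]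
  have "h \<cdot> i' = Ide C E" by (rule confl_mono[OF ci', of _ E]) (simp_all add: Hom_iff g_def)
  note [simp] = this Cmp_red[OF this]
  \<comment> \<open>The subtracted term passes through \<open>\<nu>\<close>, which \<open>v'\<close>
    kills; so \<open>h\<close> is compatible with \<open>p\<close> as well as being a retraction of
    \<open>i'\<close>.\<close>
  have "p \<cdot> h = v' \<cdot> (i' \<cdot> h)" by (simp del: h(2))
  also have "\<dots> = v'" unfolding h(2) g_def by simp
  finally have ph: "p \<cdot> h = v'" .
  note [simp] = ph Cmp_red[OF ph]
  show thesis by (rule that[of "h \<cdot> f'"]) (simp_all add: Hom_iff)
qed

text \<open>A section over \<open>A\<close> exists by lifting \<open>i\<close>, and
  \<open>cofibration_lifting\<close> against the identity of \<open>B\<close> extends it to a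
  section over \<open>B\<close>.\<close>

lemma \<X>_extension:
  assumes c: "confl A i B d D" and A: "A \<in> \<X>" and D: "D \<in> \<X>"
  shows "B \<in> \<X>"
proof (rule \<X>I)
  note [simp] = confl_simps[OF c]
  show "B \<in> Obj C" by simp
  fix F k N e assume F: "F \<in> \<Y>" and ce: "confl F k N e B"
  note [simp] = confl_simps[OF ce]
  obtain u where u: "u \<in> Hom C A N" "e \<cdot> u = i" by (rule \<X>_lift[OF ce F A confl_types(2)[OF c]])
  obtain h where "h \<in> Hom C B N" "h \<cdot> i = u" "e \<cdot> h = Ide C B"
    by (rule cofibration_lifting[OF c D ce F u(1), of "Ide C B"]) (simp_all add: Hom_iff u(2))
  then show "\<exists>s\<in>Hom C B N. e \<cdot> s = Ide C B" by blast
qed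

text \<open>A section of an extension of \<open>Q\<close> is a lift of \<open>\<delta>\<close> that
  vanishes on \<open>A\<close>. Two applications of \<open>cofibration_lifting\<close> produce it,
  from zero on \<open>A\<close> to \<open>B\<close> and from there to \<open>D\<close>; the
  conflation relating the three cokernels need not be constructed.\<close>

lemma cofibration_Cmp:
  assumes ci: "confl A i B d X" and X: "X \<in> \<X>" and cj: "confl B j D e X'" and X': "X' \<in> \<X>"
  obtains \<delta> Q where "confl A (j \<cdot> i) D \<delta> Q" "Q \<in> \<X>"
proof -
  note [simp] = confl_simps[OF ci] confl_simps[OF cj]
  have "inflation C (j \<cdot> i)"
    by (rule inflation_Cmp[OF confl_inflation[OF ci] confl_inflation[OF cj]]) simp
  then obtain \<delta> Q where c: "confl A (j \<cdot> i) D \<delta> Q"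
    by (rule inflation_confl[of _ A D]) (simp add: Hom_iff)
  note [simp] = confl_simps(4-6,9)[OF c]
  have [simp]: "\<delta> \<cdot> (j \<cdot> i) = Zer C A Q" using confl_simps(10)[OF c] .
  have "Q \<in> \<X>"
  proof (rule \<X>I)
    fix F k N e' assume F: "F \<in> \<Y>" and ce: "confl F k N e' Q"
    note [simp] = confl_simps[OF ce]
    obtain h1 where h1: "h1 \<in> Hom C B N" "h1 \<cdot> i = Zer C A N" "e' \<cdot> h1 = \<delta> \<cdot> j"
      by (rule cofibration_lifting[OF ci X ce F, of "Zer C A N" "\<delta> \<cdot> j"]) (simp_all add: Hom_iff)
    obtain h2 where h2: "h2 \<in> Hom C D N" "h2 \<cdot> j = h1" "e' \<cdot> h2 = \<delta>"
      by (rule cofibration_lifting[OF cj X' ce F, of h1 \<delta>]) (use h1 in \<open>simp_all add: Hom_iff\<close>)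
    note [simp] = h2(1)[THEN Hom_facts] h1(2) h2(3) Cmp_red[OF h2(2)]
    obtain s where s: "s \<in> Hom C Q N" "s \<cdot> \<delta> = h2"
      by (rule confl_colift[OF c, of h2 N]) (simp_all add: Hom_iff)
    note [simp] = s(1)[THEN Hom_facts] s(2)
    have "e' \<cdot> s = Ide C Q" by (rule confl_epi[OF c, of _ Q]) (simp_all add: Hom_iff)
    then show "\<exists>s\<in>Hom C Q N. e' \<cdot> s = Ide C Q" using s(1) by blast
  qed simp
  then show thesis using c that by blast
qed

end

section \<open>The model structure\<close>

context omega_setup
begin

section \<open>The ideal of maps that factor through \<omega>\<close>

abbreviation \<omega> :: "'o set" where "\<omega> \<equiv> \<X> \<inter> \<Y>"

text \<open>These are the maps that become zero in the stable category, the quotient of the category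
  by \<omega>. The quotient is never formed: equality in it is expressed by a difference being
  \<open>null\<close>.\<close>

definition null :: "'m \<Rightarrow> bool" where
  "null x \<longleftrightarrow> x \<in> Arr C \<and> (\<exists>W \<in> \<omega>. \<exists>u \<in> Hom C (Dom C x) W. \<exists>v \<in> Hom C W (Cod C x). x = v \<cdot> u)"

lemma nullI: "\<lbrakk>W \<in> \<omega>; u \<in> Hom C A W; v \<in> Hom C W B\<rbrakk> \<Longrightarrow> null (v \<cdot> u)"
proof -
  assume *: "W \<in> \<omega>" "u \<in> Hom C A W" "v \<in> Hom C W B"
  note [simp] = *(2,3)[THEN Hom_facts]
  have "v \<cdot> u \<in> Arr C" "Dom C (v \<cdot> u) = A" "Cod C (v \<cdot> u) = B" by simp_all
  with * show "null (v \<cdot> u)" unfolding null_def by blast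
qed

lemma nullE:
  assumes "null x" "x \<in> Hom C A B"
  obtains W u v where "W \<in> \<omega>" "u \<in> Hom C A W" "v \<in> Hom C W B" "x = v \<cdot> u"
proof -
  have "Dom C x = A" "Cod C x = B" using assms(2) by (simp_all add: Hom_iff)
  then show thesis using assms(1) that unfolding null_def by blast
qed

lemma null_Cmp_left:
  assumes "null x" "g \<in> Arr C" "Cod C x = Dom C g"
  shows "null (g \<cdot> x)"
proof -
  obtain W u v where W: "W \<in> \<omega>" "u \<in> Hom C (Dom C x) W" "v \<in> Hom C W (Cod C x)" "x = v \<cdot> u"
    using assms(1) unfolding null_def by blast
  note [simp] = W(2,3)[THEN Hom_facts]
  have "null ((g \<cdot> v) \<cdot> u)"
    by (rule nullI[OF W(1,2), of _ "Cod C g"]) (simp add: Hom_iff assms)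
  then show ?thesis by (simp add: assms W(4)[symmetric])
qed

lemma null_Arr: "null x \<Longrightarrow> x \<in> Arr C"
  by (simp add: null_def)

lemma null_neg:
  assumes "null x"
  shows "null (neg x)"
proof -
  have [simp]: "x \<in> Arr C" "Cod C x \<in> Obj C" using null_Arr[OF assms] Cod_in by auto
  have "null (neg (Ide C (Cod C x)) \<cdot> x)" by (rule null_Cmp_left[OF assms]) simp_all
  then show ?thesis by simp
qed

lemma null_Zer:
  assumes [simp]: "A \<in> Obj C" "B \<in> Obj C"
  shows "null (Zer C A B)"
proof -
  \<comment> \<open>The approximation serves to provide an object of \<omega> with a map to
    \<open>B\<close>, through which the zero map factors.\<close>
  obtain W t where W: "W \<in> \<omega>" "t \<in> Hom C W B" by (rule ex_approximation[OF assms(2)])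
  note [simp] = W(2)[THEN Hom_facts]
  have "null (t \<cdot> Zer C A W)" by (rule nullI[OF W(1) _ W(2), of _ A]) (simp add: Hom_iff)
  then show ?thesis by simp
qed

text \<open>The sum factors through the biproduct of the two intermediate objects, which stays in
  \<omega> because both classes are closed under biproducts.\<close>

lemma null_Add:
  assumes x: "null x" and y: "null y" and xy: "Dom C x = Dom C y" "Cod C x = Cod C y"
  shows "null (Add C x y)"
proof -
  obtain W u v where W: "W \<in> \<omega>" "u \<in> Hom C (Dom C y) W" "v \<in> Hom C W (Cod C y)" "x = v \<cdot> u"
    using x xy unfolding null_def by auto
  obtain W' u' v' where W': "W' \<in> \<omega>" "u' \<in> Hom C (Dom C y) W'" "v' \<in> Hom C W' (Cod C y)" "y = v' \<cdot> u'"
    using y unfolding null_def by blast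
  note [simp] = W(2,3)[THEN Hom_facts] W'(2,3)[THEN Hom_facts]
  obtain P i1 i2 p1 p2 where b: "is_biproduct C W W' P i1 i2 p1 p2" using ex_biproduct[of W W'] by auto
  note [simp] = biproduct_simps[OF b]
  have P: "P \<in> \<omega>" using \<X>_biproduct[OF b] \<Y>_biproduct[OF b] W(1) W'(1) by blast
  have "null (Add C (v \<cdot> p1) (v' \<cdot> p2) \<cdot> Add C (i1 \<cdot> u) (i2 \<cdot> u'))"
    by (rule nullI[OF P, of _ "Dom C y" _ "Cod C y"]) (simp_all add: Hom_iff)
  moreover have "Add C (v \<cdot> p1) (v' \<cdot> p2) \<cdot> Add C (i1 \<cdot> u) (i2 \<cdot> u') = Add C (v \<cdot> u) (v' \<cdot> u')" by simp
  ultimately show ?thesis by (simp only: W(4)[symmetric] W'(4)[symmetric])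
qed

text \<open>Surjectivity and injectivity on stable Hom groups out of \<X>. Composition with
  \<open>f\<close> is additive, so injectivity is stated as triviality of the kernel.\<close>

definition stable_bij :: "'m \<Rightarrow> bool" where
  "stable_bij f \<longleftrightarrow> f \<in> Arr C \<and> (\<forall>X \<in> \<X>.
     (\<forall>b \<in> Hom C X (Cod C f). \<exists>a \<in> Hom C X (Dom C f). null (Add C b (neg (f \<cdot> a)))) \<and>
     (\<forall>a \<in> Hom C X (Dom C f). null (f \<cdot> a) \<longrightarrow> null a))"

lemma stable_bijI:
  assumes "f \<in> Hom C A B"
    and "\<And>X b. \<lbrakk>X \<in> \<X>; b \<in> Hom C X B\<rbrakk> \<Longrightarrow> \<exists>a \<in> Hom C X A. null (Add C b (neg (f \<cdot> a)))"
    and "\<And>X a. \<lbrakk>X \<in> \<X>; a \<in> Hom C X A; null (f \<cdot> a)\<rbrakk> \<Longrightarrow> null a"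
  shows "stable_bij f"
proof -
  have "f \<in> Arr C" "Dom C f = A" "Cod C f = B" using assms(1) by (simp_all add: Hom_iff)
  then show ?thesis unfolding stable_bij_def using assms(2,3) by simp
qed

lemma stable_bij_surj:
  assumes "stable_bij f" "f \<in> Hom C A B" "X \<in> \<X>" "b \<in> Hom C X B"
  obtains a where "a \<in> Hom C X A" "null (Add C b (neg (f \<cdot> a)))"
proof -
  have "Dom C f = A" "Cod C f = B" using assms(2) by (simp_all add: Hom_iff)
  then show thesis using assms(1,3,4) that unfolding stable_bij_def by blast
qed

lemma stable_bij_inj:
  assumes "stable_bij f" "f \<in> Hom C A B" "X \<in> \<X>" "a \<in> Hom C X A" "null (f \<cdot> a)"
  shows "null a"
proof -
  have "Dom C f = A" "Cod C f = B" using assms(2) by (simp_all add: Hom_iff)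
  then show ?thesis using assms(1,3-5) unfolding stable_bij_def by blast
qed

section \<open>Formal closure properties of stable bijections\<close>

lemma stable_bij_Cmp:
  assumes f: "f \<in> Hom C A B" and g: "g \<in> Hom C B D" and sf: "stable_bij f" and sg: "stable_bij g"
  shows "stable_bij (g \<cdot> f)"
proof (rule stable_bijI[of _ A D])
  note [simp] = f[THEN Hom_facts] g[THEN Hom_facts]
  show "g \<cdot> f \<in> Hom C A D" by (simp add: Hom_iff)
  fix X assume X: "X \<in> \<X>"
  show "\<exists>a\<in>Hom C X A. null (Add C c (neg ((g \<cdot> f) \<cdot> a)))" if c: "c \<in> Hom C X D" for c
  proof -
    obtain b where b: "b \<in> Hom C X B" "null (Add C c (neg (g \<cdot> b)))" by (rule stable_bij_surj[OF sg g X c])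
    obtain a where a: "a \<in> Hom C X A" "null (Add C b (neg (f \<cdot> a)))" by (rule stable_bij_surj[OF sf f X b(1)])
    note [simp] = c[THEN Hom_facts] b(1)[THEN Hom_facts] a(1)[THEN Hom_facts]
    have "null (Add C (Add C c (neg (g \<cdot> b))) (g \<cdot> Add C b (neg (f \<cdot> a))))"
      by (intro null_Add b(2) null_Cmp_left a(2)) simp_all
    then have "null (Add C c (neg ((g \<cdot> f) \<cdot> a)))" by (simp add: Add_assoc)
    then show ?thesis using a(1) by blast
  qed
  show "null a" if a: "a \<in> Hom C X A" "null ((g \<cdot> f) \<cdot> a)" for a
  proof -
    note [simp] = a(1)[THEN Hom_facts]
    have "null (f \<cdot> a)"
      by (rule stable_bij_inj[OF sg g X]) (use a(2) in \<open>simp_all add: Hom_iff\<close>)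
    then show ?thesis by (rule stable_bij_inj[OF sf f X a(1)])
  qed
qed

lemma stable_bij_cancel_left:
  assumes f: "f \<in> Hom C A B" and g: "g \<in> Hom C B D" and sg: "stable_bij g" and s: "stable_bij (g \<cdot> f)"
  shows "stable_bij f"
proof (rule stable_bijI[OF f])
  note [simp] = f[THEN Hom_facts] g[THEN Hom_facts]
  have gf: "g \<cdot> f \<in> Hom C A D" by (simp add: Hom_iff)
  fix X assume X: "X \<in> \<X>"
  show "\<exists>a\<in>Hom C X A. null (Add C b (neg (f \<cdot> a)))" if b: "b \<in> Hom C X B" for b
  proof -
    note [simp] = b[THEN Hom_facts]
    obtain a where a: "a \<in> Hom C X A" "null (Add C (g \<cdot> b) (neg ((g \<cdot> f) \<cdot> a)))"
      by (rule stable_bij_surj[OF s gf X, of "g \<cdot> b"]) (simp add: Hom_iff)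
    note [simp] = a(1)[THEN Hom_facts]
    have "null (Add C b (neg (f \<cdot> a)))"
      by (rule stable_bij_inj[OF sg g X]) (use a(2) in \<open>simp_all add: Hom_iff\<close>)
    then show ?thesis using a(1) by blast
  qed
  show "null a" if a: "a \<in> Hom C X A" "null (f \<cdot> a)" for a
  proof -
    note [simp] = a(1)[THEN Hom_facts]
    have "null (g \<cdot> (f \<cdot> a))" by (rule null_Cmp_left[OF a(2)]) simp_all
    then show ?thesis by - (rule stable_bij_inj[OF s gf X a(1)], simp)
  qed
qed

lemma stable_bij_cancel_right:
  assumes f: "f \<in> Hom C A B" and g: "g \<in> Hom C B D" and sf: "stable_bij f" and s: "stable_bij (g \<cdot> f)"
  shows "stable_bij g"
proof (rule stable_bijI[OF g])
  note [simp] = f[THEN Hom_facts] g[THEN Hom_facts]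
  have gf: "g \<cdot> f \<in> Hom C A D" by (simp add: Hom_iff)
  fix X assume X: "X \<in> \<X>"
  show "\<exists>b\<in>Hom C X B. null (Add C c (neg (g \<cdot> b)))" if c: "c \<in> Hom C X D" for c
  proof -
    obtain a where a: "a \<in> Hom C X A" "null (Add C c (neg ((g \<cdot> f) \<cdot> a)))"
      by (rule stable_bij_surj[OF s gf X c])
    note [simp] = a(1)[THEN Hom_facts]
    show ?thesis using a(2) by (intro bexI[of _ "f \<cdot> a"]) (simp_all add: Hom_iff)
  qed
  show "null b" if b: "b \<in> Hom C X B" "null (g \<cdot> b)" for b
  proof -
    note [simp] = b(1)[THEN Hom_facts]
    obtain a where a: "a \<in> Hom C X A" "null (Add C b (neg (f \<cdot> a)))" by (rule stable_bij_surj[OF sf f X b(1)])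
    note [simp] = a(1)[THEN Hom_facts]
    \<comment> \<open>Stably \<open>b\<close> is \<open>f \<cdot> a\<close>; subtracting
      \<open>g\<close> applied to their difference from \<open>g \<cdot> b\<close> leaves
      \<open>g \<cdot> f \<cdot> a\<close>, which is therefore null.\<close>
    have "null (Add C (g \<cdot> b) (neg (g \<cdot> Add C b (neg (f \<cdot> a)))))"
      by (intro null_Add b(2) null_neg null_Cmp_left a(2)) simp_all
    then have "null ((g \<cdot> f) \<cdot> a)" by simp
    then have "null a" by (rule stable_bij_inj[OF s gf X a(1)])
    then have "null (Add C (Add C b (neg (f \<cdot> a))) (f \<cdot> a))"
      by (intro null_Add a(2) null_Cmp_left) simp_all
    then show ?thesis by (simp add: Add_assoc)
  qed
qed

lemma stable_bij_retract:
  assumes r: "retract_of C f g" and s: "stable_bij g"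
  shows "stable_bij f"
proof (rule stable_bijI[of f "Dom C f" "Cod C f"])
  have [simp]: "f \<in> Arr C" "g \<in> Arr C" using r by (auto simp: retract_of_def)
  have [simp]: "Dom C f \<in> Obj C" "Cod C f \<in> Obj C" using Dom_in Cod_in by auto
  obtain i r j t where irjt: "i \<in> Hom C (Dom C f) (Dom C g)" "r \<in> Hom C (Dom C g) (Dom C f)"
    "j \<in> Hom C (Cod C f) (Cod C g)" "t \<in> Hom C (Cod C g) (Cod C f)"
    and eqs: "r \<cdot> i = Ide C (Dom C f)" "t \<cdot> j = Ide C (Cod C f)" "g \<cdot> i = j \<cdot> f" "f \<cdot> r = t \<cdot> g"
    using r unfolding retract_of_def by blast
  note [simp] = irjt[THEN Hom_facts] eqs eqs[THEN Cmp_red]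
  show "f \<in> Hom C (Dom C f) (Cod C f)" by (simp add: Hom_iff)
  have g: "g \<in> Hom C (Dom C g) (Cod C g)" by (simp add: Hom_iff)
  fix X assume X: "X \<in> \<X>"
  show "\<exists>a\<in>Hom C X (Dom C f). null (Add C b (neg (f \<cdot> a)))" if b: "b \<in> Hom C X (Cod C f)" for b
  proof -
    note [simp] = b[THEN Hom_facts]
    obtain a where a: "a \<in> Hom C X (Dom C g)" "null (Add C (j \<cdot> b) (neg (g \<cdot> a)))"
      by (rule stable_bij_surj[OF s g X, of "j \<cdot> b"]) (simp add: Hom_iff)
    note [simp] = a(1)[THEN Hom_facts]
    have "null (t \<cdot> Add C (j \<cdot> b) (neg (g \<cdot> a)))" by (rule null_Cmp_left[OF a(2)]) simp_all
    then have "null (Add C b (neg (f \<cdot> (r \<cdot> a))))" by simp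
    moreover have "r \<cdot> a \<in> Hom C X (Dom C f)" by (simp add: Hom_iff)
    ultimately show ?thesis by blast
  qed
  show "null a" if a: "a \<in> Hom C X (Dom C f)" "null (f \<cdot> a)" for a
  proof -
    note [simp] = a(1)[THEN Hom_facts]
    have "null (j \<cdot> (f \<cdot> a))" by (rule null_Cmp_left[OF a(2)]) simp_all
    then have "null (i \<cdot> a)" by - (rule stable_bij_inj[OF s g X], simp_all add: Hom_iff)
    then have "null (r \<cdot> (i \<cdot> a))" by (rule null_Cmp_left) simp_all
    then show ?thesis by simp
  qed
qed

text \<open>The preenvelope \<open>W\<close> of \<open>X\<close> is an extension of objects of \<X>
  and lies in \<Y>, hence in \<omega>; \<open>y\<close> extends over it because the cokernel is in
  \<X>.\<close>

lemma null_\<X>_\<Y>: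
  assumes y: "y \<in> Hom C X Y" and X: "X \<in> \<X>" and Y: "Y \<in> \<Y>"
  shows "null y"
proof -
  note [simp] = y[THEN Hom_facts]
  obtain m W e X' where c: "confl X m W e X'" and W: "W \<in> \<Y>" "X' \<in> \<X>"
    by (rule \<Y>_preenvelope[of X]) simp_all
  obtain u where u: "u \<in> Hom C W Y" "u \<cdot> m = y" by (rule \<Y>_extend[OF c W(2) Y y])
  have "W \<in> \<omega>" using \<X>_extension[OF c X W(2)] W(1) by blast
  from nullI[OF this confl_types(2)[OF c] u(1)] show ?thesis using u(2) by simp
qed

text \<open>Surjectivity holds on the nose by \<open>\<X>_lift\<close>. For injectivity, a
  factorization of \<open>p \<cdot> a\<close> through \<open>W\<close> in \<omega> lifts to
  \<open>E\<close>; the difference from \<open>a\<close> comes from the kernel \<open>Y\<close>, and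
  maps from \<X> to \<Y> are null.\<close>

lemma stable_bij_deflation:
  assumes c: "confl Y \<kappa> E p B" and Y: "Y \<in> \<Y>"
  shows "stable_bij p"
proof (rule stable_bijI[OF confl_types(3)[OF c]])
  note [simp] = confl_simps[OF c]
  fix X assume X: "X \<in> \<X>"
  show "\<exists>a\<in>Hom C X E. null (Add C b (neg (p \<cdot> a)))" if b: "b \<in> Hom C X B" for b
  proof -
    note [simp] = b[THEN Hom_facts]
    obtain a where a: "a \<in> Hom C X E" "p \<cdot> a = b" by (rule \<X>_lift[OF c Y X b])
    then show ?thesis by (intro bexI[of _ a]) (simp_all add: null_Zer)
  qed
  show "null a" if a: "a \<in> Hom C X E" "null (p \<cdot> a)" for a
  proof -
    note [simp] = a(1)[THEN Hom_facts]
    obtain W u v where W: "W \<in> \<omega>" "u \<in> Hom C X W" "v \<in> Hom C W B" "p \<cdot> a = v \<cdot> u"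
      by (rule nullE[OF a(2), of X B]) (simp add: Hom_iff)
    obtain v' where v': "v' \<in> Hom C W E" "p \<cdot> v' = v" using \<X>_lift[OF c Y _ W(3)] W(1) by blast
    note [simp] = W(2,3)[THEN Hom_facts] W(4) v'(1)[THEN Hom_facts] v'(2) Cmp_red[OF v'(2)]
    obtain y where y: "y \<in> Hom C X Y" "\<kappa> \<cdot> y = Add C a (neg (v' \<cdot> u))"
      by (rule confl_lift[OF c, of "Add C a (neg (v' \<cdot> u))" X]) (simp_all add: Hom_iff)
    note [simp] = y(1)[THEN Hom_facts]
    have "null (Add C (\<kappa> \<cdot> y) (v' \<cdot> u))"
      by (intro null_Add null_Cmp_left null_\<X>_\<Y>[OF y(1) X Y] nullI[OF W(1,2) v'(1)]) simp_all
    then show ?thesis by (simp add: y(2) Add_assoc)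
  qed
qed

lemma stable_bij_inclusion:
  assumes b: "is_biproduct C A W P i1 i2 p1 p2" and W: "W \<in> \<omega>"
  shows "stable_bij i1"
proof (rule stable_bijI[of i1 A P])
  note [simp] = biproduct_simps[OF b]
  show "i1 \<in> Hom C A P" by (simp add: Hom_iff)
  fix X assume X: "X \<in> \<X>"
  show "\<exists>a\<in>Hom C X A. null (Add C x (neg (i1 \<cdot> a)))" if x: "x \<in> Hom C X P" for x
  proof -
    note [simp] = x[THEN Hom_facts]
    have "x = Add C (i2 \<cdot> (p2 \<cdot> x)) (i1 \<cdot> (p1 \<cdot> x))"
      using biproduct_decomp_left[OF b x] by (simp add: Add_commute[of "i2 \<cdot> (p2 \<cdot> x)"])
    moreover have "Add C (Add C (i2 \<cdot> (p2 \<cdot> x)) (i1 \<cdot> (p1 \<cdot> x))) (neg (i1 \<cdot> (p1 \<cdot> x))) = i2 \<cdot> (p2 \<cdot> x)"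
      by (simp add: Add_assoc)
    ultimately have "Add C x (neg (i1 \<cdot> (p1 \<cdot> x))) = i2 \<cdot> (p2 \<cdot> x)" by metis
    moreover have "null (i2 \<cdot> (p2 \<cdot> x))"
      by (rule nullI[OF W, of _ X _ P]) (simp_all add: Hom_iff)
    moreover have "p1 \<cdot> x \<in> Hom C X A" by (simp add: Hom_iff)
    ultimately show ?thesis by metis
  qed
  show "null a" if a: "a \<in> Hom C X A" "null (i1 \<cdot> a)" for a
  proof -
    note [simp] = a(1)[THEN Hom_facts]
    have "null (p1 \<cdot> (i1 \<cdot> a))" by (rule null_Cmp_left[OF a(2)]) simp_all
    then show ?thesis by simp
  qed
qed

section \<open>Fibrations that are stable bijections\<close>

definition fibration :: "'m \<Rightarrow> bool" where
  "fibration f \<longleftrightarrow> f \<in> Arr C \<and>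
     (\<forall>W \<in> \<omega>. \<forall>b \<in> Hom C W (Cod C f). \<exists>a \<in> Hom C W (Dom C f). f \<cdot> a = b)"

lemma fibration_lift:
  assumes "fibration f" "f \<in> Hom C A B" "W \<in> \<omega>" "b \<in> Hom C W B"
  obtains a where "a \<in> Hom C W A" "f \<cdot> a = b"
proof -
  have "Dom C f = A" "Cod C f = B" using assms(2) by (auto simp: Hom_iff)
  then show thesis using assms(1,3,4) that unfolding fibration_def by blast
qed

lemma fibrationI:
  assumes "f \<in> Hom C A B" "\<And>W b. \<lbrakk>W \<in> \<omega>; b \<in> Hom C W B\<rbrakk> \<Longrightarrow> \<exists>a \<in> Hom C W A. f \<cdot> a = b"
  shows "fibration f"
proof -
  have "f \<in> Arr C" "Dom C f = A" "Cod C f = B" using assms(1) by (auto simp: Hom_iff)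
  then show ?thesis using assms(2) unfolding fibration_def by simp
qed

text \<open>Stable surjectivity lifts \<open>b\<close> up to an error that factors through \<omega>.
  The fibration property lifts the error, which corrects the stable lift to a strict one.\<close>

lemma stable_bij_fibration_lift:
  assumes f: "f \<in> Hom C A B" and fib: "fibration f" and s: "stable_bij f"
    and X: "X \<in> \<X>" and b: "b \<in> Hom C X B"
  obtains a where "a \<in> Hom C X A" "f \<cdot> a = b"
proof -
  note [simp] = f[THEN Hom_facts] b[THEN Hom_facts]
  obtain a where a: "a \<in> Hom C X A" "null (Add C b (neg (f \<cdot> a)))" by (rule stable_bij_surj[OF s f X b])
  note [simp] = a(1)[THEN Hom_facts]
  obtain W u v where W: "W \<in> \<omega>" "u \<in> Hom C X W" "v \<in> Hom C W B" "Add C b (neg (f \<cdot> a)) = v \<cdot> u"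
    by (rule nullE[OF a(2), of X B]) (simp add: Hom_iff)
  obtain v' where v': "v' \<in> Hom C W A" "f \<cdot> v' = v" by (rule fibration_lift[OF fib f W(1,3)])
  note [simp] = W(2,3)[THEN Hom_facts] v'(1)[THEN Hom_facts] v'(2) Cmp_red[OF v'(2)]
  have "f \<cdot> Add C (v' \<cdot> u) a = Add C (Add C b (neg (f \<cdot> a))) (f \<cdot> a)" by (simp add: W(4))
  also have "\<dots> = b" by (simp add: Add_assoc)
  finally show thesis by (intro that[of "Add C (v' \<cdot> u) a"]) (simp_all add: Hom_iff)
qed

text \<open>An \<X>-precover of the target lifts through \<open>f\<close>, so
  \<open>deflation_cancel\<close> applies to it. For the kernel, stable injectivity extends the
  inclusion \<open>\<kappa>\<close> over a given extension \<open>N\<close> of \<open>K\<close>;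
  surjectivity then corrects the extended map so that it lands in \<open>K\<close>.\<close>

lemma stable_bij_fibration:
  assumes f: "f \<in> Hom C A B" and fib: "fibration f" and s: "stable_bij f"
  obtains K \<kappa> where "confl K \<kappa> A f B" "K \<in> \<Y>"
proof -
  note [simp] = f[THEN Hom_facts]
  have "deflation C f"
  proof -
    obtain F k X e where c: "confl F k X e B" "F \<in> \<Y>" "X \<in> \<X>" by (rule \<X>_precover[of B]) simp
    obtain a where "a \<in> Hom C X A" "f \<cdot> a = e"
      by (rule stable_bij_fibration_lift[OF f fib s c(3) confl_types(3)[OF c(1)]])
    then show ?thesis using deflation_cancel[OF _ f] confl_deflation[OF c(1)] by blast
  qed
  then obtain K \<kappa> where c: "confl K \<kappa> A f B" using deflation_confl f by blast
  note [simp] = confl_simps[OF c]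
  have "K \<in> \<Y>"
  proof (rule \<Y>I)
    show "K \<in> Obj C" by simp
    fix X i N d assume X: "X \<in> \<X>" and cN: "confl K i N d X"
    note [simp] = confl_simps[OF cN]
    \<comment> \<open>By heredity the extension \<open>N\<close> is induced from one of \<open>X\<close> by an object \<open>P\<close> of \<open>\<X>\<close>, where stable
      injectivity applies to \<open>P \<rightarrow> K \<rightarrow> A\<close>.\<close>
    obtain Y' k N' n where cn: "confl Y' k N' n N" and Y': "Y' \<in> \<Y>" and N': "N' \<in> \<X>"
      by (rule \<X>_precover[of N]) simp
    note [simp] = confl_simps[OF cn]
    obtain P k' c' i' where pb: "is_pullback C n i c' i'" and cc: "confl Y' k' P c' K"
      and i': "i' \<in> Hom C P N'" "i' \<cdot> k' = k"
      by (rule ex_pullback[OF cn confl_types(2)[OF cN]])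
    note [simp] = confl_simps[OF cc] i'(1)[THEN Hom_facts] i'(2) pullback_simps(9,10)[OF pb]
    have cP: "confl P i' N' (d \<cdot> n) X"
    proof (rule conflI_deflation)
      show "deflation C (d \<cdot> n)"
        by (rule deflation_Cmp[OF confl_deflation[OF cn] confl_deflation[OF cN]]) simp
    next
      fix T g assume g: "g \<in> Hom C T N'" "(d \<cdot> n) \<cdot> g = Zer C T X"
      note [simp] = g(1)[THEN Hom_facts]
      obtain w where w: "w \<in> Hom C T K" "i \<cdot> w = n \<cdot> g"
        using confl_lift[OF cN, of "n \<cdot> g" T] g(2) by (auto simp: Hom_iff)
      obtain u where "u \<in> Hom C T (Dom C c')" "i' \<cdot> u = g" "c' \<cdot> u = w"
        by (rule pullback_lift[OF pb, of g T w]) (use g(1) w in \<open>simp_all add: Hom_iff\<close>)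
      then show "\<exists>u\<in>Hom C T P. i' \<cdot> u = g" by auto
    next
      fix T u assume u: "u \<in> Hom C T P" "i' \<cdot> u = Zer C T N'"
      note [simp] = u(1)[THEN Hom_facts]
      have "i \<cdot> (c' \<cdot> u) = n \<cdot> (i' \<cdot> u)" by simp
      also have "\<dots> = i \<cdot> Zer C T K" unfolding u(2) by simp
      finally have "c' \<cdot> u = Zer C T K"
        by - (rule confl_mono[OF cN, of _ T], simp_all add: Hom_iff)
      then show "u = Zer C T P"
        using u by - (rule pullback_eq[OF pb, of _ T], simp_all add: Hom_iff)
    qed (simp_all add: Hom_iff)
    have P: "P \<in> \<X>" by (rule \<X>_kernel[OF cP N' X])
    \<comment> \<open>Its composite with \<open>f\<close> is zero and its source \<open>P\<close> is
      now in \<X>.\<close>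
    have "null (\<kappa> \<cdot> c')"
      by (rule stable_bij_inj[OF s f P]) (simp_all add: Hom_iff null_Zer)
    then obtain W a b where W: "W \<in> \<omega>" "a \<in> Hom C P W" "b \<in> Hom C W A" "\<kappa> \<cdot> c' = b \<cdot> a"
      by (rule nullE[of _ P A]) (simp_all add: Hom_iff)
    obtain a' where a': "a' \<in> Hom C N' W" "a' \<cdot> i' = a" using \<Y>_extend[OF cP X _ W(2)] W(1) by blast
    note [simp] = W(2,3)[THEN Hom_facts] a'(1)[THEN Hom_facts]
    have \<rho>'i': "(b \<cdot> a') \<cdot> i' = \<kappa> \<cdot> c'" using a'(2) W(4) by simp
    \<comment> \<open>The extension of \<open>\<kappa> \<cdot> c'\<close> to \<open>N'\<close>
      vanishes on the kernel of \<open>n\<close>, since \<open>k\<close> is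
      \<open>i' \<cdot> k'\<close> and \<open>c' \<cdot> k'\<close> is zero. It descends to a map
      \<open>\<rho>\<close> on \<open>N\<close> that extends \<open>\<kappa>\<close>.\<close>
    have "(b \<cdot> a') \<cdot> k = ((b \<cdot> a') \<cdot> i') \<cdot> k'" by simp
    also have "\<dots> = Zer C Y' A" unfolding \<rho>'i' by simp
    finally obtain \<rho> where \<rho>: "\<rho> \<in> Hom C N A" "\<rho> \<cdot> n = b \<cdot> a'"
      by (rule confl_colift[OF cn, of "b \<cdot> a'" A, rotated]) (simp_all add: Hom_iff)
    note [simp] = \<rho>(1)[THEN Hom_facts]
    have "(\<rho> \<cdot> i) \<cdot> c' = (\<rho> \<cdot> n) \<cdot> i'" by simp
    also have "\<dots> = \<kappa> \<cdot> c'" unfolding \<rho>(2) by (rule \<rho>'i')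
    finally have \<rho>i: "\<rho> \<cdot> i = \<kappa>"
      by - (rule confl_epi[OF cc, of _ A], simp_all add: Hom_iff)
    note [simp] = \<rho>i
    \<comment> \<open>The composite \<open>f \<cdot> \<rho>\<close> is zero on \<open>K\<close>,
      hence comes from \<open>X\<close>. Subtracting a lift of that map moves \<open>\<rho>\<close>
      into the kernel of \<open>f\<close> without changing it on \<open>K\<close>.\<close>
    obtain y where y: "y \<in> Hom C X B" "y \<cdot> d = f \<cdot> \<rho>"
      by (rule confl_colift[OF cN, of "f \<cdot> \<rho>" B]) (simp_all add: Hom_iff)
    obtain y' where y': "y' \<in> Hom C X A" "f \<cdot> y' = y" by (rule stable_bij_fibration_lift[OF f fib s X y(1)])
    note [simp] = y(1)[THEN Hom_facts] y'(1)[THEN Hom_facts] y(2) Cmp_red[OF y'(2)]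
    obtain z where z: "z \<in> Hom C N K" "\<kappa> \<cdot> z = Add C \<rho> (neg (y' \<cdot> d))"
      by (rule confl_lift[OF c, of "Add C \<rho> (neg (y' \<cdot> d))" N]) (simp_all add: Hom_iff)
    note [simp] = z(1)[THEN Hom_facts] Cmp_red[OF z(2)]
    have "z \<cdot> i = Ide C K" by (rule confl_mono[OF c, of _ K]) (simp_all add: Hom_iff)
    then show "\<exists>r\<in>Hom C N K. r \<cdot> i = Ide C K" using z(1) by blast
  qed
  then show thesis using c that by blast
qed

lemma fibration_deflation:
  assumes c: "confl Y \<kappa> E p B" and Y: "Y \<in> \<Y>"
  shows "fibration p"
proof (rule fibrationI[OF confl_types(3)[OF c]])
  fix W b assume "W \<in> \<omega>" "b \<in> Hom C W B"
  then show "\<exists>a\<in>Hom C W E. p \<cdot> a = b" using \<X>_lift[OF c Y, of W b] by blast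
qed

definition cofibration :: "'m \<Rightarrow> bool" where
  "cofibration f \<longleftrightarrow> (\<exists>A B d X. confl A f B d X \<and> X \<in> \<X>)"

text \<open>With \<open>t\<close> an approximation of \<open>B\<close>, every map from \<omega> to
  \<open>B\<close> lifts through the second summand alone. This is the source of the
  \<open>W\<close> and \<open>t\<close> demanded by \<open>Weq\<close>.\<close>

lemma fibration_approximation:
  assumes f: "f \<in> Hom C A B"
  obtains W t P i1 i2 p1 p2 where "W \<in> \<omega>" "t \<in> Hom C W B" "is_biproduct C A W P i1 i2 p1 p2"
    "fibration (Add C (f \<cdot> p1) (t \<cdot> p2))"
proof -
  note [simp] = f[THEN Hom_facts]
  obtain W t where W: "W \<in> \<omega>" "t \<in> Hom C W B"
    and approx: "\<And>W' s. \<lbrakk>W' \<in> \<omega>; s \<in> Hom C W' B\<rbrakk> \<Longrightarrow> \<exists>u \<in> Hom C W' W. t \<cdot> u = s"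
    by (rule ex_approximation[of B]) simp_all
  note [simp] = W(2)[THEN Hom_facts]
  obtain P i1 i2 p1 p2 where b: "is_biproduct C A W P i1 i2 p1 p2" using ex_biproduct[of A W] by auto
  note [simp] = biproduct_simps[OF b]
  have "fibration (Add C (f \<cdot> p1) (t \<cdot> p2))"
  proof (rule fibrationI[of _ P B])
    fix W' s assume "W' \<in> \<omega>" "s \<in> Hom C W' B"
    from approx[OF this] obtain u where u: "u \<in> Hom C W' W" "t \<cdot> u = s" by blast
    note [simp] = u(1)[THEN Hom_facts]
    show "\<exists>a\<in>Hom C W' P. Add C (f \<cdot> p1) (t \<cdot> p2) \<cdot> a = s"
      using u(2) Hom_facts[of s] by (intro bexI[of _ "i2 \<cdot> u"]) (auto simp: Hom_iff)
  qed (simp add: Hom_iff)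
  then show thesis using W b that by blast
qed

text \<open>Both directions compare \<open>f\<close> with \<open>(f, t)\<close> along the inclusion
  of the first summand, which is a stable bijection. In the converse direction \<open>t\<close> is
  an approximation, so that \<open>stable_bij_fibration\<close> yields the conflation.\<close>

lemma Weq_stable_bij: "f \<in> Weq (omega_model C \<X> \<Y>) \<longleftrightarrow> stable_bij f"
proof
  assume "f \<in> Weq (omega_model C \<X> \<Y>)"
  then obtain W t P i1 i2 p1 p2 k where f: "f \<in> Arr C" and W: "W \<in> \<omega>" "t \<in> Hom C W (Cod C f)"
    and b: "is_biproduct C (Dom C f) W P i1 i2 p1 p2"
    and k: "(k, Add C (f \<cdot> p1) (t \<cdot> p2)) \<in> Confl C" "Dom C k \<in> \<Y>"
    unfolding omega_model_def by auto
  note [simp] = W(2)[THEN Hom_facts] biproduct_simps[OF b] f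
  have c: "stable_bij (Add C (f \<cdot> p1) (t \<cdot> p2))" by (rule stable_bij_deflation[OF Confl_confl[OF k(1)] k(2)])
  have "stable_bij (Add C (f \<cdot> p1) (t \<cdot> p2) \<cdot> i1)"
    by (rule stable_bij_Cmp[OF _ _ stable_bij_inclusion[OF b W(1)] c]) (auto simp: Hom_iff)
  then show "stable_bij f" by simp
next
  assume s: "stable_bij f"
  then have f: "f \<in> Arr C" by (simp add: stable_bij_def)
  then have f': "f \<in> Hom C (Dom C f) (Cod C f)" by (simp add: Hom_iff)
  obtain W t P i1 i2 p1 p2 where W: "W \<in> \<omega>" "t \<in> Hom C W (Cod C f)"
    and b: "is_biproduct C (Dom C f) W P i1 i2 p1 p2" and fib: "fibration (Add C (f \<cdot> p1) (t \<cdot> p2))"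
    by (rule fibration_approximation[OF f'])
  note [simp] = W(2)[THEN Hom_facts] biproduct_simps[OF b] f
  have g: "Add C (f \<cdot> p1) (t \<cdot> p2) \<in> Hom C P (Cod C f)" by (simp add: Hom_iff)
  have "stable_bij (Add C (f \<cdot> p1) (t \<cdot> p2))"
    by (rule stable_bij_cancel_right[OF _ g stable_bij_inclusion[OF b W(1)], of "Dom C f"])
      (simp_all add: Hom_iff s)
  then obtain K \<kappa> where "confl K \<kappa> P (Add C (f \<cdot> p1) (t \<cdot> p2)) (Cod C f)" "K \<in> \<Y>"
    using stable_bij_fibration[OF g fib] by blast
  then have "(\<kappa>, Add C (f \<cdot> p1) (t \<cdot> p2)) \<in> Confl C \<and> Dom C \<kappa> \<in> \<Y>"
    using confl_simps(2) confl_types(1) by blast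
  then show "f \<in> Weq (omega_model C \<X> \<Y>)"
    using f W b unfolding omega_model_def model.simps mem_Collect_eq by blast
qed

lemma Fib_fibration: "f \<in> Fib (omega_model C \<X> \<Y>) \<longleftrightarrow> fibration f"
proof (cases "f \<in> Arr C")
  case True
  show ?thesis
    by (simp only: fibration_def omega_model_def model.simps mem_Collect_eq Hom_surj_iff[OF True])
qed (simp add: fibration_def omega_model_def)

lemma CoFib_cofibration: "f \<in> CoFib (omega_model C \<X> \<Y>) \<longleftrightarrow> cofibration f"
proof
  assume "f \<in> CoFib (omega_model C \<X> \<Y>)"
  then obtain d where "(f, d) \<in> Confl C" "Cod C d \<in> \<X>" by (auto simp: omega_model_def)
  then show "cofibration f" using Confl_confl unfolding cofibration_def by blast
next
  assume "cofibration f"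
  then obtain A B d X where c: "confl A f B d X" "X \<in> \<X>" unfolding cofibration_def by blast
  then show "f \<in> CoFib (omega_model C \<X> \<Y>)"
    using confl_simps[OF c(1)] confl_types(1)[OF c(1)] by (auto simp: omega_model_def)
qed

section \<open>Retracts of fibrations and cofibrations\<close>

lemma fibration_retract:
  assumes r: "retract_of C f g" and s: "fibration g"
  shows "fibration f"
proof (rule fibrationI[of f "Dom C f" "Cod C f"])
  have [simp]: "f \<in> Arr C" "g \<in> Arr C" using r by (auto simp: retract_of_def)
  obtain i r j t where irjt: "i \<in> Hom C (Dom C f) (Dom C g)" "r \<in> Hom C (Dom C g) (Dom C f)"
    "j \<in> Hom C (Cod C f) (Cod C g)" "t \<in> Hom C (Cod C g) (Cod C f)"
    and eqs: "r \<cdot> i = Ide C (Dom C f)" "t \<cdot> j = Ide C (Cod C f)" "g \<cdot> i = j \<cdot> f" "f \<cdot> r = t \<cdot> g"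
    using r unfolding retract_of_def by blast
  note [simp] = irjt[THEN Hom_facts] eqs(2,4)[THEN Cmp_red]
  show "f \<in> Hom C (Dom C f) (Cod C f)" by (simp add: Hom_iff)
  fix W b assume W: "W \<in> \<omega>" and b: "b \<in> Hom C W (Cod C f)"
  note [simp] = b[THEN Hom_facts]
  obtain a where a: "a \<in> Hom C W (Dom C g)" "g \<cdot> a = j \<cdot> b"
    by (rule fibration_lift[OF s _ W, of "Dom C g" "Cod C g" "j \<cdot> b"]) (simp_all add: Hom_iff)
  note [simp] = a(1)[THEN Hom_facts] a(2)
  show "\<exists>a\<in>Hom C W (Dom C f). f \<cdot> a = b" by (intro bexI[of _ "r \<cdot> a"]) (simp_all add: Hom_iff)
qed

text \<open>The pushout of \<open>g\<close> along \<open>r\<close> keeps the cokernel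
  \<open>X\<close> and reduces to a retract with fixed source \<open>A\<close>. The complement
  \<open>K\<close> of \<open>B\<close> in \<open>P\<close> then turns out to be a summand of
  \<open>X\<close>, and the remaining summand \<open>D\<close> is the cokernel of
  \<open>f\<close>.\<close>

lemma cofibration_retract:
  assumes ret: "retract_of C f g" and cof: "cofibration g"
  shows "cofibration f"
proof -
  define A B where "A = Dom C f" and "B = Cod C f"
  obtain A' B' d X where cg: "confl A' g B' d X" and X: "X \<in> \<X>" using cof unfolding cofibration_def by blast
  note [simp] = confl_simps[OF cg]
  have f: "f \<in> Hom C A B" using ret by (auto simp: retract_of_def A_def B_def Hom_iff)
  obtain i r j s where irjt: "i \<in> Hom C A A'" "r \<in> Hom C A' A"
    "j \<in> Hom C B B'" "s \<in> Hom C B' B"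
    and eqs: "r \<cdot> i = Ide C A" "s \<cdot> j = Ide C B" "g \<cdot> i = j \<cdot> f" "f \<cdot> r = s \<cdot> g"
    using ret unfolding retract_of_def A_def B_def by auto
  note [simp] = irjt[THEN Hom_facts] f[THEN Hom_facts] eqs(1,2) 
  obtain P g' r' c where po: "is_pushout C g r g' r'" and cg': "confl A g' P c X"
    and r': "r' \<in> Hom C B' P" "c \<cdot> r' = d"
    by (rule ex_pushout[OF cg irjt(2)])
  note [simp] = confl_simps[OF cg'] r'(1)[THEN Hom_facts]
  obtain s' where s': "s' \<in> Hom C P B" "s' \<cdot> r' = s" "s' \<cdot> g' = f"
    by (rule pushout_colift[OF po, of s B f]) (simp_all add: Hom_iff eqs(4))
  define j' where "j' = r' \<cdot> j"
  have j'_types [simp]: "j' \<in> Arr C" "Dom C j' = B" "Cod C j' = P" by (simp_all add: j'_def)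
  note [simp] = s'(1)[THEN Hom_facts] 
  have j'f: "j' \<cdot> f = g'"
  proof -
    have "j' \<cdot> f = r' \<cdot> (g \<cdot> i)" by (simp add: j'_def eqs(3))
    also have "\<dots> = g' \<cdot> (r \<cdot> i)" using pushout_simps(10)[OF po, of i] by (simp del: eqs)
    also have "\<dots> = g'" by simp
    finally show ?thesis .
  qed
  have s'j': "s' \<cdot> j' = Ide C B" using Cmp_red[OF s'(2), of j] by (simp add: j'_def)
  obtain K k \<pi> where bP: "is_biproduct C K B P k j' \<pi> s'"
    by (rule split_epi_biproduct[OF s'(1) _ s'j']) (simp add: Hom_iff)
  note [simp] = biproduct_simps[OF bP]
  \<comment> \<open>Since \<open>g'\<close> is \<open>j' \<cdot> f\<close>, its image lies in the
    summand \<open>B\<close>. So the projection to \<open>K\<close> factors through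
    \<open>X\<close>, where it is split by \<open>c \<cdot> k\<close>.\<close>
  have "\<pi> \<cdot> g' = Zer C A K" unfolding j'f[symmetric] by simp
  then obtain \<sigma> where \<sigma>: "\<sigma> \<in> Hom C X K" "\<sigma> \<cdot> c = \<pi>"
    by (rule confl_colift[OF cg', of \<pi> K, rotated]) (simp_all add: Hom_iff)
  note [simp] = \<sigma>(1)[THEN Hom_facts]  Cmp_red[OF \<sigma>(2)]
  obtain D m q where bX: "is_biproduct C D K X m (c \<cdot> k) q \<sigma>"
    by (rule split_epi_biproduct[OF \<sigma>(1), of "c \<cdot> k"]) (simp_all add: Hom_iff)
  note bX_simps [simp] = biproduct_simps(1-3,7-9,13-15)[OF bX]
  have D: "D \<in> \<X>"
    by (rule \<X>_retract[OF X, of m _ q]) (use biproduct_facts[OF bX] in \<open>simp_all add: Hom_iff\<close>)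
  define \<delta> where "\<delta> = q \<cdot> (c \<cdot> j')"
  have \<delta>: "\<delta> \<in> Hom C B D" by (simp add: \<delta>_def Hom_iff)
  note [simp] = \<delta>[THEN Hom_facts]
  have m\<delta>: "m \<cdot> \<delta> = c \<cdot> j'"
    using biproduct_decomp_left[OF bX, of "c \<cdot> j'" B] by (simp add: Hom_iff \<delta>_def)
  have qck: "q \<cdot> (c \<cdot> k) = Zer C K D" using biproduct_simps(18)[OF bX] by simp
  \<comment> \<open>The summand \<open>K\<close> of \<open>P\<close> dies in \<open>D\<close>, so
    \<open>q \<cdot> c\<close> factors through \<open>s'\<close>. Being a composite of deflations,
    it makes \<open>\<delta>\<close> a deflation by cancellation.\<close>
  have \<delta>s': "\<delta> \<cdot> s' = q \<cdot> c"
    using biproduct_decomp_right[OF bP, of "q \<cdot> c" D] Cmp_red[OF qck, of \<pi>]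
    by (simp add: Hom_iff \<delta>_def)
  have "deflation C q"
    by (rule split_epi_deflation[of q X D m]) (use biproduct_simps(16)[OF bX] in \<open>simp_all add: Hom_iff\<close>)
  then have "deflation C (q \<cdot> c)" by (rule deflation_Cmp[OF confl_deflation[OF cg']]) simp
  then have defl: "deflation C \<delta>"
    using deflation_cancel[OF s'(1) \<delta>] \<delta>s' by simp
  have "confl A f B \<delta> D"
  proof (rule conflI_deflation[OF defl \<delta> f])
    show "\<delta> \<cdot> f = Zer C A D" using j'f by (simp add: \<delta>_def)
  next
    fix T x assume x: "x \<in> Hom C T B" "\<delta> \<cdot> x = Zer C T D"
    note [simp] = x(1)[THEN Hom_facts]
    \<comment> \<open>Because the \<open>K\<close>-component of \<open>c \<cdot> j'\<close>
      vanishes, a map killed by \<open>\<delta>\<close> is already killed in \<open>X\<close>, and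
      so it lifts through \<open>g'\<close>.\<close>
    have "c \<cdot> (j' \<cdot> x) = m \<cdot> (\<delta> \<cdot> x)" using Cmp_red[OF m\<delta>, of x] by simp
    also have "\<dots> = Zer C T X" unfolding x(2) by simp
    finally obtain w where w: "w \<in> Hom C T A" "g' \<cdot> w = j' \<cdot> x"
      by (rule confl_lift[OF cg', of "j' \<cdot> x" T, rotated]) (simp_all add: Hom_iff)
    note [simp] = w(1)[THEN Hom_facts]
    have "f \<cdot> w = s' \<cdot> (g' \<cdot> w)" using Cmp_red[OF s'(3), of w] by simp
    also have "\<dots> = x" unfolding w(2) by simp
    finally show "\<exists>u\<in>Hom C T A. f \<cdot> u = x" using w(1) by blast
  next
    fix T w assume w: "w \<in> Hom C T A" "f \<cdot> w = Zer C T B"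
    note [simp] = w(1)[THEN Hom_facts]
    have "g' \<cdot> w = j' \<cdot> (f \<cdot> w)" using Cmp_red[OF j'f, of w] by simp
    also have "\<dots> = g' \<cdot> Zer C T A" unfolding w(2) by simp
    finally show "w = Zer C T A" by - (rule confl_mono[OF cg', of _ T], simp_all add: Hom_iff)
  qed
  then show ?thesis using D unfolding cofibration_def by blast
qed

section \<open>Lifting properties\<close>

lemma has_liftingI:
  assumes "i \<in> Hom C A B" "p \<in> Hom C E D"
    and "\<And>u v. \<lbrakk>u \<in> Hom C A E; v \<in> Hom C B D; p \<cdot> u = v \<cdot> i\<rbrakk>
      \<Longrightarrow> \<exists>h \<in> Hom C B E. h \<cdot> i = u \<and> p \<cdot> h = v"
  shows "has_lifting C i p"
proof -
  have "Dom C i = A" "Cod C i = B" "Dom C p = E" "Cod C p = D" using assms(1,2) by (auto simp: Hom_iff)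
  then show ?thesis using assms(3) unfolding has_lifting_def by simp
qed

lemma cofibration_has_lifting:
  assumes "cofibration i" "fibration p" "stable_bij p"
  shows "has_lifting C i p"
proof -
  obtain A B d X where ci: "confl A i B d X" and X: "X \<in> \<X>" using assms(1) unfolding cofibration_def by blast
  have p: "p \<in> Hom C (Dom C p) (Cod C p)" using assms(2) by (simp add: fibration_def Hom_iff)
  obtain Y \<kappa> where cp: "confl Y \<kappa> (Dom C p) p (Cod C p)" and Y: "Y \<in> \<Y>"
    by (rule stable_bij_fibration[OF p assms(2,3)])
  show ?thesis
    using cofibration_lifting[OF ci X cp Y] by (intro has_liftingI[OF confl_types(2)[OF ci] p]) blast
qed

text \<open>Lifting \<open>i\<close> against its own factorization through \<open>A \<oplus> W\<close> exhibits \<open>i\<close> as a retract of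
  \<open>A \<rightarrow> A \<oplus> W\<close>.\<close>

lemma trivial_cofibration_has_lifting:
  assumes cof: "cofibration i" and weq: "i \<in> Weq (omega_model C \<X> \<Y>)" and fib: "fibration p"
  shows "has_lifting C i p"
proof -
  obtain A B d X where ci: "confl A i B d X" and X: "X \<in> \<X>" using cof unfolding cofibration_def by blast
  note [simp] = confl_simps[OF ci]
  obtain W t P i1 i2 p1 p2 k where W: "W \<in> \<omega>" "t \<in> Hom C W B"
    and b: "is_biproduct C A W P i1 i2 p1 p2"
    and k: "(k, Add C (i \<cdot> p1) (t \<cdot> p2)) \<in> Confl C" "Dom C k \<in> \<Y>"
    using weq unfolding omega_model_def by auto
  note [simp] = W(2)[THEN Hom_facts] biproduct_simps[OF b]
  have ck: "confl (Dom C k) k P (Add C (i \<cdot> p1) (t \<cdot> p2)) B" using Confl_confl[OF k(1)] by simp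
  obtain h where h: "h \<in> Hom C B P" "h \<cdot> i = i1" "Add C (i \<cdot> p1) (t \<cdot> p2) \<cdot> h = Ide C B"
    by (rule cofibration_lifting[OF ci X ck k(2), of i1 "Ide C B"]) (simp_all add: Hom_iff)
  note [simp] = h(1)[THEN Hom_facts] h(2)
  define E D where "E = Dom C p" and "D = Cod C p"
  have p: "p \<in> Hom C E D" using fib by (simp add: fibration_def Hom_iff E_def D_def)
  show ?thesis
  proof (rule has_liftingI[OF confl_types(2)[OF ci] p])
    fix u v assume u: "u \<in> Hom C A E" and v: "v \<in> Hom C B D" and sq: "p \<cdot> u = v \<cdot> i"
    note [simp] = p[THEN Hom_facts] u[THEN Hom_facts] v[THEN Hom_facts]
    obtain w where w: "w \<in> Hom C W E" "p \<cdot> w = v \<cdot> t"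
      by (rule fibration_lift[OF fib p W(1), of "v \<cdot> t"]) (simp_all add: Hom_iff)
    note [simp] = w(1)[THEN Hom_facts] Cmp_red[OF w(2)] Cmp_red[OF sq]
    \<comment> \<open>This solves the lifting problem for the inclusion of \<open>A\<close> into
      \<open>A \<oplus> W\<close>: the second entry \<open>w\<close> lifts
      \<open>v \<cdot> t\<close>, which the fibration property permits. Composition with
      \<open>h\<close> carries the solution back to \<open>i\<close>.\<close>
    define H where "H = Add C (u \<cdot> p1) (w \<cdot> p2)"
    have [simp]: "H \<in> Arr C" "Dom C H = P" "Cod C H = E" by (simp_all add: H_def)
    have pH: "p \<cdot> H = v \<cdot> Add C (i \<cdot> p1) (t \<cdot> p2)" by (simp add: H_def)
    have "p \<cdot> (H \<cdot> h) = v \<cdot> (Add C (i \<cdot> p1) (t \<cdot> p2) \<cdot> h)" using Cmp_red[OF pH, of h] by simp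
    also have "\<dots> = v" unfolding h(3) by simp
    finally have "p \<cdot> (H \<cdot> h) = v" .
    moreover have "(H \<cdot> h) \<cdot> i = u" by (simp add: H_def)
    moreover have "H \<cdot> h \<in> Hom C B E" by (simp add: Hom_iff)
    ultimately show "\<exists>h\<in>Hom C B E. h \<cdot> i = u \<and> p \<cdot> h = v" by blast
  qed
qed

section \<open>Factorizations\<close>

lemma cofibration_inclusion:
  "\<lbrakk>is_biproduct C A X P i1 i2 p1 p2; X \<in> \<X>\<rbrakk> \<Longrightarrow> cofibration i1"
  unfolding cofibration_def using biproduct_confl by blast

lemma factor_trivial_cofibration:
  assumes f: "f \<in> Hom C A B"
  shows "\<exists>i p. cofibration i \<and> stable_bij i \<and> fibration p \<and> Cod C i = Dom C p \<and> f = p \<cdot> i"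
proof -
  obtain W t P i1 i2 p1 p2 where W: "W \<in> \<omega>" "t \<in> Hom C W B"
    and b: "is_biproduct C A W P i1 i2 p1 p2" and fib: "fibration (Add C (f \<cdot> p1) (t \<cdot> p2))"
    by (rule fibration_approximation[OF f])
  note [simp] = W(2)[THEN Hom_facts] biproduct_simps[OF b] f[THEN Hom_facts]
  have "cofibration i1" using cofibration_inclusion[OF b] W(1) by blast
  moreover have "stable_bij i1" by (rule stable_bij_inclusion[OF b W(1)])
  moreover have "f = Add C (f \<cdot> p1) (t \<cdot> p2) \<cdot> i1" by simp
  moreover have "Cod C i1 = Dom C (Add C (f \<cdot> p1) (t \<cdot> p2))" by simp
  ultimately show ?thesis using fib by blast
qed

text \<open>Adding an \<X>-precover of \<open>B\<close> as a summand makes \<open>f\<close> a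
  deflation \<open>g\<close>. Its kernel \<open>K\<close> need not lie in \<Y>, so the conflation is
  pushed out along a \<Y>-preenvelope of \<open>K\<close>; both enlargements of the source are
  cofibrations.\<close>

lemma factor_trivial_fibration:
  assumes f: "f \<in> Hom C A B"
  shows "\<exists>i p. cofibration i \<and> fibration p \<and> stable_bij p \<and> Cod C i = Dom C p \<and> f = p \<cdot> i"
proof -
  note [simp] = f[THEN Hom_facts]
  obtain F k X t where ct: "confl F k X t B" and X: "X \<in> \<X>" by (rule \<X>_precover[of B]) simp_all
  note [simp] = confl_simps[OF ct]
  obtain E i1 i2 p1 p2 where b: "is_biproduct C A X E i1 i2 p1 p2" using ex_biproduct[of A X] by auto
  note [simp] = biproduct_simps[OF b]
  define g where "g = Add C (f \<cdot> p1) (t \<cdot> p2)"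
  have g: "g \<in> Hom C E B" and gi: "g \<cdot> i1 = f" "g \<cdot> i2 = t" by (simp_all add: g_def Hom_iff)
  have "deflation C g"
    by (rule deflation_cancel[of i2 X E g B]) (simp_all add: Hom_iff gi confl_deflation[OF ct] g[unfolded Hom_iff])
  then obtain K \<kappa> where c\<kappa>: "confl K \<kappa> E g B" using deflation_confl g by blast
  note [simp] = confl_simps[OF c\<kappa>]
  obtain m Y0 e X0 where cm: "confl K m Y0 e X0" and Y0: "Y0 \<in> \<Y>" and X0: "X0 \<in> \<X>"
    by (rule \<Y>_preenvelope[of K]) simp_all
  note [simp] = confl_simps[OF cm]
  obtain P i' f' d' where po: "is_pushout C \<kappa> m i' f'" and cd': "confl Y0 i' P d' B"
    and f': "f' \<in> Hom C E P" "d' \<cdot> f' = g"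
    by (rule ex_pushout[OF c\<kappa> confl_types(2)[OF cm]])
  note [simp] = confl_simps[OF cd'] f'(1)[THEN Hom_facts]
  \<comment> \<open>Read in the other direction, the same square exhibits \<open>f'\<close> as a
    pushout of \<open>m\<close>, so its cokernel is \<open>X0\<close>.\<close>
  obtain e' where ce': "confl E f' P e' X0"
    using pushout_confl[OF cm is_pushout_sym[OF po]] by auto
  obtain \<delta> Q where "confl A (f' \<cdot> i1) P \<delta> Q" "Q \<in> \<X>"
    by (rule cofibration_Cmp[OF biproduct_confl[OF b] X ce' X0])
  then have "cofibration (f' \<cdot> i1)" unfolding cofibration_def by blast
  moreover have "f = d' \<cdot> (f' \<cdot> i1)" using Cmp_red[OF f'(2), of i1] gi by simp
  moreover have "Cod C (f' \<cdot> i1) = Dom C d'" by simp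
  ultimately show ?thesis
    using fibration_deflation[OF cd' Y0] stable_bij_deflation[OF cd' Y0] by blast
qed

text \<open>The defining equation of \<open>is_exact\<close> is available only for actual model structures.\<close>

lemma model_structure_omega_model: "model_structure C (omega_model C \<X> \<Y>)"
proof
  show "CoFib (omega_model C \<X> \<Y>) \<subseteq> Arr C"
    using confl_simps(1) by (auto simp: CoFib_cofibration cofibration_def)
  show "Fib (omega_model C \<X> \<Y>) \<subseteq> Arr C" by (auto simp: Fib_fibration fibration_def)
  show "Weq (omega_model C \<X> \<Y>) \<subseteq> Arr C" by (auto simp: Weq_stable_bij stable_bij_def)
next
  fix f g A B D assume "f \<in> Hom C A B" "g \<in> Hom C B D"
  note fg = this
  show "\<lbrakk>f \<in> Weq (omega_model C \<X> \<Y>); g \<in> Weq (omega_model C \<X> \<Y>)\<rbrakk> \<Longrightarrow> g \<cdot> f \<in> Weq (omega_model C \<X> \<Y>)"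
    using stable_bij_Cmp[OF fg] by (simp add: Weq_stable_bij)
  show "\<lbrakk>g \<in> Weq (omega_model C \<X> \<Y>); g \<cdot> f \<in> Weq (omega_model C \<X> \<Y>)\<rbrakk> \<Longrightarrow> f \<in> Weq (omega_model C \<X> \<Y>)"
    using stable_bij_cancel_left[OF fg] by (simp add: Weq_stable_bij)
  show "\<lbrakk>f \<in> Weq (omega_model C \<X> \<Y>); g \<cdot> f \<in> Weq (omega_model C \<X> \<Y>)\<rbrakk> \<Longrightarrow> g \<in> Weq (omega_model C \<X> \<Y>)"
    using stable_bij_cancel_right[OF fg] by (simp add: Weq_stable_bij)
next
  fix f g assume r: "retract_of C f g"
  show "g \<in> CoFib (omega_model C \<X> \<Y>) \<Longrightarrow> f \<in> CoFib (omega_model C \<X> \<Y>)"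
    using cofibration_retract[OF r] by (simp add: CoFib_cofibration)
  show "g \<in> Fib (omega_model C \<X> \<Y>) \<Longrightarrow> f \<in> Fib (omega_model C \<X> \<Y>)"
    using fibration_retract[OF r] by (simp add: Fib_fibration)
  show "g \<in> Weq (omega_model C \<X> \<Y>) \<Longrightarrow> f \<in> Weq (omega_model C \<X> \<Y>)"
    using stable_bij_retract[OF r] by (simp add: Weq_stable_bij)
next
  fix i p
  show "\<lbrakk>i \<in> CoFib (omega_model C \<X> \<Y>); p \<in> Fib (omega_model C \<X> \<Y>) \<inter> Weq (omega_model C \<X> \<Y>)\<rbrakk>
    \<Longrightarrow> has_lifting C i p"
    using cofibration_has_lifting by (auto simp: CoFib_cofibration Fib_fibration Weq_stable_bij)
  show "\<lbrakk>i \<in> CoFib (omega_model C \<X> \<Y>) \<inter> Weq (omega_model C \<X> \<Y>); p \<in> Fib (omega_model C \<X> \<Y>)\<rbrakk>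
    \<Longrightarrow> has_lifting C i p"
    using trivial_cofibration_has_lifting by (auto simp: CoFib_cofibration Fib_fibration)
next
  fix f assume "f \<in> Arr C"
  then have f: "f \<in> Hom C (Dom C f) (Cod C f)" by (simp add: Hom_iff)
  show "\<exists>i p. i \<in> CoFib (omega_model C \<X> \<Y>) \<inter> Weq (omega_model C \<X> \<Y>) \<and> p \<in> Fib (omega_model C \<X> \<Y>) \<and>
    Cod C i = Dom C p \<and> f = p \<cdot> i"
    using factor_trivial_cofibration[OF f]
    unfolding Int_iff CoFib_cofibration Fib_fibration Weq_stable_bij by blast
  show "\<exists>i p. i \<in> CoFib (omega_model C \<X> \<Y>) \<and> p \<in> Fib (omega_model C \<X> \<Y>) \<inter> Weq (omega_model C \<X> \<Y>) \<and>
    Cod C i = Dom C p \<and> f = p \<cdot> i"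
    using factor_trivial_fibration[OF f]
    unfolding Int_iff CoFib_cofibration Fib_fibration Weq_stable_bij by blast
qed

end

section \<open>Exactness\<close>

context category
begin

lemma zero_object_unique:
  assumes "zero_object C Z"
  shows "\<lbrakk>f \<in> Hom C A Z; g \<in> Hom C A Z\<rbrakk> \<Longrightarrow> f = g" "\<lbrakk>f \<in> Hom C Z A; g \<in> Hom C Z A\<rbrakk> \<Longrightarrow> f = g"
  using assms Hom_facts unfolding zero_object_def by blast+

end

context exact_category
begin

lemma deflation_Arr: "deflation C d \<Longrightarrow> d \<in> Arr C"
  using Confl_confl confl_simps(4) unfolding deflation_def by blast

lemma projective_lift:
  assumes "P \<in> projectives C" "deflation C d" "d \<in> Hom C Y Z" "f \<in> Hom C P Z"
  obtains g where "g \<in> Hom C P Y" "d \<cdot> g = f"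
proof -
  have d: "d \<in> Arr C" "Dom C d = Y" "Cod C d = Z" using assms(3) by (auto simp: Hom_iff)
  have "Hom_surj C P d" using assms(1,2) by (simp add: projectives_def)
  then show thesis using assms(4) that unfolding Hom_surj_iff[OF d(1)] d(2,3) by blast
qed

end

context omega_setup
begin

interpretation M: model_structure C "omega_model C \<X> \<Y>"
  by (rule model_structure_omega_model)

section \<open>Cofibrant and fibrant objects\<close>

lemma cofibrant_omega_model: "M.cofibrant = \<X>"
proof (intro equalityI subsetI)
  fix A assume "A \<in> M.cofibrant"
  then obtain Z f where Z: "zero_object C Z" and f: "f \<in> Hom C Z A" and cof: "cofibration f"
    by (auto simp: M.cofibrant_def CoFib_cofibration)
  obtain Z' A' d X where c': "confl Z' f A' d X" and X: "X \<in> \<X>" using cof unfolding cofibration_def by blast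
  have c: "confl Z f A d X" using c' confl_simps(2,3)[OF c'] f by (auto simp: Hom_iff)
  note [simp] = confl_simps[OF c]
  \<comment> \<open>The identity of \<open>A\<close> restricts to zero on the zero object, so it
    factors through \<open>d\<close> and exhibits \<open>A\<close> as a retract of
    \<open>X\<close>.\<close>
  have "Ide C A \<cdot> f = Zer C Z A"
    by (rule zero_object_unique(2)[OF Z, of _ A]) (simp_all add: Hom_iff)
  then obtain u where u: "u \<in> Hom C X A" "u \<cdot> d = Ide C A"
    by (rule confl_colift[OF c, of "Ide C A" A, rotated]) (simp_all add: Hom_iff)
  show "A \<in> \<X>" by (rule \<X>_retract[OF X confl_types(3)[OF c] u])
next
  fix A assume A: "A \<in> \<X>"
  then have [simp]: "A \<in> Obj C" by (rule \<X>_Obj)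
  obtain Z where Z: "zero_object C Z" using ex_zero_object by blast
  then have [simp]: "Z \<in> Obj C" by (simp add: zero_object_def)
  have "confl Z (Zer C Z A) A (Ide C A) A"
  proof (rule conflI_deflation)
    show "deflation C (Ide C A)" by (rule deflation_Ide) simp
  next
    fix T g assume g: "g \<in> Hom C T A" "Ide C A \<cdot> g = Zer C T A"
    note [simp] = g(1)[THEN Hom_facts]
    show "\<exists>u\<in>Hom C T Z. Zer C Z A \<cdot> u = g" using g(2) by (intro bexI[of _ "Zer C T Z"]) (simp_all add: Hom_iff)
  next
    fix T u assume u: "u \<in> Hom C T Z"
    note [simp] = u[THEN Hom_facts]
    show "u = Zer C T Z" by (rule zero_object_unique(1)[OF Z, of _ T]) (simp_all add: Hom_iff)
  qed (simp_all add: Hom_iff)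
  then have "cofibration (Zer C Z A)" using A unfolding cofibration_def by blast
  moreover have "Zer C Z A \<in> Hom C Z A" by (simp add: Hom_iff)
  ultimately show "A \<in> M.cofibrant" using Z by (auto simp: M.cofibrant_def CoFib_cofibration)
qed

lemma fibrant_omega_model: "M.fibrant = Obj C"
proof (intro equalityI subsetI)
  fix A assume A [simp]: "A \<in> Obj C"
  obtain Z where Z: "zero_object C Z" using ex_zero_object by blast
  then have [simp]: "Z \<in> Obj C" by (simp add: zero_object_def)
  have "fibration (Zer C A Z)"
  proof (rule fibrationI[of _ A Z])
    fix W b assume "b \<in> Hom C W Z"
    note [simp] = this[THEN Hom_facts]
    have "Zer C A Z \<cdot> Zer C W A = b" by (rule zero_object_unique(1)[OF Z, of _ W]) (simp_all add: Hom_iff)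
    then show "\<exists>a\<in>Hom C W A. Zer C A Z \<cdot> a = b" by (intro bexI[of _ "Zer C W A"]) (simp_all add: Hom_iff)
  qed (simp add: Hom_iff)
  moreover have "Zer C A Z \<in> Hom C A Z" by (simp add: Hom_iff)
  ultimately show "A \<in> M.fibrant" using Z A by (auto simp: M.fibrant_def Fib_fibration)
qed (simp add: M.fibrant_def)

text \<open>With the cofibrant objects known to be \<X>, the cofibration half of exactness is the
  definition of \<open>CoFib\<close>. In the other half the condition on the kernel is satisfied by
  every object.\<close>

lemma is_exact_omega_model: "M.is_exact \<longleftrightarrow> (\<forall>f. fibration f \<longleftrightarrow> deflation C f)"
proof -
  have "CoFib (omega_model C \<X> \<Y>) = {i. \<exists>d. (i, d) \<in> Confl C \<and> Cod C d \<in> \<X>}"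
    by (simp add: omega_model_def)
  moreover have "{d. \<exists>k. (k, d) \<in> Confl C \<and> Dom C k \<in> Obj C} = {d. deflation C d}"
    using Confl_confl confl_simps(7) unfolding deflation_def by blast
  moreover have "Fib (omega_model C \<X> \<Y>) = {f. fibration f}" using Fib_fibration by blast
  ultimately show ?thesis
    unfolding M.is_exact_def cofibrant_omega_model fibrant_omega_model by (simp add: set_eq_iff)
qed

section \<open>The two implications\<close>

lemma projectives_if_fibrations_deflations:
  assumes eq: "\<And>f. fibration f \<longleftrightarrow> deflation C f"
  shows "enough_projectives C" "\<omega> = projectives C"
proof -
  have sub: "W \<in> projectives C" if W: "W \<in> \<omega>" for W
  proof -
    have "Hom_surj C W d" if "deflation C d" for d
      using that W eq[of d] unfolding Hom_surj_iff[OF deflation_Arr[OF that]] fibration_def by blast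
    then show ?thesis using W \<X>_Obj by (simp add: projectives_def)
  qed
  have cover: "\<exists>W \<in> \<omega>. \<exists>t \<in> Hom C W B. deflation C t" if B: "B \<in> Obj C" for B
  proof -
    obtain W t where W: "W \<in> \<omega>" "t \<in> Hom C W B"
      and approx: "\<And>W' s. \<lbrakk>W' \<in> \<omega>; s \<in> Hom C W' B\<rbrakk> \<Longrightarrow> \<exists>u \<in> Hom C W' W. t \<cdot> u = s"
      by (rule ex_approximation[OF B]) simp_all
    show ?thesis using fibrationI[OF W(2) approx] W eq by blast
  qed
  show "enough_projectives C" unfolding enough_projectives_def using cover sub by blast
  have "P \<in> \<omega>" if P: "P \<in> projectives C" for P
  proof -
    have [simp]: "P \<in> Obj C" using P by (simp add: projectives_def)
    obtain W t where W: "W \<in> \<omega>" "t \<in> Hom C W P" "deflation C t" using cover[of P] by auto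
    obtain s where s: "s \<in> Hom C P W" "t \<cdot> s = Ide C P"
      by (rule projective_lift[OF P W(3,2), of "Ide C P"]) (simp add: Hom_iff)
    show ?thesis using \<X>_retract[OF _ s(1) W(2) s(2)] \<Y>_retract[OF _ s(1) W(2) s(2)] W(1) by blast
  qed
  then show "\<omega> = projectives C" using sub by blast
qed

lemma fibration_iff_deflation_if_projectives:
  assumes enough: "enough_projectives C" and \<omega>: "\<omega> = projectives C"
  shows "fibration f \<longleftrightarrow> deflation C f"
proof
  assume fib: "fibration f"
  then have f: "f \<in> Hom C (Dom C f) (Cod C f)" by (simp add: fibration_def Hom_iff)
  then have "Cod C f \<in> Obj C" using Hom_facts by blast
  then obtain P d where P: "P \<in> projectives C" "d \<in> Hom C P (Cod C f)" "deflation C d"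
    using enough unfolding enough_projectives_def by blast
  obtain u where "u \<in> Hom C P (Dom C f)" "f \<cdot> u = d"
    by (rule fibration_lift[OF fib f _ P(2)]) (use P(1) \<omega> in blast)+
  then show "deflation C f" using deflation_cancel[OF _ f] P(3) by blast
next
  assume d: "deflation C f"
  then have f: "f \<in> Hom C (Dom C f) (Cod C f)" using deflation_Arr by (simp add: Hom_iff)
  show "fibration f"
  proof (rule fibrationI[OF f])
    fix W b assume "W \<in> \<omega>" "b \<in> Hom C W (Cod C f)"
    then show "\<exists>a\<in>Hom C W (Dom C f). f \<cdot> a = b" using projective_lift[OF _ d f] \<omega> by blast
  qed
qed

end

theorem proposition3p11:
  fixes C :: "('o, 'm) exact_cat" and \<X> \<Y> :: "'o set"
  assumes "exact_category C"
    and "weakly_idempotent_complete C"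
    and "complete_cotorsion_pair C \<X> \<Y>"
    and "hereditary_cotorsion_pair C \<X> \<Y>"
    and "contravariantly_finite C (\<X> \<inter> \<Y>)"
  shows "model_structure.is_exact C (omega_model C \<X> \<Y>) \<longleftrightarrow>
           enough_projectives C \<and> \<X> \<inter> \<Y> = projectives C"
proof -
  interpret exact_category C by (rule assms(1))
  interpret omega_setup C \<X> \<Y> by unfold_locales (rule assms(2-5))+
  show ?thesis
    using is_exact_omega_model projectives_if_fibrations_deflations
      fibration_iff_deflation_if_projectives by blast
qed

end
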